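(* Let $a=s-\frac\alpha2$, $b=s+\frac\alpha2$. For $\operatorname{Re}s<\frac12$ and $2s\notin\mathbb Z$, $$\mathcal H(\alpha;Z)=\frac{\Gamma(2s)}{\Gamma(a)\Gamma(b)}\bigl[\mathsf S(\alpha;s)+i\pi\,\mathsf K(\alpha;s)\bigr],$$ where $$\mathsf K(\alpha;s)={}_2F_1(a,b;1;-1),\qquad \mathsf S(\alpha;s)=\sum_{n\ge0}(-1)^n\frac{(a)_n(b)_n}{(n!)^2}\bigl[2\psi(n+1)-\psi(a+n)-\psi(b+n)\bigr],$$ both series (the Gauss series at $-1$ and the series for $\mathsf S$) converging absolutely. In particular, for real $\alpha$ (and real $Z>1$, so $s<0$ real) the imaginary part of $\mathcal H(\alpha;Z)$ is $\pi\,\Gamma(2s)\,{}_2F_1(a,b;1;-1)/(\Gamma(a)\Gamma(b))$. At $\alpha=0$, $$\mathsf K(0;s)=\frac{\Gamma(1+\frac s2)}{\Gamma(1+s)\,\Gamma(1-\frac s2)},\qquad \mathsf S(0;s)=\cos\frac{\pi s}2\cdot\frac{\sqrt\pi\,\Gamma(s+\frac12)\,\Gamma(s)^2}{\Gamma(2s)\,\Gamma(\frac{s+1}2)^2}.$$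
   Context: Here $s=(1-Z)/2$, $\psi$ is the digamma function, $(x)_n$ the Pochhammer symbol, and $$\mathcal H(\alpha;Z)={}_2F_1^{\uparrow}\!\left(s-\tfrac\alpha2,\,s+\tfrac\alpha2;\,2s;\,2\right)$$ denotes the boundary value at $z=2+i0$ of the principal branch of the Gauss function ${}_2F_1(s-\frac\alpha2,s+\frac\alpha2;2s;z)$ (cut along $[1,\infty)$), i.e. the limit as $z\to2$ from $\operatorname{Im}z>0$. If $a$ or $b$ is a nonpositive integer, the right-hand side is understood as its limit in $\alpha$. *)

theory Defs
  imports "HOL-Complex_Analysis.Complex_Analysis"
begin

definition gauss_fps :: "complex \<Rightarrow> complex \<Rightarrow> complex \<Rightarrow> complex fps" where
  "gauss_fps a b c = fps_hypergeo [a, b] [c] 1"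

lemma fps_nth_gauss_fps:
  "fps_nth (gauss_fps a b c) n =
     pochhammer a n * pochhammer b n / (pochhammer c n * fact n)"
  by (simp add: gauss_fps_def)

definition cut_plane :: "complex set" where
  "cut_plane = - {of_real x | x::real. 1 \<le> x}"

(* The principal branch: the analytic continuation of the Gauss series from the unit disc
   to the plane cut along [1,\<infinity>).  By the identity theorem its values on cut_plane are
   uniquely determined; its values on the cut itself are unspecified and never used. *)
definition gauss_2F1 :: "complex \<Rightarrow> complex \<Rightarrow> complex \<Rightarrow> complex \<Rightarrow> complex" where
  "gauss_2F1 a b c = (SOME f. f holomorphic_on cut_plane \<and>
     (\<forall>z\<in>ball 0 1. f z = eval_fps (gauss_fps a b c) z))"

definition gauss_2F1_upper :: "complex \<Rightarrow> complex \<Rightarrow> complex \<Rightarrow> real \<Rightarrow> complex" where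
  "gauss_2F1_upper a b c x = Lim (at (of_real x) within {z. Im z > 0}) (gauss_2F1 a b c)"

definition calH :: "complex \<Rightarrow> complex \<Rightarrow> complex" where
  "calH \<alpha> Z = (let s = (1 - Z) / 2 in gauss_2F1_upper (s - \<alpha> / 2) (s + \<alpha> / 2) (2 * s) 2)"

(* The point -1 lies on the circle of convergence: this is the sum of the Gauss series there. *)
definition K_fun :: "complex \<Rightarrow> complex \<Rightarrow> complex" where
  "K_fun \<alpha> s = eval_fps (gauss_fps (s - \<alpha> / 2) (s + \<alpha> / 2) 1) (-1)"

definition S_term :: "complex \<Rightarrow> complex \<Rightarrow> nat \<Rightarrow> complex" where
  "S_term \<alpha> s n = (let a = s - \<alpha> / 2; b = s + \<alpha> / 2 in
     (-1) ^ n * (pochhammer a n * pochhammer b n / (fact n)\<^sup>2) *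
       (2 * Digamma (of_nat n + 1) - Digamma (a + of_nat n) - Digamma (b + of_nat n)))"

definition S_fun :: "complex \<Rightarrow> complex \<Rightarrow> complex" where
  "S_fun \<alpha> s = (\<Sum>n. S_term \<alpha> s n)"

(* Gamma is 0 at its poles in HOL, so that division by Gamma a * Gamma b is multiplication by
   the entire functions 1/Gamma.  If a or b is a nonpositive integer the factor S_fun has no
   meaning (digamma poles), and only the limit of this expression in \<alpha> may be used. *)
definition H_rhs :: "complex \<Rightarrow> complex \<Rightarrow> complex" where
  "H_rhs \<alpha> s = Gamma (2 * s) / (Gamma (s - \<alpha> / 2) * Gamma (s + \<alpha> / 2)) *
     (S_fun \<alpha> s + \<i> * of_real pi * K_fun \<alpha> s)"

end

theory Submission
  imports Defs "HOL-Real_Asymp.Real_Asymp"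
begin

text \<open>
  Put x = 1 - z.  For c = a + b both exponents of the hypergeometric equation at x = 0
  vanish, so the solutions on the unit disc slit along the negative axis are spanned by the Gauss
  series U(x) = F(a,b;1;x) and a logarithmic solution W(x) = D(x) - U(x) log x, where D
  is the power series whose value at -1 is S.  The branch of F(a,b;a+b;1-x) is therefore
  A U + B W on the lens common to the discs around z = 0 and z = 1, and its behaviour as x tends
  to 0 from the right fixes the two constants.  The coefficients of the Gauss series are
  C/(k+1) + O(1/k^2) with C = \<Gamma>(a+b)/(\<Gamma>(a)\<Gamma>(b)), so F(a,b;a+b;1-x) + C log x converges, and
  its limit C (2\<psi>(1) - \<psi>(a) - \<psi>(b)) is C D(0) (lemma \<open>zb_const_eq\<close>).  Hence A = 0 and B = C
  (lemma \<open>connection_lens\<close>).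

  As Re(a+b) < 1, the series U and D converge absolutely on the closed disc, and the identity
  F(a,b;a+b;1-x) = C W(x) extends to the unit circle without -1.  If z tends to 2 from the upper
  half plane, x tends to -1 from the lower one, where log x tends to -i\<pi>; this gives
  C (S + i\<pi>K) (lemma \<open>boundary_value\<close>).  That the branch exists on the cut plane, and
  that it has a limit at 2 from the whole upper half plane, both follow from the existence of
  solutions of linear equations on star-shaped domains without 0 and 1: solutions on two slit
  planes are glued to the Gauss series, and a solution on a disc around 2 + i/2 continues the branch
  across the cut.

  If a = -m, the branch is a multiple of the polynomial F(-m,b;1;1-z), the factor being given
  by Vandermonde's sum at z = 0.  On the other side only the terms n \<le> m of S keep a pole of the digamma
  function that compensates the zero of 1/\<Gamma>(a), and these terms produce the same polynomial at
  z = 2 (lemma \<open>H_rhs_limit\<close>).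

  For \<alpha> = 0 Pfaff's transformation maps F(s,s;2s;z) to itself and exchanges x and 1/x.
  Comparing the limits at -1 along the two halves of the circle gives S + i\<pi>K = exp(i\<pi>s) (S - i\<pi>K),
  which determines S from K.  Finally K = F(s,s;1;-1) = 2^(-s) F(s,1-s;1;1/2), and Bailey's sum of the
  last series follows from a telescoping relation between the parameters c and c + 2
  (lemma \<open>bailey_step\<close>).
\<close>

section \<open>Linear second order equations in a star-shaped domain\<close>

text \<open>
  Integrating B |w - z0|^n along the segment gains the factor |z - z0|/(n+1).  Iterated, this produces
  the factorials that make the successive approximations of a linear equation converge.
\<close>

lemma primitive_power_bound:
  fixes g h :: "complex \<Rightarrow> complex"
  assumes der: "\<And>w. w \<in> closed_segment z0 z \<Longrightarrow> (g has_field_derivative h w) (at w)"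
    and bnd: "\<And>w. w \<in> closed_segment z0 z \<Longrightarrow> norm (h w) \<le> B * norm (w - z0) ^ n"
    and g0: "g z0 = 0"
  shows "norm (g z) \<le> B * norm (z - z0) ^ Suc n / real (Suc n)"
proof -
  define \<gamma> where "\<gamma> = (\<lambda>t::real. z0 + of_real t * (z - z0))"
  have seg: "\<gamma> t \<in> closed_segment z0 z" if "0 \<le> t" "t \<le> 1" for t
    unfolding \<gamma>_def closed_segment_def using that
    by (auto intro!: exI[of _ t] simp: algebra_simps scaleR_conv_of_real)
  have der\<gamma>: "((\<lambda>t. g (\<gamma> t)) has_vector_derivative h (\<gamma> t) * (z - z0)) (at t)"
    if "0 \<le> t" "t \<le> 1" for t
  proof -
    have "(\<gamma> has_vector_derivative (z - z0)) (at t)"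
      unfolding \<gamma>_def has_vector_derivative_def
      by (auto intro!: derivative_eq_intros simp: scaleR_conv_of_real)
    from field_vector_diff_chain_at[OF this der[OF seg[OF that]]] show ?thesis
      by (simp add: o_def mult_ac)
  qed
  define \<phi> where "\<phi> = (\<lambda>t::real. B * norm (z - z0) ^ Suc n * t ^ Suc n / real (Suc n))"
  have "norm (g (\<gamma> 1) - g (\<gamma> 0)) \<le> \<phi> 1 - \<phi> 0"
  proof (rule differentiable_bound_general[where f' = "\<lambda>t. h (\<gamma> t) * (z - z0)"
        and \<phi>' = "\<lambda>t. B * norm (z - z0) ^ Suc n * t ^ n"])
    show "continuous_on {0..1} (\<lambda>t. g (\<gamma> t))"
      using der\<gamma> by (intro continuous_at_imp_continuous_on ballI)
        (metis atLeastAtMost_iff has_vector_derivative_continuous)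
    show "continuous_on {0..1} \<phi>" unfolding \<phi>_def by (intro continuous_intros) auto
    show "(\<phi> has_vector_derivative B * norm (z - z0) ^ Suc n * t ^ n) (at t)" for t
      unfolding \<phi>_def
      by (auto intro!: derivative_eq_intros
          simp: has_real_derivative_iff_has_vector_derivative[symmetric] field_simps
          simp del: power_Suc of_nat_Suc)
    show "norm (h (\<gamma> t) * (z - z0)) \<le> B * norm (z - z0) ^ Suc n * t ^ n"
      if t: "0 < t" "t < 1" for t
    proof -
      have "norm (h (\<gamma> t)) \<le> B * norm (\<gamma> t - z0) ^ n"
        using t by (intro bnd seg) auto
      also have "norm (\<gamma> t - z0) = t * norm (z - z0)"
        using t by (simp add: \<gamma>_def norm_mult)
      finally have "norm (h (\<gamma> t)) * norm (z - z0) \<le> B * (t * norm (z - z0)) ^ n * norm (z - z0)"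
        by (intro mult_right_mono) auto
      thus ?thesis by (simp add: norm_mult power_mult_distrib mult_ac)
    qed
  qed (use der\<gamma> in auto)
  thus ?thesis by (simp add: \<gamma>_def \<phi>_def g0)
qed

text \<open>
  Successive approximation for the system y' = v, v' = p v + q y.  The n-th correction is an
  (n+1)-st iterated primitive along segments from z0, which exists on a star-shaped domain; on
  compact star-shaped subsets it is bounded by C (2M |z - z0|)^n / n! because of
  \<open>primitive_power_bound\<close>, so the corrections may be summed and differentiated termwise.
\<close>

lemma linear_ode_solution_exists:
  fixes p q :: "complex \<Rightarrow> complex"
  assumes D: "open D" "z0 \<in> D" and star: "\<And>z. z \<in> D \<Longrightarrow> closed_segment z0 z \<subseteq> D"
    and p: "p holomorphic_on D" and q: "q holomorphic_on D"
  obtains y v where "y z0 = A" "v z0 = B"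
    "\<And>z. z \<in> D \<Longrightarrow> (y has_field_derivative v z) (at z)"
    "\<And>z. z \<in> D \<Longrightarrow> (v has_field_derivative (p z * v z + q z * y z)) (at z)"
proof -
  have "\<exists>g. h holomorphic_on D \<longrightarrow> g z0 = 0 \<and> (\<forall>z\<in>D. (g has_field_derivative h z) (at z))" for h
  proof (cases "h holomorphic_on D")
    case True
    have "starlike D" using D star by (auto simp: starlike_def)
    from holomorphic_starlike_primitive[OF holomorphic_on_imp_continuous_on[OF True] this D(1) finite.emptyI]
    obtain g where g: "\<forall>z\<in>D. (g has_field_derivative h z) (at z)"
      using True D(1) holomorphic_on_imp_differentiable_at by auto
    have "\<forall>z\<in>D. ((\<lambda>w. g w - g z0) has_field_derivative h z) (at z)"
      using g by (auto intro!: derivative_eq_intros)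
    thus ?thesis by (intro exI[of _ "\<lambda>w. g w - g z0"]) auto
  qed auto
  then obtain J where J: "\<And>h. h holomorphic_on D \<Longrightarrow> J h z0 = 0"
    "\<And>h z. h holomorphic_on D \<Longrightarrow> z \<in> D \<Longrightarrow> (J h has_field_derivative h z) (at z)"
    by metis
  define dd where "dd = rec_nat ((\<lambda>_. A), (\<lambda>_. B))
     (\<lambda>_ yv. (J (snd yv), J (\<lambda>z. p z * snd yv z + q z * fst yv z)))"
  define dy where "dy = (\<lambda>n. fst (dd n))"
  define dv where "dv = (\<lambda>n. snd (dd n))"
  have dy0: "dy 0 = (\<lambda>_. A)" and dv0: "dv 0 = (\<lambda>_. B)"
    and dyS: "dy (Suc n) = J (dv n)"
    and dvS: "dv (Suc n) = J (\<lambda>z. p z * dv n z + q z * dy n z)" for n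
    by (simp_all add: dy_def dv_def dd_def)
  have Jhol: "J h holomorphic_on D" if "h holomorphic_on D" for h
    using J(2)[OF that] D(1) by (auto simp: holomorphic_on_open)
  have hol: "dy n holomorphic_on D \<and> dv n holomorphic_on D" for n
    by (induction n) (auto simp: dy0 dv0 dyS dvS intro!: Jhol holomorphic_intros p q)
  note hol_y = hol[THEN conjunct1] and hol_v = hol[THEN conjunct2]
  have holF: "(\<lambda>z. p z * dv n z + q z * dy n z) holomorphic_on D" for n
    by (intro holomorphic_intros p q hol_y hol_v)
  \<comment> \<open>The zeroth correction is constant, so the series of derivatives is the original series shifted by one.\<close>
  define dy' where "dy' = (\<lambda>n z. case n of 0 \<Rightarrow> 0 | Suc k \<Rightarrow> dv k z)"
  define dv' where "dv' = (\<lambda>n z. case n of 0 \<Rightarrow> 0 | Suc k \<Rightarrow> p z * dv k z + q z * dy k z)"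
  have der_y: "(dy n has_field_derivative dy' n z) (at z)" if "z \<in> D" for n z
    using that by (cases n) (auto simp: dy'_def dy0 dyS intro!: J(2) hol_v)
  have der_v: "(dv n has_field_derivative dv' n z) (at z)" if "z \<in> D" for n z
    using that by (cases n) (auto simp: dv'_def dv0 dvS intro!: J(2) holF)
  have bound: "\<exists>d h. 0 < d \<and> summable h \<and>
      (\<forall>n. \<forall>w\<in>ball x d \<inter> D. norm (dy n w) \<le> h n \<and> norm (dv n w) \<le> h n)" if x: "x \<in> D" for x
  proof -
    obtain d where d: "d > 0" "cball x d \<subseteq> D"
      using D(1) x open_contains_cball by blast
    \<comment> \<open>All segments from z0 to points of the small disc: compact, and star-shaped about z0.\<close>
    define K where "K = (\<lambda>(t::real,w). z0 + of_real t * (w - z0)) ` ({0..1} \<times> cball x d)"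
    have Kcomp: "compact K" unfolding K_def
      by (intro compact_continuous_image compact_Times)
         (auto intro!: continuous_intros simp: case_prod_unfold)
    have KD: "K \<subseteq> D"
    proof
      fix u assume "u \<in> K"
      then obtain t w where tw: "u = z0 + of_real t * (w - z0)" "0 \<le> t" "t \<le> 1" "w \<in> cball x d"
        by (auto simp: K_def)
      have "u \<in> closed_segment z0 w"
        using tw by (auto simp: closed_segment_def algebra_simps scaleR_conv_of_real intro!: exI[of _ t])
      moreover have "w \<in> D" using tw d by blast
      ultimately show "u \<in> D" using star[of w] by blast
    qed
    have Kstar: "w \<in> K" if zK: "z \<in> K" and wseg: "w \<in> closed_segment z0 z" for w z
    proof -
      obtain t u where tu: "z = z0 + of_real t * (u - z0)" "0 \<le> t" "t \<le> 1" "u \<in> cball x d"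
        using zK unfolding K_def by (auto simp del: mem_cball)
      obtain r where r: "0 \<le> r" "r \<le> 1" "w = (1 - r) *\<^sub>R z0 + r *\<^sub>R z"
        using wseg by (auto simp: closed_segment_def)
      have "w = z0 + of_real (r * t) * (u - z0)"
        by (simp add: r tu algebra_simps scaleR_conv_of_real)
      moreover have "r * t \<in> {0..1}" using r tu by (auto intro: mult_le_one)
      ultimately show ?thesis using tu by (force simp: K_def)
    qed
    have "bounded (p ` K)" "bounded (q ` K)"
      using KD p q Kcomp by (auto intro!: compact_imp_bounded compact_continuous_image
        intro: continuous_on_subset holomorphic_on_imp_continuous_on)
    then obtain M1 M2 where M12: "\<And>z. z \<in> K \<Longrightarrow> norm (p z) \<le> M1" "\<And>z. z \<in> K \<Longrightarrow> norm (q z) \<le> M2"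
      by (auto simp: bounded_iff)
    define M where "M = max 1 (max M1 M2)"
    have M: "norm (p z) \<le> M" "norm (q z) \<le> M" if "z \<in> K" for z
      using M12[OF that] by (auto simp: M_def)
    have M1: "M \<ge> 1" by (simp add: M_def)
    define C where "C = max (norm A) (norm B)"
    have C: "norm A \<le> C" "norm B \<le> C" "0 \<le> C"
      using norm_ge_zero[of A] by (auto simp: C_def simp del: norm_ge_zero)
    have main: "\<forall>z\<in>K. norm (dy n z) \<le> C * (2*M)^n / fact n * norm (z - z0)^n \<and>
                      norm (dv n z) \<le> C * (2*M)^n / fact n * norm (z - z0)^n" for n
    proof (induction n)
      case 0 thus ?case using C by (auto simp: dy0 dv0)
    next
      case (Suc n)
      let ?B = "C * (2*M)^n / fact n"
      have B0: "?B \<ge> 0" using C M1 by auto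
      show ?case
      proof (intro ballI conjI)
        fix z assume z: "z \<in> K"
        have sub: "closed_segment z0 z \<subseteq> D" using star z KD by blast
        have eq: "2 * M * ?B * norm (z - z0) ^ Suc n / real (Suc n)
              = C * (2*M)^Suc n / fact (Suc n) * norm (z - z0)^Suc n"
          by (simp add: field_simps)
        have "norm (dy (Suc n) z) \<le> (2 * M * ?B) * norm (z - z0) ^ Suc n / real (Suc n)"
        proof (rule primitive_power_bound)
          show "(dy (Suc n) has_field_derivative dv n w) (at w)" if "w \<in> closed_segment z0 z" for w
            using that sub by (auto simp: dyS intro!: J(2) hol_v)
          show "dy (Suc n) z0 = 0" by (simp add: dyS J(1) hol_v)
          show "norm (dv n w) \<le> (2 * M * ?B) * norm (w - z0) ^ n" if "w \<in> closed_segment z0 z" for w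
          proof -
            have "norm (dv n w) \<le> ?B * norm (w - z0) ^ n" using Suc Kstar[OF z that] by blast
            also have "\<dots> \<le> (2 * M) * (?B * norm (w - z0) ^ n)"
              using mult_right_mono[of 1 "2 * M" "?B * norm (w - z0) ^ n"] mult_nonneg_nonneg[OF B0, of "norm (w - z0) ^ n"] M1
              by simp
            finally show ?thesis by (simp add: mult_ac)
          qed
        qed
        thus "norm (dy (Suc n) z) \<le> C * (2*M)^Suc n / fact (Suc n) * norm (z - z0)^Suc n"
          unfolding eq .
        have "norm (dv (Suc n) z) \<le> (2 * M * ?B) * norm (z - z0) ^ Suc n / real (Suc n)"
        proof (rule primitive_power_bound)
          show "(dv (Suc n) has_field_derivative p w * dv n w + q w * dy n w) (at w)"
            if "w \<in> closed_segment z0 z" for w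
            using that sub by (auto simp: dvS intro!: J(2) holF)
          show "dv (Suc n) z0 = 0" by (simp add: dvS J(1) holF)
          show "norm (p w * dv n w + q w * dy n w) \<le> (2 * M * ?B) * norm (w - z0) ^ n"
            if "w \<in> closed_segment z0 z" for w
          proof -
            note wK = Kstar[OF z that]
            have "norm (p w * dv n w + q w * dy n w) \<le> norm (p w) * norm (dv n w) + norm (q w) * norm (dy n w)"
              by (metis norm_mult norm_triangle_ineq)
            also have "\<dots> \<le> M * (?B * norm (w - z0) ^ n) + M * (?B * norm (w - z0) ^ n)"
              using wK M Suc M1 by (intro add_mono mult_mono) auto
            finally show ?thesis by (simp add: mult_ac)
          qed
        qed
        thus "norm (dv (Suc n) z) \<le> C * (2*M)^Suc n / fact (Suc n) * norm (z - z0)^Suc n"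
          unfolding eq .
      qed
    qed
    define R where "R = norm (x - z0) + d"
    define h where "h = (\<lambda>n. C * ((2 * M * R) ^ n /\<^sub>R fact n))"
    have "summable h" unfolding h_def by (intro summable_mult summable_exp_generic)
    moreover have "norm (dy n w) \<le> h n \<and> norm (dv n w) \<le> h n" if w: "w \<in> ball x d \<inter> D" for n w
    proof -
      have "w \<in> K" unfolding K_def by (rule image_eqI[of _ _ "(1,w)"]) (use w in auto)
      have "norm (w - z0) \<le> R"
        using w norm_triangle_ineq[of "w - x" "x - z0"] by (auto simp: R_def dist_norm norm_minus_commute)
      hence "C * (2*M)^n / fact n * norm (w - z0)^n \<le> C * (2*M)^n / fact n * R ^ n"
        using C M1 by (intro mult_left_mono power_mono) auto
      also have "\<dots> = h n" by (simp add: h_def power_mult_distrib field_simps)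
      finally show ?thesis using main[of n] \<open>w \<in> K\<close> by fastforce
    qed
    ultimately show ?thesis using d by blast
  qed
  have "\<exists>g g'. \<forall>x\<in>D. ((\<lambda>n. dy n x) sums g x) \<and> ((\<lambda>n. dy' n x) sums g' x) \<and> (g has_field_derivative g' x) (at x)"
    using bound by (intro series_and_derivative_comparison_local D der_y) (blast intro: always_eventually)+
  then obtain Y Y' where Y: "\<And>x. x \<in> D \<Longrightarrow> (\<lambda>n. dy n x) sums Y x"
    "\<And>x. x \<in> D \<Longrightarrow> (\<lambda>n. dy' n x) sums Y' x" "\<And>x. x \<in> D \<Longrightarrow> (Y has_field_derivative Y' x) (at x)" by blast
  have "\<exists>g g'. \<forall>x\<in>D. ((\<lambda>n. dv n x) sums g x) \<and> ((\<lambda>n. dv' n x) sums g' x) \<and> (g has_field_derivative g' x) (at x)"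
    using bound by (intro series_and_derivative_comparison_local D der_v) (blast intro: always_eventually)+
  then obtain V V' where V: "\<And>x. x \<in> D \<Longrightarrow> (\<lambda>n. dv n x) sums V x"
    "\<And>x. x \<in> D \<Longrightarrow> (\<lambda>n. dv' n x) sums V' x" "\<And>x. x \<in> D \<Longrightarrow> (V has_field_derivative V' x) (at x)" by blast
  have Y'eq: "Y' x = V x" if "x \<in> D" for x
  proof -
    have "(\<lambda>n. dy' (Suc n) x) sums V x" using V(1)[OF that] by (simp add: dy'_def)
    hence "(\<lambda>n. dy' n x) sums (V x + dy' 0 x)" by (rule sums_Suc)
    thus ?thesis using Y(2)[OF that] sums_unique2 by (fastforce simp: dy'_def)
  qed
  have V'eq: "V' x = p x * V x + q x * Y x" if "x \<in> D" for x
  proof -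
    have "(\<lambda>n. p x * dv n x + q x * dy n x) sums (p x * V x + q x * Y x)"
      by (intro sums_add sums_mult V Y that)
    hence "(\<lambda>n. dv' (Suc n) x) sums (p x * V x + q x * Y x)" by (simp add: dv'_def)
    hence "(\<lambda>n. dv' n x) sums (p x * V x + q x * Y x + dv' 0 x)" by (rule sums_Suc)
    thus ?thesis using V(2)[OF that] sums_unique2 by (fastforce simp: dv'_def)
  qed
  have y0: "dy n z0 = (if n = 0 then A else 0)" and v0: "dv n z0 = (if n = 0 then B else 0)" for n
    by (cases n; simp add: dy0 dyS J(1) hol_v dv0 dvS holF)+
  have "Y z0 = A" using sums_unique2[OF Y(1)[OF D(2)]] sums_single[of 0 "\<lambda>_. A"] by (simp add: y0)
  moreover have "V z0 = B" using sums_unique2[OF V(1)[OF D(2)]] sums_single[of 0 "\<lambda>_. B"] by (simp add: v0)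
  ultimately show ?thesis using that[of Y V] Y(3) V(3) Y'eq V'eq by metis
qed

section \<open>The hypergeometric equation\<close>

text \<open>
  The derivative is carried as a separate function so that solutions can be composed with
  substitutions without computing iterated derivatives.
\<close>

definition hypergeo_solution ::
    "complex \<Rightarrow> complex \<Rightarrow> complex \<Rightarrow> complex set \<Rightarrow> (complex \<Rightarrow> complex) \<Rightarrow> (complex \<Rightarrow> complex) \<Rightarrow> bool"
  where "hypergeo_solution a b c D y y' \<longleftrightarrow> (\<forall>z\<in>D. (y has_field_derivative y' z) (at z) \<and>
     (\<exists>d. (y' has_field_derivative d) (at z) \<and>
        z * (1 - z) * d + (c - (a + b + 1) * z) * y' z - a * b * y z = 0))"

lemma hypergeo_solution_holomorphic:
  assumes "hypergeo_solution a b c D y y'" "open D"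
  shows "y holomorphic_on D" "y' holomorphic_on D"
  using assms by (auto simp: hypergeo_solution_def holomorphic_on_open)

lemma hypergeo_solution_subset:
  "hypergeo_solution a b c D y y' \<Longrightarrow> E \<subseteq> D \<Longrightarrow> hypergeo_solution a b c E y y'"
  by (auto simp: hypergeo_solution_def)

lemma hypergeo_solution_cmult:
  assumes "hypergeo_solution a b c D y y'"
  shows "hypergeo_solution a b c D (\<lambda>z. k * y z) (\<lambda>z. k * y' z)"
  unfolding hypergeo_solution_def
proof (intro ballI conjI)
  fix z assume z: "z \<in> D"
  obtain d where y: "(y has_field_derivative y' z) (at z)" and
    d: "(y' has_field_derivative d) (at z)"
       "z * (1 - z) * d + (c - (a + b + 1) * z) * y' z - a * b * y z = 0"
    using assms z unfolding hypergeo_solution_def by blast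
  show "((\<lambda>z. k * y z) has_field_derivative k * y' z) (at z)" by (intro DERIV_cmult y)
  have "z * (1 - z) * (k * d) + (c - (a + b + 1) * z) * (k * y' z) - a * b * (k * y z) = 
        k * (z * (1 - z) * d + (c - (a + b + 1) * z) * y' z - a * b * y z)" by (simp add: algebra_simps)
  also have "\<dots> = 0" by (simp only: d(2) mult_zero_right)
  finally show "\<exists>d. ((\<lambda>z. k * y' z) has_field_derivative d) (at z) \<and>
            z * (1 - z) * d + (c - (a + b + 1) * z) * (k * y' z) - a * b * (k * y z) = 0"
    using DERIV_cmult[OF d(1)] by blast
qed

lemma hypergeo_solution_add:
  assumes "hypergeo_solution a b c D y y'" "hypergeo_solution a b c D w w'"
  shows "hypergeo_solution a b c D (\<lambda>z. y z + w z) (\<lambda>z. y' z + w' z)"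
  unfolding hypergeo_solution_def
proof (intro ballI conjI)
  fix z assume z: "z \<in> D"
  obtain d where y: "(y has_field_derivative y' z) (at z)" and
    d: "(y' has_field_derivative d) (at z)"
       "z * (1 - z) * d + (c - (a + b + 1) * z) * y' z - a * b * y z = 0"
    using assms z unfolding hypergeo_solution_def by blast
  obtain e where w: "(w has_field_derivative w' z) (at z)" and
    e: "(w' has_field_derivative e) (at z)"
       "z * (1 - z) * e + (c - (a + b + 1) * z) * w' z - a * b * w z = 0"
    using assms z unfolding hypergeo_solution_def by blast
  show "((\<lambda>z. y z + w z) has_field_derivative y' z + w' z) (at z)" by (intro DERIV_add y w)
  have "z * (1 - z) * (d + e) + (c - (a + b + 1) * z) * (y' z + w' z) - a * b * (y z + w z) = 
        (z * (1 - z) * d + (c - (a + b + 1) * z) * y' z - a * b * y z) +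
        (z * (1 - z) * e + (c - (a + b + 1) * z) * w' z - a * b * w z)" by (simp add: algebra_simps)
  also have "\<dots> = 0" by (simp only: d(2) e(2) add_0_left)
  finally show "\<exists>d. ((\<lambda>z. y' z + w' z) has_field_derivative d) (at z) \<and>
            z * (1 - z) * d + (c - (a + b + 1) * z) * (y' z + w' z) - a * b * (y z + w z) = 0"
    using DERIV_add[OF d(1) e(1)] by blast
qed

lemma hypergeo_solution_exists:
  assumes "open D" "z0 \<in> D" "\<And>z. z \<in> D \<Longrightarrow> closed_segment z0 z \<subseteq> D" "0 \<notin> D" "1 \<notin> D"
  obtains y y' where "hypergeo_solution a b c D y y'" "y z0 = A" "y' z0 = B"
proof -
  have nz: "z \<noteq> 0 \<and> z \<noteq> 1" if "z \<in> D" for z using that assms by auto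
  define p where "p = (\<lambda>z. - (c - (a + b + 1) * z) / (z * (1 - z)))"
  define q where "q = (\<lambda>z. a * b / (z * (1 - z)))"
  have hol: "p holomorphic_on D" "q holomorphic_on D"
    using nz unfolding p_def q_def by (auto intro!: holomorphic_intros)
  obtain y v where yv: "y z0 = A" "v z0 = B"
    "\<And>z. z \<in> D \<Longrightarrow> (y has_field_derivative v z) (at z)"
    "\<And>z. z \<in> D \<Longrightarrow> (v has_field_derivative (p z * v z + q z * y z)) (at z)"
    by (rule linear_ode_solution_exists[OF assms(1,2,3) hol, of A B]) (assumption | blast)+
  have "z * (1 - z) * (p z * v z + q z * y z) + (c - (a + b + 1) * z) * v z - a * b * y z = 0" if "z \<in> D" for z
  proof -
    have "z * (1 - z) * p z = - (c - (a + b + 1) * z)" "z * (1 - z) * q z = a * b"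
      using nz[OF that] by (simp_all add: p_def q_def)
    moreover have "z * (1 - z) * (p z * v z + q z * y z) = (z * (1 - z) * p z) * v z + (z * (1 - z) * q z) * y z"
      by (simp add: algebra_simps)
    ultimately have "z * (1 - z) * (p z * v z + q z * y z) = - (c - (a + b + 1) * z) * v z + a * b * y z"
      by simp
    thus ?thesis by (simp add: algebra_simps)
  qed
  hence "hypergeo_solution a b c D y v" using yv unfolding hypergeo_solution_def by blast
  thus ?thesis using that yv by blast
qed

lemma DERIV_translate:
  fixes f :: "complex \<Rightarrow> complex"
  assumes "(f has_field_derivative d) (at (z0 + x))"
  shows "((\<lambda>x. f (z0 + x)) has_field_derivative d) (at x)"
proof -
  have "((\<lambda>x. z0 + x) has_field_derivative 1) (at x)" by (auto intro!: derivative_eq_intros)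
  from DERIV_chain2[OF assms this] show ?thesis by simp
qed

lemma fps_eqI_expansion:
  fixes f g :: "complex \<Rightarrow> complex"
  assumes "f has_fps_expansion F" "eventually (\<lambda>z. f z = 0) (nhds 0)"
  shows "F = 0"
  using assms fps_expansion_unique_complex has_fps_expansion_0_iff by blast

text \<open>
  The equation at z0 as an identity of formal power series; uniqueness of solutions, both at regular points
  and at the singular point 0, then is a statement on recurrences for coefficients.
\<close>

lemma hypergeo_solution_fps:
  assumes sol: "hypergeo_solution a b c D y y'" and D: "open D" "z0 \<in> D"
  obtains F where "(\<lambda>x. y (z0 + x)) has_fps_expansion F" "fps_nth F 1 = y' z0"
    "(fps_const z0 + fps_X) * (1 - (fps_const z0 + fps_X)) * fps_deriv (fps_deriv F) +
     (fps_const c - fps_const (a + b + 1) * (fps_const z0 + fps_X)) * fps_deriv F - fps_const (a * b) * F = 0"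
proof -
  define F where "F = fps_expansion y z0"
  note hol = hypergeo_solution_holomorphic[OF sol D(1)]
  have "y analytic_on {z0}" using hol D by (auto simp: analytic_at)
  hence F: "(\<lambda>x. y (z0 + x)) has_fps_expansion F"
    unfolding F_def by (rule analytic_at_imp_has_fps_expansion)
  have ev: "eventually (\<lambda>x. z0 + x \<in> D) (nhds 0)"
  proof -
    have "((\<lambda>x. z0 + x) \<longlongrightarrow> z0 + 0) (nhds 0)" by (intro tendsto_intros filterlim_ident)
    thus ?thesis using D by (simp add: topological_tendstoD)
  qed
  have d1: "deriv (\<lambda>x. y (z0 + x)) x = y' (z0 + x)" if "z0 + x \<in> D" for x
  proof (rule DERIV_imp_deriv)
    have "(y has_field_derivative y' (z0 + x)) (at (z0 + x))" using sol that by (auto simp: hypergeo_solution_def)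
    thus "((\<lambda>x. y (z0 + x)) has_field_derivative y' (z0 + x)) (at x)"
      by (rule DERIV_translate)
  qed
  have F1: "(\<lambda>x. y' (z0 + x)) has_fps_expansion fps_deriv F"
  proof -
    have "eventually (\<lambda>x. deriv (\<lambda>x. y (z0 + x)) x = y' (z0 + x)) (nhds 0)"
      using ev by eventually_elim (rule d1)
    from has_fps_expansion_cong[OF this refl] show ?thesis
      using has_fps_expansion_deriv[OF F] by blast
  qed
  have d2: "(z0 + x) * (1 - (z0 + x)) * deriv (\<lambda>x. y' (z0 + x)) x + (c - (a+b+1) * (z0+x)) * y' (z0+x) - a*b* y (z0 + x) = 0"
    if xD: "z0 + x \<in> D" for x
  proof -
    obtain d where d: "(y' has_field_derivative d) (at (z0 + x))" 
       "(z0+x) * (1 - (z0+x)) * d + (c - (a + b + 1) * (z0+x)) * y' (z0+x) - a * b * y (z0+x) = 0"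
      using sol xD unfolding hypergeo_solution_def by blast
    have "deriv (\<lambda>x. y' (z0 + x)) x = d"
      by (intro DERIV_imp_deriv DERIV_translate d(1))
    thus ?thesis using d(2) by (simp only:)
  qed
  have F2: "deriv (\<lambda>x. y' (z0 + x)) has_fps_expansion fps_deriv (fps_deriv F)"
    by (rule has_fps_expansion_deriv[OF F1])
  have "(\<lambda>x. (z0 + x) * (1 - (z0 + x)) * deriv (\<lambda>x. y' (z0 + x)) x + (c - (a+b+1) * (z0+x)) * y' (z0+x) - a*b* y (z0 + x))
     has_fps_expansion ((fps_const z0 + fps_X) * (1 - (fps_const z0 + fps_X)) * fps_deriv (fps_deriv F) +
     (fps_const c - fps_const (a + b + 1) * (fps_const z0 + fps_X)) * fps_deriv F - fps_const (a * b) * F)"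
    by (intro fps_expansion_intros F F1 F2)
  moreover have "eventually (\<lambda>x. (z0 + x) * (1 - (z0 + x)) * deriv (\<lambda>x. y' (z0 + x)) x + (c - (a+b+1) * (z0+x)) * y' (z0+x) - a*b* y (z0 + x) = 0) (nhds 0)"
    using ev by eventually_elim (rule d2)
  moreover have "fps_nth F 1 = y' z0"
    using fps_nth_fps_expansion[OF F, of 1] d1[of 0] D by simp
  ultimately show ?thesis using that[OF F] fps_eqI_expansion by blast
qed

text \<open>
  At a regular point the leading coefficient z0 (1 - z0) of the equation is invertible, so the
  recurrence for the Taylor coefficients expresses each of them by the two preceding ones.
\<close>

lemma hypergeo_solution_zero:
  assumes sol: "hypergeo_solution a b c D y y'" and D: "open D" "connected D" "z0 \<in> D"
    and z0: "z0 \<noteq> 0" "z0 \<noteq> 1" and ini: "y z0 = 0" "y' z0 = 0" and z: "z \<in> D"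
  shows "y z = 0"
proof -
  obtain F where F: "(\<lambda>x. y (z0 + x)) has_fps_expansion F" "fps_nth F 1 = y' z0" and
    eq: "(fps_const z0 + fps_X) * (1 - (fps_const z0 + fps_X)) * fps_deriv (fps_deriv F) +
     (fps_const c - fps_const (a + b + 1) * (fps_const z0 + fps_X)) * fps_deriv F - fps_const (a * b) * F = 0"
    using hypergeo_solution_fps[OF sol D(1,3)] by metis
  have F0: "fps_nth F 0 = 0" using has_fps_expansion_imp_0_eq_fps_nth_0[OF F(1)] ini by simp
  define P where "P = (fps_const z0 + fps_X) * (1 - (fps_const z0 + fps_X))"
  define Q where "Q = (fps_const c - fps_const (a + b + 1) * (fps_const z0 + fps_X))"
  have P0: "fps_nth P 0 = z0 * (1 - z0)" by (simp add: P_def)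
  have coeff: "fps_nth F n = 0" for n
  proof (induction n rule: less_induct)
    case (less n)
    consider "n = 0" | "n = 1" | m where "n = Suc (Suc m)" by (metis One_nat_def not0_implies_Suc)
    thus ?case
    proof cases
      case 3
      have "fps_nth (P * fps_deriv (fps_deriv F)) m = (\<Sum>i=0..m. fps_nth P i * fps_nth (fps_deriv (fps_deriv F)) (m - i))"
        by (rule fps_mult_nth)
      also have "\<dots> = (\<Sum>i\<in>{0}. fps_nth P i * fps_nth (fps_deriv (fps_deriv F)) (m - i))"
      proof (rule sum.mono_neutral_right)
        show "\<forall>i\<in>{0..m} - {0}. P $ i * fps_deriv (fps_deriv F) $ (m - i) = 0"
        proof
          fix i assume "i \<in> {0..m} - {0}"
          hence "fps_nth F (Suc (Suc (m - i))) = 0" by (intro less) (auto simp: 3)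
          thus "P $ i * fps_deriv (fps_deriv F) $ (m - i) = 0" by simp
        qed
      qed auto
      finally have 1: "fps_nth (P * fps_deriv (fps_deriv F)) m = 
         z0 * (1 - z0) * (of_nat (m + 1) * (of_nat (m + 2) * fps_nth F n))" by (simp add: P0 3)
      have 2: "fps_nth (Q * fps_deriv F) m = 0" unfolding fps_mult_nth
        by (intro sum.neutral) (auto simp: 3 less)
      have 4: "fps_nth (fps_const (a * b) * F) m = 0" by (simp add: less 3)
      have "fps_nth (P * fps_deriv (fps_deriv F) + Q * fps_deriv F - fps_const (a * b) * F) m = 0"
        using eq unfolding P_def Q_def by simp
      hence "z0 * (1 - z0) * (of_nat (m + 1) * (of_nat (m + 2) * fps_nth F n)) = 0"
        unfolding fps_add_nth fps_sub_nth 1 2 4 by simp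
      moreover have "of_nat (m + 1) \<noteq> (0::complex)" "of_nat (m + 2) \<noteq> (0::complex)"
        unfolding of_nat_eq_0_iff by auto
      ultimately show ?thesis using z0 by auto
    qed (use F0 F(2) ini in auto)
  qed
  hence "F = 0" by (simp add: fps_eq_iff)
  hence "eventually (\<lambda>x. y (z0 + x) = 0) (nhds 0)" using F(1) by (simp add: has_fps_expansion_0_iff)
  then obtain S where S: "open S" "0 \<in> S" "\<And>x. x \<in> S \<Longrightarrow> y (z0 + x) = 0"
    unfolding eventually_nhds by blast
  define T where "T = (\<lambda>x. z0 + x) ` S \<inter> D"
  show ?thesis
  proof (rule analytic_continuation_open[of T D y "\<lambda>_. 0"])
    show "open T" unfolding T_def by (intro open_Int open_translation S D)
    have "z0 \<in> (\<lambda>x. z0 + x) ` S" by (rule image_eqI[of _ _ 0]) (use S in auto)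
    thus "T \<noteq> {}" using D by (auto simp: T_def)
    show "y holomorphic_on D" by (rule hypergeo_solution_holomorphic[OF sol D(1)])
  qed (use D z S in \<open>auto simp: T_def\<close>)
qed

lemma hypergeo_solution_unique:
  assumes sol: "hypergeo_solution a b c D y y'" "hypergeo_solution a b c D w w'"
    and D: "open D" "connected D" "z0 \<in> D"
    and z0: "z0 \<noteq> 0" "z0 \<noteq> 1" and ini: "y z0 = w z0" "y' z0 = w' z0" and z: "z \<in> D"
  shows "y z = w z"
proof -
  have "hypergeo_solution a b c D (\<lambda>z. y z + -1 * w z) (\<lambda>z. y' z + -1 * w' z)"
    by (intro hypergeo_solution_add hypergeo_solution_cmult sol)
  from hypergeo_solution_zero[OF this D z0 _ _ z] have "y z + -1 * w z = 0"
    unfolding ini by simp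
  thus ?thesis by simp
qed

lemma not_nonpos_Int_add_of_nat:
  fixes z :: complex
  assumes "z \<notin> \<int>\<^sub>\<le>\<^sub>0"
  shows "z + of_nat n \<noteq> 0"
proof
  assume "z + of_nat n = 0"
  hence "z = - of_nat n" by (simp add: eq_neg_iff_add_eq_0)
  thus False using assms by simp
qed

lemma pochhammer_not_nonpos_Int:
  fixes z :: complex
  assumes "z \<notin> \<int>\<^sub>\<le>\<^sub>0"
  shows "pochhammer z n \<noteq> 0"
  using assms pochhammer_eq_0_imp_nonpos_Int by blast

text \<open>
  The ratio test applies unless a or b is a nonpositive integer; in that case the series is a polynomial.
\<close>

lemma gauss_fps_conv_radius:
  assumes "c \<notin> \<int>\<^sub>\<le>\<^sub>0"
  shows "fps_conv_radius (gauss_fps a b c) \<ge> 1"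
proof -
  have nz: "c + of_nat n \<noteq> 0" for n
    by (rule not_nonpos_Int_add_of_nat[OF assms])
  have pnz: "pochhammer c n \<noteq> 0" for n
    by (rule pochhammer_not_nonpos_Int[OF assms])
  show ?thesis
  proof (cases "\<exists>n. fps_nth (gauss_fps a b c) n = 0")
    case True
    then obtain n where "pochhammer a n = 0 \<or> pochhammer b n = 0"
      using pnz by (auto simp: fps_nth_gauss_fps)
    then have "pochhammer a m = 0 \<or> pochhammer b m = 0" if "m \<ge> n" for m
      using that pochhammer_eq_0_mono by blast
    hence "fps_nth (gauss_fps a b c) m = 0" if "m \<ge> n" for m
      using that by (auto simp: fps_nth_gauss_fps)
    hence "eventually (\<lambda>m. fps_nth (gauss_fps a b c) m = 0) sequentially"
      using eventually_ge_at_top[of n] by (rule eventually_mono[rotated])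
    from conv_radius_cong'[OF this] show ?thesis by (simp add: fps_conv_radius_def)
  next
    case False
    have "(\<lambda>n. (c / of_nat (Suc n) + of_nat n / of_nat (Suc n)) / 
         ((a / of_nat (Suc n) + of_nat n / of_nat (Suc n)) * (b / of_nat (Suc n) + of_nat n / of_nat (Suc n))))
          \<longlonglongrightarrow> (0 + 1) / ((0 + 1) * (0 + 1))"
      by (intro tendsto_intros LIMSEQ_n_over_Suc_n LIMSEQ_Suc[OF tendsto_divide_0[OF tendsto_const tendsto_of_nat]]) auto
    hence "(\<lambda>n. norm ((c / of_nat (Suc n) + of_nat n / of_nat (Suc n)) / 
         ((a / of_nat (Suc n) + of_nat n / of_nat (Suc n)) * (b / of_nat (Suc n) + of_nat n / of_nat (Suc n)))))
          \<longlonglongrightarrow> 1"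
      by (rule tendsto_norm[THEN tendsto_eq_rhs]) simp
    also have "(\<lambda>n. norm ((c / of_nat (Suc n) + of_nat n / of_nat (Suc n)) / 
         ((a / of_nat (Suc n) + of_nat n / of_nat (Suc n)) * (b / of_nat (Suc n) + of_nat n / of_nat (Suc n))))) =
         (\<lambda>n. norm (fps_nth (gauss_fps a b c) n) / norm (fps_nth (gauss_fps a b c) (Suc n)))"
    proof
      fix n
      have f: "fps_nth (gauss_fps a b c) n \<noteq> 0" "fps_nth (gauss_fps a b c) (Suc n) \<noteq> 0" using False by auto
      have n0: "of_nat (Suc n) \<noteq> (0::complex)" unfolding of_nat_eq_0_iff by simp
      have S: "pochhammer x (Suc n) = pochhammer x n * (x + of_nat n)" for x :: complex
        by (simp add: pochhammer_Suc)
      have "a + of_nat n \<noteq> 0" "b + of_nat n \<noteq> 0" "pochhammer a n \<noteq> 0" "pochhammer b n \<noteq> 0"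
        using f by (auto simp: fps_nth_gauss_fps S)
      hence "fps_nth (gauss_fps a b c) n / fps_nth (gauss_fps a b c) (Suc n) =
         (c + of_nat n) * of_nat (Suc n) / ((a + of_nat n) * (b + of_nat n))"
        using pnz[of n] n0 nz[of n] unfolding fps_nth_gauss_fps S fact_Suc
        by (simp add: divide_simps del: of_nat_Suc)
      also have "\<dots> = (c / of_nat (Suc n) + of_nat n / of_nat (Suc n)) / 
         ((a / of_nat (Suc n) + of_nat n / of_nat (Suc n)) * (b / of_nat (Suc n) + of_nat n / of_nat (Suc n)))"
        using n0 by (simp add: add_divide_distrib[symmetric] del: of_nat_Suc)
      finally show "norm ((c / of_nat (Suc n) + of_nat n / of_nat (Suc n)) / 
         ((a / of_nat (Suc n) + of_nat n / of_nat (Suc n)) * (b / of_nat (Suc n) + of_nat n / of_nat (Suc n)))) =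
         norm (fps_nth (gauss_fps a b c) n) / norm (fps_nth (gauss_fps a b c) (Suc n))"
        by (metis norm_divide)
    qed
    finally have "conv_radius (fps_nth (gauss_fps a b c)) = ereal 1"
      using False by (intro conv_radius_ratio_limit_nonzero[of _ 1]) (auto simp: one_ereal_def)
    thus ?thesis by (simp add: fps_conv_radius_def)
  qed
qed

lemma gauss_fps_Suc:
  assumes "c \<notin> \<int>\<^sub>\<le>\<^sub>0"
  shows "of_nat (Suc n) * (c + of_nat n) * fps_nth (gauss_fps a b c) (Suc n) =
         (a + of_nat n) * (b + of_nat n) * fps_nth (gauss_fps a b c) n"
proof -
  have nz: "c + of_nat n \<noteq> 0" for n
    by (rule not_nonpos_Int_add_of_nat[OF assms])
  have pnz: "pochhammer c n \<noteq> 0" for n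
    by (rule pochhammer_not_nonpos_Int[OF assms])
  have n0: "of_nat (Suc n) \<noteq> (0::complex)" unfolding of_nat_eq_0_iff by simp
  have S: "pochhammer x (Suc n) = pochhammer x n * (x + of_nat n)" for x :: complex
    by (simp add: pochhammer_Suc)
  show ?thesis unfolding fps_nth_gauss_fps S fact_Suc
    using pnz[of n] nz[of n] n0 by (simp add: divide_simps del: of_nat_Suc)
qed

lemma gauss_ode_coeff:
  fixes F :: "complex fps"
  shows "fps_nth (fps_X * (1 - fps_X) * fps_deriv (fps_deriv F) +
     (fps_const c - fps_const (a + b + 1) * fps_X) * fps_deriv F - fps_const (a * b) * F) n =
   of_nat (Suc n) * (c + of_nat n) * fps_nth F (Suc n) - (a + of_nat n) * (b + of_nat n) * fps_nth F n"
proof -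
  have eq: "fps_X * (1 - fps_X) * fps_deriv (fps_deriv F) +
     (fps_const c - fps_const (a + b + 1) * fps_X) * fps_deriv F - fps_const (a * b) * F =
     fps_X * fps_deriv (fps_deriv F) - fps_X * (fps_X * fps_deriv (fps_deriv F)) + fps_const c * fps_deriv F
     - fps_const (a + b + 1) * (fps_X * fps_deriv F) - fps_const (a * b) * F"
  proof -
    have "X * (1 - X) * A + (d - e * X) * B - f * F =
       X * A - X * (X * A) + d * B - e * (X * B) - f * F" for X A B d e f :: "complex fps"
      by (simp add: algebra_simps)
    thus ?thesis .
  qed
  have 1: "fps_nth (fps_X * fps_deriv (fps_deriv F)) n = of_nat n * of_nat (Suc n) * fps_nth F (Suc n)"
    by (cases n) simp_all
  have 2: "fps_nth (fps_X * (fps_X * fps_deriv (fps_deriv F))) n = of_nat n * (of_nat n - 1) * fps_nth F n"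
    by (cases n; cases "n - 1") (simp_all add: algebra_simps)
  have 3: "fps_nth (fps_X * fps_deriv F) n = of_nat n * fps_nth F n"
    by (cases n) simp_all
  have 4: "fps_nth (fps_deriv F) n = of_nat (Suc n) * fps_nth F (Suc n)" by simp
  show ?thesis
    unfolding eq fps_add_nth fps_sub_nth fps_mult_left_const_nth 1 2 3 4 
    by (simp add: ring_distribs mult_ac)
qed

lemma eval_gauss_operator:
  fixes F :: "complex fps"
  assumes z: "norm z < fps_conv_radius F"
  shows "eval_fps (fps_X * (1 - fps_X) * fps_deriv (fps_deriv F) +
     (fps_const c - fps_const (a + b + 1) * fps_X) * fps_deriv F - fps_const (a * b) * F) z =
     z * (1 - z) * eval_fps (fps_deriv (fps_deriv F)) z + (c - (a + b + 1) * z) * eval_fps (fps_deriv F) z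
      - a * b * eval_fps F z"
proof -
  have z1: "norm z < fps_conv_radius (fps_deriv F)" using z fps_conv_radius_deriv[of F] by order
  have z2: "norm z < fps_conv_radius (fps_deriv (fps_deriv F))" using z1 fps_conv_radius_deriv[of "fps_deriv F"] by order
  have m: "fps_conv_radius (p * q) \<ge> min (fps_conv_radius p) (fps_conv_radius q)" for p q :: "complex fps"
    by (rule fps_conv_radius_mult)
  define p1 :: "complex poly" where "p1 = [:0, 1, -1:]"
  define p2 :: "complex poly" where "p2 = [:c, -(a+b+1):]"
  have e1: "fps_X * (1 - fps_X) = fps_of_poly p1" by (simp add: p1_def fps_of_poly_pCons algebra_simps)
  have e2: "fps_const c - fps_const (a + b + 1) * fps_X = fps_of_poly p2"
    by (simp add: p2_def fps_of_poly_pCons algebra_simps fps_const_neg[symmetric] fps_const_add[symmetric]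
           del: fps_const_neg fps_const_add)
  have r1: "norm z < fps_conv_radius (fps_of_poly p1 * fps_deriv (fps_deriv F))"
    using m[of "fps_of_poly p1" "fps_deriv (fps_deriv F)"] z2 by (auto simp: min_def split: if_splits)
  have r2: "norm z < fps_conv_radius (fps_of_poly p2 * fps_deriv F)"
    using m[of "fps_of_poly p2" "fps_deriv F"] z1 by (auto simp: min_def split: if_splits)
  have r3: "norm z < fps_conv_radius (fps_const (a*b) * F)"
    using m[of "fps_const (a*b)" "F"] z by (auto simp: min_def split: if_splits)
  have r12: "norm z < fps_conv_radius (fps_of_poly p1 * fps_deriv (fps_deriv F) + fps_of_poly p2 * fps_deriv F)"
    using fps_conv_radius_add[of "fps_of_poly p1 * fps_deriv (fps_deriv F)" "fps_of_poly p2 * fps_deriv F"] r1 r2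
    by (auto simp: min_def split: if_splits)
  have "eval_fps (fps_of_poly p1 * fps_deriv (fps_deriv F) + fps_of_poly p2 * fps_deriv F - fps_const (a * b) * F) z
     = poly p1 z * eval_fps (fps_deriv (fps_deriv F)) z + poly p2 z * eval_fps (fps_deriv F) z - a * b * eval_fps F z"
    using z z1 z2 r1 r2 r3 r12 by (simp add: eval_fps_diff eval_fps_add eval_fps_mult)
  thus ?thesis unfolding e1 e2 by (simp add: p1_def p2_def algebra_simps)
qed

lemma gauss_series_solution_eball:
  assumes c: "c \<notin> \<int>\<^sub>\<le>\<^sub>0"
  shows "hypergeo_solution a b c (eball 0 (fps_conv_radius (gauss_fps a b c)))
     (eval_fps (gauss_fps a b c)) (eval_fps (fps_deriv (gauss_fps a b c)))"
  unfolding hypergeo_solution_def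
proof (intro ballI conjI exI)
  let ?F = "gauss_fps a b c"
  fix z :: complex assume "z \<in> eball 0 (fps_conv_radius ?F)"
  hence z: "norm z < fps_conv_radius ?F" by simp
  have z1: "norm z < fps_conv_radius (fps_deriv ?F)" using z fps_conv_radius_deriv[of ?F] by order
  show "(eval_fps ?F has_field_derivative eval_fps (fps_deriv ?F) z) (at z)"
    by (rule has_field_derivative_eval_fps[OF z])
  show "(eval_fps (fps_deriv ?F) has_field_derivative eval_fps (fps_deriv (fps_deriv ?F)) z) (at z)"
    by (rule has_field_derivative_eval_fps[OF z1])
  have L: "fps_X * (1 - fps_X) * fps_deriv (fps_deriv ?F) +
     (fps_const c - fps_const (a + b + 1) * fps_X) * fps_deriv ?F - fps_const (a * b) * ?F = 0"
    unfolding fps_eq_iff gauss_ode_coeff gauss_fps_Suc[OF c] by simp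
  show "z * (1 - z) * eval_fps (fps_deriv (fps_deriv ?F)) z + (c - (a + b + 1) * z) * eval_fps (fps_deriv ?F) z - a * b * eval_fps ?F z = 0"
    using eval_gauss_operator[OF z, of c a b] unfolding L by simp
qed

lemma gauss_series_solution:
  assumes c: "c \<notin> \<int>\<^sub>\<le>\<^sub>0"
  shows "hypergeo_solution a b c (ball 0 1) (eval_fps (gauss_fps a b c)) (eval_fps (fps_deriv (gauss_fps a b c)))"
proof (rule hypergeo_solution_subset[OF gauss_series_solution_eball[OF c]])
  show "(ball 0 1 :: complex set) \<subseteq> eball 0 (fps_conv_radius (gauss_fps a b c))"
  proof
    fix z :: complex assume "z \<in> ball 0 1"
    hence "ereal (norm z) < 1" by (simp add: one_ereal_def)
    also have "1 \<le> fps_conv_radius (gauss_fps a b c)" by (rule gauss_fps_conv_radius[OF c])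
    finally show "z \<in> eball 0 (fps_conv_radius (gauss_fps a b c))" by simp
  qed
qed

text \<open>
  At the singular point 0 the recurrence (n+1)(c+n) u(n+1) = (a+n)(b+n) u(n) determines a
  holomorphic solution from its value at 0 as long as c + n never vanishes.
\<close>

lemma hypergeo_solution_at_0:
  assumes sol: "hypergeo_solution a b c (ball 0 r) y y'" and r: "r > 0" and c: "c \<notin> \<int>\<^sub>\<le>\<^sub>0"
    and z: "norm z < r"
  shows "y z = y 0 * eval_fps (gauss_fps a b c) z"
proof -
  obtain F where F: "(\<lambda>x. y (0 + x)) has_fps_expansion F" and
    eq: "(fps_const 0 + fps_X) * (1 - (fps_const 0 + fps_X)) * fps_deriv (fps_deriv F) +
     (fps_const c - fps_const (a + b + 1) * (fps_const 0 + fps_X)) * fps_deriv F - fps_const (a * b) * F = 0"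
    using hypergeo_solution_fps[OF sol, of 0] r by (metis centre_in_ball open_ball)
  have nz: "c + of_nat n \<noteq> 0" for n
    by (rule not_nonpos_Int_add_of_nat[OF c])
  have rec: "of_nat (Suc n) * (c + of_nat n) * fps_nth F (Suc n) = (a + of_nat n) * (b + of_nat n) * fps_nth F n" for n
  proof -
    have eq': "fps_X * (1 - fps_X) * fps_deriv (fps_deriv F) +
       (fps_const c - fps_const (a + b + 1) * fps_X) * fps_deriv F - fps_const (a * b) * F = 0"
      using eq by (simp only: fps_const_0_eq_0 add_0_left)
    show ?thesis using gauss_ode_coeff[of F c a b n] unfolding eq' by simp
  qed
  have F0: "fps_nth F 0 = y 0" using has_fps_expansion_imp_0_eq_fps_nth_0[OF F(1)] by simp
  have "fps_nth F n = y 0 * fps_nth (gauss_fps a b c) n" for n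
  proof (induction n)
    case 0 show ?case by (simp add: F0 fps_nth_gauss_fps)
  next
    case (Suc n)
    have "of_nat (Suc n) * (c + of_nat n) * fps_nth F (Suc n) = 
          y 0 * ((a + of_nat n) * (b + of_nat n) * fps_nth (gauss_fps a b c) n)" unfolding rec Suc by simp
    also have "\<dots> = of_nat (Suc n) * (c + of_nat n) * (y 0 * fps_nth (gauss_fps a b c) (Suc n))"
      unfolding gauss_fps_Suc[OF c, symmetric] by simp
    finally show ?case using nz[of n] of_nat_neq_0[of n, where ?'a = complex] by (simp del: of_nat_Suc)
  qed
  hence Feq: "F = fps_const (y 0) * gauss_fps a b c" by (simp add: fps_eq_iff)
  have hol: "y holomorphic_on eball 0 (ereal r)" using hypergeo_solution_holomorphic[OF sol] by simp
  have "(\<lambda>n. fps_nth F n * z ^ n) sums y z"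
    using has_fps_expansion_imp_sums_complex[of y F r z] F hol z by simp
  hence s: "(\<lambda>n. y 0 * (fps_nth (gauss_fps a b c) n * z ^ n)) sums y z" by (simp add: Feq mult.assoc)
  show ?thesis
  proof (cases "y 0 = 0")
    case True
    have "(\<lambda>n. 0) sums y z" using s unfolding True by simp
    from sums_unique2[OF this sums_0] show ?thesis using True by simp
  next
    case False
    have "eval_fps (gauss_fps a b c) z = y z / y 0"
      unfolding eval_fps_def by (rule sums_unique[symmetric, OF sums_mult_D[OF s False]])
    thus ?thesis using False by simp
  qed
qed

section \<open>The principal branch and its boundary value at 2\<close>

text \<open>
  Complements of real rays in a form for which being star-shaped about a point of I follows at once from
  the convexity of I.
\<close>

definition slit_plane :: "real set \<Rightarrow> complex set" where
  "slit_plane I = {z. Im z = 0 \<longrightarrow> Re z \<in> I}"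

lemma open_slit_plane:
  assumes "open I"
  shows "open (slit_plane I)"
proof -
  have "closed ({z. Im z = 0} \<inter> Re -` (- I))"
    by (intro closed_Int closed_Collect_eq continuous_closed_vimage continuous_intros)
       (use assms in auto)
  moreover have "slit_plane I = - ({z. Im z = 0} \<inter> Re -` (- I))" by (auto simp: slit_plane_def)
  ultimately show ?thesis by (simp only: open_Compl)
qed

lemma slit_plane_star:
  assumes "convex I" "r \<in> I" "z \<in> slit_plane I"
  shows "closed_segment (of_real r) z \<subseteq> slit_plane I"
proof
  fix u assume "u \<in> closed_segment (of_real r) z"
  then obtain t where t: "0 \<le> t" "t \<le> 1" "u = (1 - t) *\<^sub>R of_real r + t *\<^sub>R z"
    by (auto simp: closed_segment_def)
  show "u \<in> slit_plane I"
  proof (cases "t = 0 \<or> Im z \<noteq> 0")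
    case True
    thus ?thesis using t assms(2) by (auto simp: slit_plane_def)
  next
    case False
    hence "Re z \<in> I" using assms(3) by (auto simp: slit_plane_def)
    hence "(1 - t) *\<^sub>R r + t *\<^sub>R Re z \<in> I" using t assms(1,2) by (intro convexD) auto
    thus ?thesis using t by (auto simp: slit_plane_def)
  qed
qed

lemma connected_slit_plane_Int_convex:
  assumes "convex I" "r \<in> I" "convex C" "of_real r \<in> C"
  shows "connected (slit_plane I \<inter> C)"
proof (rule starlike_imp_connected)
  have "of_real r \<in> slit_plane I" using assms(2) by (simp add: slit_plane_def)
  moreover have "closed_segment (of_real r) z \<subseteq> slit_plane I \<inter> C" if "z \<in> slit_plane I \<inter> C" for z
    using that slit_plane_star[OF assms(1,2)] assms(3,4) by (auto dest: closed_segment_subset)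
  ultimately show "starlike (slit_plane I \<inter> C)" using assms(4) unfolding starlike_def by blast
qed

lemma cut_plane_eq: "cut_plane = slit_plane {..<1}"
proof -
  have "(\<exists>x. z = complex_of_real x \<and> 1 \<le> x) \<longleftrightarrow> Im z = 0 \<and> 1 \<le> Re z" for z
    by (auto intro!: exI[of _ "Re z"] simp: complex_eq_iff)
  thus ?thesis by (auto simp: cut_plane_def slit_plane_def)
qed

lemma open_cut_plane: "open cut_plane"
  unfolding cut_plane_eq by (rule open_slit_plane) auto

lemma connected_cut_plane: "connected cut_plane"
  using connected_slit_plane_Int_convex[of "{..<1}" 0 UNIV] unfolding cut_plane_eq by simp

lemma ball_subset_cut_plane: "ball 0 1 \<subseteq> cut_plane"
proof
  fix z :: complex assume "z \<in> ball 0 1"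
  thus "z \<in> cut_plane" using complex_Re_le_cmod[of z] by (auto simp: cut_plane_eq slit_plane_def)
qed

text \<open>
  The Gauss series is continued as a solution of the equation, once from 1/2 to the plane without the
  rays below 0 and above 1, and once from -1/2 to the plane without the nonnegative ray.  Both
  agree with the series inside the unit disc, so they agree on each open half plane, and the three
  functions glue to one on the cut plane.
\<close>

lemma gauss_continuation_exists:
  assumes c: "c \<notin> \<int>\<^sub>\<le>\<^sub>0"
  shows "\<exists>f. f holomorphic_on cut_plane \<and> (\<forall>z\<in>ball 0 1. f z = eval_fps (gauss_fps a b c) z)"
proof -
  define F where "F = eval_fps (gauss_fps a b c)"
  define F' where "F' = eval_fps (fps_deriv (gauss_fps a b c))"
  have F: "hypergeo_solution a b c (ball 0 1) F F'"
    unfolding F_def F'_def by (rule gauss_series_solution[OF c])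
  have ext: "\<exists>y. y holomorphic_on slit_plane I \<and> (\<forall>z\<in>slit_plane I \<inter> ball 0 1. y z = F z) \<and>
     (\<exists>y'. hypergeo_solution a b c (slit_plane I) y y')"
    if I: "open I" "convex I" "r \<in> I" "\<bar>r\<bar> < 1" "0 \<notin> I" "1 \<notin> I" for I r
  proof -
    have rI: "of_real r \<in> slit_plane I" using I by (simp add: slit_plane_def)
    obtain y y' where y: "hypergeo_solution a b c (slit_plane I) y y'" "y (of_real r) = F (of_real r)" "y' (of_real r) = F' (of_real r)"
      by (rule hypergeo_solution_exists[of "slit_plane I" "of_real r" a b c "F (of_real r)" "F' (of_real r)"])
         (use I rI slit_plane_star open_slit_plane in \<open>auto simp: slit_plane_def\<close>)
    have "y z = F z" if z: "z \<in> slit_plane I \<inter> ball 0 1" for z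
    proof (rule hypergeo_solution_unique[of a b c "slit_plane I \<inter> ball 0 1" y y' F F' "of_real r"])
      show "connected (slit_plane I \<inter> ball 0 1)"
        by (rule connected_slit_plane_Int_convex[of _ r]) (use I in auto)
    qed (use y F z I rI in \<open>auto intro: hypergeo_solution_subset open_slit_plane\<close>)
    thus ?thesis using y hypergeo_solution_holomorphic(1)[OF y(1) open_slit_plane[OF I(1)]] by blast
  qed
  obtain y1 y1' where y1: "y1 holomorphic_on slit_plane {0<..<1}"
     "\<And>z. z \<in> slit_plane {0<..<1} \<inter> ball 0 1 \<Longrightarrow> y1 z = F z" "hypergeo_solution a b c (slit_plane {0<..<1}) y1 y1'"
    using ext[of "{0<..<1}" "1/2"] by auto
  obtain y2 y2' where y2: "y2 holomorphic_on slit_plane {..<0}"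
     "\<And>z. z \<in> slit_plane {..<0} \<inter> ball 0 1 \<Longrightarrow> y2 z = F z" "hypergeo_solution a b c (slit_plane {..<0}) y2 y2'"
    using ext[of "{..<0}" "-1/2"] by auto
  have y12_half: "y1 z = y2 z" if H: "H = {z. Im z > 0} \<or> H = {z. Im z < 0}" and z: "z \<in> H" for z H
  proof (rule analytic_continuation_open[of "H \<inter> ball 0 1" H y1 y2])
    have "open H" "connected H" using H by (auto simp: open_halfspace_Im_gt open_halfspace_Im_lt
       convex_halfspace_Im_gt convex_halfspace_Im_lt convex_connected)
    thus "open H" "connected H" "open (H \<inter> ball 0 1)" by auto
    have "\<i> / 2 \<in> H \<inter> ball 0 1 \<or> - (\<i> / 2) \<in> H \<inter> ball 0 1" using H by (auto simp: norm_divide)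
    thus "H \<inter> ball 0 1 \<noteq> {}" by blast
    have sub: "H \<subseteq> slit_plane {0<..<1}" "H \<subseteq> slit_plane {..<0}" using H by (auto simp: slit_plane_def)
    show "y1 holomorphic_on H" "y2 holomorphic_on H"
      using y1(1) y2(1) sub by (auto intro: holomorphic_on_subset)
    show "y1 w = y2 w" if "w \<in> H \<inter> ball 0 1" for w 
    proof -
      have "w \<in> slit_plane {0<..<1} \<inter> ball 0 1" "w \<in> slit_plane {..<0} \<inter> ball 0 1" using that sub by blast+
      thus ?thesis using y1(2) y2(2) by metis
    qed
  qed (use z in auto)
  have y12: "y1 z = y2 z" if "z \<in> slit_plane {0<..<1} \<inter> slit_plane {..<0}" for z
  proof -
    have "Im z \<noteq> 0" using that by (auto simp: slit_plane_def)
    hence "Im z > 0 \<or> Im z < 0" by linarith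
    thus ?thesis using y12_half[of "{z. Im z > 0}" z] y12_half[of "{z. Im z < 0}" z] by auto
  qed
  define f where "f = (\<lambda>z. if z \<in> ball 0 1 then F z else if z \<in> slit_plane {0<..<1} then y1 z else y2 z)"
  have fF: "f z = F z" if "z \<in> ball 0 1" for z using that by (simp add: f_def)
  have f1: "f z = y1 z" if "z \<in> slit_plane {0<..<1}" for z using that y1(2)[of z] by (simp add: f_def)
  have f2: "f z = y2 z" if "z \<in> slit_plane {..<0}" for z using that y2(2)[of z] y12[of z] by (simp add: f_def)
  have op: "open (slit_plane {0<..<1})" "open (slit_plane {..<0})" by (auto intro: open_slit_plane)
  have "f holomorphic_on ball 0 1"
    by (rule holomorphic_transform[OF hypergeo_solution_holomorphic(1)[OF F open_ball]]) (metis fF)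
  moreover have "f holomorphic_on slit_plane {0<..<1}"
    by (rule holomorphic_transform[OF y1(1)]) (metis f1)
  moreover have "f holomorphic_on slit_plane {..<0}"
    by (rule holomorphic_transform[OF y2(1)]) (metis f2)
  ultimately have "f holomorphic_on (ball 0 1 \<union> slit_plane {0<..<1} \<union> slit_plane {..<0})"
    using op by (intro holomorphic_on_Un) auto
  moreover have "cut_plane \<subseteq> ball 0 1 \<union> slit_plane {0<..<1} \<union> slit_plane {..<0}"
  proof
    fix z assume z: "z \<in> cut_plane"
    show "z \<in> ball 0 1 \<union> slit_plane {0<..<1} \<union> slit_plane {..<0}"
    proof (cases "Im z = 0")
      case True
      hence "cmod z = \<bar>Re z\<bar>" by (simp add: cmod_eq_Re)
      thus ?thesis using z True by (auto simp: cut_plane_eq slit_plane_def)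
    qed (auto simp: slit_plane_def)
  qed
  ultimately have "f holomorphic_on cut_plane" by (rule holomorphic_on_subset)
  thus ?thesis using fF unfolding F_def by blast
qed

lemma
  assumes c: "c \<notin> \<int>\<^sub>\<le>\<^sub>0"
  shows gauss_2F1_holomorphic: "gauss_2F1 a b c holomorphic_on cut_plane"
    and gauss_2F1_series: "z \<in> ball 0 1 \<Longrightarrow> gauss_2F1 a b c z = eval_fps (gauss_fps a b c) z"
proof -
  have *: "gauss_2F1 a b c holomorphic_on cut_plane \<and>
     (\<forall>z\<in>ball 0 1. gauss_2F1 a b c z = eval_fps (gauss_fps a b c) z)"
    unfolding gauss_2F1_def by (rule someI_ex[OF gauss_continuation_exists[OF c]])
  show "gauss_2F1 a b c holomorphic_on cut_plane" using * by blast
  show "z \<in> ball 0 1 \<Longrightarrow> gauss_2F1 a b c z = eval_fps (gauss_fps a b c) z" using * by blast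
qed

text \<open>
  The left-hand side of the equation is holomorphic wherever the continued function is, so it
  vanishes identically once it vanishes on an open subset.
\<close>

lemma hypergeo_solution_continuation:
  assumes f: "f holomorphic_on D" and D: "open D" "connected D"
    and sol: "hypergeo_solution a b c U y y'" and U: "open U" "U \<subseteq> D" "U \<noteq> {}"
    and eq: "\<And>z. z \<in> U \<Longrightarrow> f z = y z"
  shows "hypergeo_solution a b c D f (deriv f)"
proof -
  have hol1: "deriv f holomorphic_on D" by (rule holomorphic_deriv[OF f D(1)])
  have hol2: "deriv (deriv f) holomorphic_on D" by (rule holomorphic_deriv[OF hol1 D(1)])
  have "z * (1 - z) * deriv (deriv f) z + (c - (a + b + 1) * z) * deriv f z - a * b * f z = 0" if "z \<in> D" for z
  proof (rule analytic_continuation_open[of U D "\<lambda>z. z * (1 - z) * deriv (deriv f) z + (c - (a + b + 1) * z) * deriv f z - a * b * f z" "\<lambda>_. 0"])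
    show "(\<lambda>z. z * (1 - z) * deriv (deriv f) z + (c - (a + b + 1) * z) * deriv f z - a * b * f z) holomorphic_on D"
      by (intro holomorphic_intros f hol1 hol2)
    have d1: "deriv f w = y' w" if w: "w \<in> U" for w
    proof (rule DERIV_imp_deriv)
      have "(y has_field_derivative y' w) (at w)" using sol w by (auto simp: hypergeo_solution_def)
      thus "(f has_field_derivative y' w) (at w)"
        by (rule has_field_derivative_transform_within_open[OF _ U(1) w]) (simp add: eq)
    qed
    show "w * (1 - w) * deriv (deriv f) w + (c - (a + b + 1) * w) * deriv f w - a * b * f w = 0" if w: "w \<in> U" for w
    proof -
      obtain d where d: "(y' has_field_derivative d) (at w)"
        "w * (1 - w) * d + (c - (a + b + 1) * w) * y' w - a * b * y w = 0"
        using sol w by (auto simp: hypergeo_solution_def)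
      have "(deriv f has_field_derivative d) (at w)"
        by (rule has_field_derivative_transform_within_open[OF d(1) U(1) w]) (simp add: d1)
      hence "deriv (deriv f) w = d" by (rule DERIV_imp_deriv)
      thus ?thesis using d(2) by (simp only: d1[OF w] eq[OF w])
    qed
  qed (use D U that in auto)
  moreover have "(f has_field_derivative deriv f z) (at z)" "(deriv f has_field_derivative deriv (deriv f) z) (at z)"
    if "z \<in> D" for z
    using that f hol1 D(1) by (auto intro: holomorphic_derivI)
  ultimately show ?thesis unfolding hypergeo_solution_def by blast
qed

lemma gauss_2F1_solution:
  assumes c: "c \<notin> \<int>\<^sub>\<le>\<^sub>0"
  shows "hypergeo_solution a b c cut_plane (gauss_2F1 a b c) (deriv (gauss_2F1 a b c))"
  by (rule hypergeo_solution_continuation[OF gauss_2F1_holomorphic[OF c] open_cut_plane connected_cut_plane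
        gauss_series_solution[OF c]])
     (use ball_subset_cut_plane gauss_2F1_series[OF c] in auto)

text \<open>
  The disc of radius 1 about 2 + i/2 contains 2 and omits both 0 and 1.  The solution on this disc with the
  initial data of the branch at the centre agrees with the branch above the real axis and is
  continuous at 2.
\<close>

lemma gauss_2F1_upper_limit_exists:
  assumes c: "c \<notin> \<int>\<^sub>\<le>\<^sub>0"
  shows "\<exists>L. (gauss_2F1 a b c \<longlongrightarrow> L) (at 2 within {z. Im z > 0})"
proof -
  define z0 :: complex where "z0 = 2 + \<i> / 2"
  define D where "D = ball z0 1"
  define H where "H = {z::complex. Im z > 0}"
  define f where "f = gauss_2F1 a b c"
  have H: "H \<subseteq> cut_plane" "open H" "convex H"
    by (auto simp: H_def cut_plane_eq slit_plane_def open_halfspace_Im_gt convex_halfspace_Im_gt)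
  have D0: "0 \<notin> D" "1 \<notin> D" "2 \<in> D" "z0 \<in> D" "z0 \<in> H"
    by (auto simp: D_def z0_def H_def dist_norm cmod_def power2_eq_square norm_divide)
  obtain y y' where y: "hypergeo_solution a b c D y y'" "y z0 = f z0" "y' z0 = deriv f z0"
    by (rule hypergeo_solution_exists[of D z0 a b c "f z0" "deriv f z0"])
       (use D0 in \<open>auto simp: D_def closed_segment_subset\<close>)
  have eq: "y z = f z" if "z \<in> D \<inter> H" for z
  proof (rule hypergeo_solution_unique[of a b c "D \<inter> H" y y' f "deriv f" z0])
    show "hypergeo_solution a b c (D \<inter> H) y y'" by (rule hypergeo_solution_subset[OF y(1)]) auto
    show "hypergeo_solution a b c (D \<inter> H) f (deriv f)" unfolding f_def
      by (rule hypergeo_solution_subset[OF gauss_2F1_solution[OF c]]) (use H in auto)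
    show "connected (D \<inter> H)" using H by (intro convex_connected convex_Int) (auto simp: D_def)
  qed (use that D0 y H in \<open>auto simp: D_def\<close>)
  have "isCont y 2"
    using hypergeo_solution_holomorphic(1)[OF y(1)] D0
    by (auto simp: D_def continuous_on_eq_continuous_at dest!: holomorphic_on_imp_continuous_on)
  hence "(y \<longlongrightarrow> y 2) (at 2 within H)" unfolding isCont_def by (rule tendsto_within_subset) auto
  moreover have "eventually (\<lambda>z. y z = f z) (at 2 within H)"
    unfolding eventually_at_topological using D0 eq
    by (intro exI[of _ D]) (auto simp: D_def)
  ultimately have "(f \<longlongrightarrow> y 2) (at 2 within H)" by (rule Lim_transform_eventually)
  thus ?thesis unfolding f_def H_def by blast
qed

lemma two_upper_nontrivial: "at (2::complex) within {z. Im z > 0} \<noteq> bot"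
proof -
  have "2 \<in> closure {z::complex. Im z > 0}" unfolding closure_sequential
  proof (intro exI[of _ "\<lambda>n. 2 + \<i> * of_real (1 / real (Suc n))"] conjI allI)
    have "(\<lambda>n. 2 + \<i> * complex_of_real (1 / real (Suc n))) \<longlonglongrightarrow> 2 + \<i> * of_real 0"
      by (intro tendsto_intros LIMSEQ_Suc[OF lim_1_over_n])
    thus "(\<lambda>n. 2 + \<i> * complex_of_real (1 / real (Suc n))) \<longlonglongrightarrow> 2" by simp
  qed simp
  thus ?thesis by (simp add: at_within_eq_bot_iff)
qed

lemma calH_limit:
  assumes "2 * ((1 - Z) / 2) \<notin> \<int>\<^sub>\<le>\<^sub>0"
  shows "(gauss_2F1 ((1 - Z) / 2 - \<alpha> / 2) ((1 - Z) / 2 + \<alpha> / 2) (2 * ((1 - Z) / 2)) \<longlongrightarrow> calH \<alpha> Z)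
           (at 2 within {z. Im z > 0})"
proof -
  obtain L where L: "(gauss_2F1 ((1 - Z) / 2 - \<alpha> / 2) ((1 - Z) / 2 + \<alpha> / 2) (2 * ((1 - Z) / 2)) \<longlongrightarrow> L)
           (at 2 within {z. Im z > 0})"
    using gauss_2F1_upper_limit_exists[OF assms] by metis
  hence "calH \<alpha> Z = L"
    unfolding calH_def Let_def gauss_2F1_upper_def of_real_numeral by (intro tendsto_Lim two_upper_nontrivial)
  thus ?thesis using L by simp
qed

section \<open>The zero-balanced series at 1\<close>

lemma one_not_nonpos_Int: "(1::complex) \<notin> \<int>\<^sub>\<le>\<^sub>0"
  by simp

lemma not_nonpos_Int_plus_of_nat:
  fixes z :: complex
  assumes "z \<notin> \<int>\<^sub>\<le>\<^sub>0"
  shows "z + of_nat n \<notin> \<int>\<^sub>\<le>\<^sub>0"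
proof
  assume "z + of_nat n \<in> \<int>\<^sub>\<le>\<^sub>0"
  then obtain m where "z + of_nat n = - of_nat m" by (elim nonpos_Ints_cases')
  hence "z = - of_nat (m + n)" by (simp add: algebra_simps eq_neg_iff_add_eq_0)
  thus False using assms by (metis minus_of_nat_in_nonpos_Ints)
qed

text \<open>
  If M bounds the moduli in K, then n + 1 exceeds |z + n| by at most M + 1, and this is at most (M+1)/d times
  |z + n| because |z + n| is at least the distance d of K from the nonpositive integers.
\<close>

lemma add_of_nat_lower_bound:
  fixes K :: "complex set"
  assumes "compact K" "K \<inter> \<int>\<^sub>\<le>\<^sub>0 = {}"
  obtains \<epsilon> where "\<epsilon> > 0" "\<And>z n. z \<in> K \<Longrightarrow> \<epsilon> * real (n + 1) \<le> norm (z + of_nat n)"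
proof -
  obtain d where d: "d > 0" "\<And>x y. x \<in> K \<Longrightarrow> y \<in> \<int>\<^sub>\<le>\<^sub>0 \<Longrightarrow> d \<le> dist x y"
    using separate_compact_closed[OF assms(1) closed_nonpos_Ints assms(2)] by auto
  obtain M where M: "M > 0" "\<And>z. z \<in> K \<Longrightarrow> norm z \<le> M"
    using compact_imp_bounded[OF assms(1)] bounded_pos by blast
  show ?thesis
  proof (rule that[of "1 / (1 + (M + 1) / d)"])
    show "1 / (1 + (M + 1) / d) > 0" using d M by (simp add: add_pos_pos)
  next
    fix z n assume z: "z \<in> K"
    have 1: "d \<le> norm (z + of_nat n)" using d(2)[OF z, of "- of_nat n"] by (simp add: dist_norm)
    have "real n = norm (complex_of_nat n)" by simp
    also have "\<dots> \<le> norm (z + of_nat n) + norm z"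
      by (metis add_diff_cancel_left' norm_triangle_ineq4)
    finally have "real (n + 1) \<le> norm (z + of_nat n) + (M + 1)" using M(2)[OF z] by simp
    also have "M + 1 = (M + 1) / d * d" using d by simp
    also have "\<dots> \<le> (M + 1) / d * norm (z + of_nat n)"
      using d M 1 by (intro mult_left_mono) auto
    finally have "real (n + 1) \<le> (1 + (M + 1) / d) * norm (z + of_nat n)" by (simp add: algebra_simps)
    moreover have "1 + (M + 1) / d > 0" using d M by (simp add: add_pos_pos)
    ultimately show "1 / (1 + (M + 1) / d) * real (n + 1) \<le> norm (z + of_nat n)"
      by (simp add: divide_le_eq mult.commute)
  qed
qed

lemma add_of_nat_lower_bound1:
  fixes z :: complex
  assumes "z \<notin> \<int>\<^sub>\<le>\<^sub>0"
  obtains \<epsilon> where "\<epsilon> > 0" "\<And>n. \<epsilon> * real (n + 1) \<le> norm (z + of_nat n)"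
proof -
  have "compact {z}" "{z} \<inter> \<int>\<^sub>\<le>\<^sub>0 = {}" using assms by auto
  then obtain \<epsilon> where "\<epsilon> > 0" "\<And>w n. w \<in> {z} \<Longrightarrow> \<epsilon> * real (n + 1) \<le> norm (w + of_nat n)"
    using add_of_nat_lower_bound by blast
  thus ?thesis using that by blast
qed

lemma summable_const_over_squares: "summable (\<lambda>n. C / real (n + 1) ^ 2)"
  using summable_mult[OF sums_summable[OF inverse_squares_sums], of C] by simp

text \<open>
  The bound B/((n+1)(n+2)) on the increments is itself the difference of B/(n+1) and B/(n+2).
\<close>

lemma telescoping_rate:
  fixes X :: "nat \<Rightarrow> complex"
  assumes lim: "X \<longlonglongrightarrow> L" and step: "\<And>n. norm (X (Suc n) - X n) \<le> B / (real (n + 1) * real (n + 2))"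
  shows "norm (X n - L) \<le> B / real (n + 1)"
proof -
  have "B / (real 1 * real 2) \<ge> 0" using order_trans[OF norm_ge_zero step[of 0]] by simp
  hence B: "B \<ge> 0" by simp
  have step': "norm (X (n + m) - X n) \<le> B / real (n + 1) - B / real (n + m + 1)" for m
  proof (induction m)
    case (Suc m)
    have "norm (X (n + Suc m) - X n) \<le> norm (X (Suc (n + m)) - X (n + m)) + norm (X (n + m) - X n)"
      using norm_triangle_ineq[of "X (Suc (n + m)) - X (n + m)" "X (n + m) - X n"] by simp
    also have "\<dots> \<le> B / (real (n + m + 1) * real (n + m + 2)) + (B / real (n + 1) - B / real (n + m + 1))"
      using step[of "n + m"] Suc by simp
    also have "B / (real (n + m + 1) * real (n + m + 2)) = B / real (n + m + 1) - B / real (n + m + 2)"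
      by (simp add: field_simps)
    finally show ?case by simp
  qed simp
  have "norm (X (m + n) - X n) \<le> B / real (n + 1)" for m
  proof -
    have "B / real (n + m + 1) \<ge> 0" using B by simp
    thus ?thesis using step'[of m] by (simp add: add.commute)
  qed
  moreover have "(\<lambda>m. norm (X (m + n) - X n)) \<longlonglongrightarrow> norm (L - X n)"
    by (intro tendsto_intros LIMSEQ_ignore_initial_segment lim)
  ultimately have "norm (L - X n) \<le> B / real (n + 1)" by (intro LIMSEQ_le_const2[of _ _ "B / real (n + 1)"]) auto
  thus ?thesis by (simp add: norm_minus_commute)
qed

definition gamma_quot :: "complex \<Rightarrow> complex \<Rightarrow> complex \<Rightarrow> complex \<Rightarrow> nat \<Rightarrow> complex" where
  "gamma_quot p q u v n = Gamma (p + of_nat n) * Gamma (q + of_nat n) / (Gamma (u + of_nat n) * Gamma (v + of_nat n))"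

text \<open>
  In Euler's product for each of the four factors the power n^z appears; these powers
  cancel since p + q = u + v.
\<close>

lemma gamma_quot_LIMSEQ:
  assumes ni: "p \<notin> \<int>\<^sub>\<le>\<^sub>0" "q \<notin> \<int>\<^sub>\<le>\<^sub>0" "u \<notin> \<int>\<^sub>\<le>\<^sub>0" "v \<notin> \<int>\<^sub>\<le>\<^sub>0" and bal: "p + q = u + v"
  shows "gamma_quot p q u v \<longlonglongrightarrow> 1"
proof -
  have G0: "Gamma p \<noteq> 0" "Gamma q \<noteq> 0" "Gamma u \<noteq> 0" "Gamma v \<noteq> 0" using ni by (auto simp: Gamma_eq_zero_iff)
  define C where "C = Gamma p * Gamma q / (Gamma u * Gamma v)"
  have "(\<lambda>n. C * (Gamma_series u n * Gamma_series v n / (Gamma_series p n * Gamma_series q n))) \<longlonglongrightarrow>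
           C * (Gamma u * Gamma v / (Gamma p * Gamma q))"
    using G0 by (intro tendsto_intros Gamma_series_LIMSEQ) auto
  also have "C * (Gamma u * Gamma v / (Gamma p * Gamma q)) = 1" using G0 by (simp add: C_def)
  also have "(\<lambda>n. C * (Gamma_series u n * Gamma_series v n / (Gamma_series p n * Gamma_series q n))) = 
             (\<lambda>n. gamma_quot p q u v (Suc n))"
  proof
    fix n
    define L where "L = complex_of_real (ln (real n))"
    have P: "pochhammer p (n+1) \<noteq> 0" "pochhammer q (n+1) \<noteq> 0" "pochhammer u (n+1) \<noteq> 0" "pochhammer v (n+1) \<noteq> 0"
      using ni[THEN pochhammer_not_nonpos_Int] by blast+
    have E: "exp (u * L) * exp (v * L) = exp (p * L) * exp (q * L)"
      by (simp flip: exp_add distrib_right add: bal)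
    have "Gamma_series u n * Gamma_series v n / (Gamma_series p n * Gamma_series q n) =
       (exp (u * L) * exp (v * L)) / (exp (p * L) * exp (q * L)) * 
        (pochhammer p (n+1) * pochhammer q (n+1) / (pochhammer u (n+1) * pochhammer v (n+1)))"
      using P unfolding Gamma_series_def L_def[symmetric] by (simp add: divide_simps del: pochhammer_Suc)
    also have "\<dots> = pochhammer p (n+1) * pochhammer q (n+1) / (pochhammer u (n+1) * pochhammer v (n+1))"
      unfolding E by simp
    also have "C * \<dots> = gamma_quot p q u v (Suc n)"
      using G0 unfolding C_def gamma_quot_def pochhammer_Gamma[OF ni(1)] pochhammer_Gamma[OF ni(2)]
        pochhammer_Gamma[OF ni(3)] pochhammer_Gamma[OF ni(4)] Suc_eq_plus1
      by (simp add: divide_simps)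
    finally show "C * (Gamma_series u n * Gamma_series v n / (Gamma_series p n * Gamma_series q n)) = gamma_quot p q u v (Suc n)" .
  qed
  finally show ?thesis by (simp only: filterlim_sequentially_Suc)
qed

text \<open>
  The ratio of consecutive terms is (p+n)(q+n)/((u+n)(v+n)), and since p + q = u + v its numerator differs from
  the denominator by the constant pq - uv only.  The increments are therefore O(1/n^2).
\<close>

lemma gamma_quot_rate:
  assumes ni: "p \<notin> \<int>\<^sub>\<le>\<^sub>0" "q \<notin> \<int>\<^sub>\<le>\<^sub>0" "u \<notin> \<int>\<^sub>\<le>\<^sub>0" "v \<notin> \<int>\<^sub>\<le>\<^sub>0" and bal: "p + q = u + v"
  obtains B where "B \<ge> 0" "\<And>n. norm (gamma_quot p q u v n - 1) \<le> B / real (n + 1)"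
proof -
  note lim = gamma_quot_LIMSEQ[OF ni bal]
  obtain R where R: "R > 0" "\<And>n. norm (gamma_quot p q u v n) \<le> R"
    using convergent_imp_Bseq[OF convergentI[OF lim]] by (auto simp: Bseq_def)
  obtain e1 where e1: "e1 > 0" "\<And>n. e1 * real (n + 1) \<le> norm (u + of_nat n)"
    using add_of_nat_lower_bound1[OF ni(3)] by metis
  obtain e2 where e2: "e2 > 0" "\<And>n. e2 * real (n + 1) \<le> norm (v + of_nat n)"
    using add_of_nat_lower_bound1[OF ni(4)] by metis
  define B where "B = 2 * R * norm (p * q - u * v) / (e1 * e2)"
  have B: "B \<ge> 0" using R e1 e2 by (simp add: B_def)
  have "norm (gamma_quot p q u v (Suc n) - gamma_quot p q u v n) \<le> B / (real (n + 1) * real (n + 2))" for n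
  proof -
    have nz: "u + of_nat n \<noteq> 0" "v + of_nat n \<noteq> 0"
      by (rule not_nonpos_Int_add_of_nat[OF ni(3)], rule not_nonpos_Int_add_of_nat[OF ni(4)])
    have GS: "Gamma (z + of_nat (Suc n)) = (z + of_nat n) * Gamma (z + of_nat n)" if "z \<notin> \<int>\<^sub>\<le>\<^sub>0" for z :: complex
      using Gamma_plus1[OF not_nonpos_Int_plus_of_nat[OF that, of n]] by (simp add: add_ac)
    have "gamma_quot p q u v (Suc n) = gamma_quot p q u v n * ((p + of_nat n) * (q + of_nat n) / ((u + of_nat n) * (v + of_nat n)))"
      unfolding gamma_quot_def GS[OF ni(1)] GS[OF ni(2)] GS[OF ni(3)] GS[OF ni(4)] by (simp add: mult_ac)
    hence "gamma_quot p q u v (Suc n) - gamma_quot p q u v n = 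
        gamma_quot p q u v n * (((p + of_nat n) * (q + of_nat n) - (u + of_nat n) * (v + of_nat n)) / ((u + of_nat n) * (v + of_nat n)))"
      using nz by (simp add: diff_divide_distrib right_diff_distrib)
    also have "(p + of_nat n) * (q + of_nat n) - (u + of_nat n) * (v + of_nat n) = p * q - u * v + of_nat n * ((p + q) - (u + v))"
      by (simp add: algebra_simps)
    also have "\<dots> = p * q - u * v" by (simp add: bal)
    finally have "norm (gamma_quot p q u v (Suc n) - gamma_quot p q u v n) = 
       norm (gamma_quot p q u v n) * norm (p * q - u * v) / (norm (u + of_nat n) * norm (v + of_nat n))"
      by (simp add: norm_mult norm_divide)
    also have "\<dots> \<le> R * norm (p * q - u * v) / ((e1 * real (n + 1)) * (e2 * real (n + 1)))"
      using R e1 e2 nz by (intro frac_le mult_mono mult_pos_pos mult_right_mono) auto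
    also have "\<dots> \<le> R * norm (p * q - u * v) / ((e1 * real (n + 1)) * (e2 * (real (n + 2) / 2)))"
      using R e1 e2 by (intro frac_le mult_mono mult_left_mono mult_pos_pos) auto
    also have "\<dots> = B / (real (n + 1) * real (n + 2))" by (simp add: B_def field_simps)
    finally show ?thesis .
  qed
  from telescoping_rate[OF lim this] B show ?thesis using that by blast
qed

text \<open>
  The coefficients of F(a,b;a+b;z) divided by \<Gamma>(a+b)/(\<Gamma>(a)\<Gamma>(b)), so that they are asymptotic to 1/k.
\<close>

definition zb_coeff :: "complex \<Rightarrow> complex \<Rightarrow> nat \<Rightarrow> complex" where
  "zb_coeff a b k = Gamma (a + of_nat k) * Gamma (b + of_nat k) / (Gamma (a + b + of_nat k) * fact k)"

text \<open>
  The constant term of the series at 1: by Abel's theorem the scaled series plus log(1-z)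
  tends to this number as z tends to 1.
\<close>

definition zb_const :: "complex \<Rightarrow> complex \<Rightarrow> complex" where
  "zb_const a b = (\<Sum>k. zb_coeff a b k - 1 / of_nat (k + 1))"

lemma zb_coeff_commute: "zb_coeff a b = zb_coeff b a"
  by (simp add: zb_coeff_def fun_eq_iff add_ac mult_ac)

lemma zb_const_commute: "zb_const a b = zb_const b a"
  by (simp add: zb_const_def zb_coeff_commute)

lemma zb_coeff_rate:
  assumes ni: "a \<notin> \<int>\<^sub>\<le>\<^sub>0" "b \<notin> \<int>\<^sub>\<le>\<^sub>0" "a + b - 1 \<notin> \<int>\<^sub>\<le>\<^sub>0"
  obtains C where "C \<ge> 0" "\<And>k. norm (zb_coeff a b k - 1 / of_nat (k + 1)) \<le> C / real (k + 1) ^ 2"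
proof -
  have one: "(1::complex) \<notin> \<int>\<^sub>\<le>\<^sub>0" by simp
  obtain B where B: "B \<ge> 0" "\<And>n. norm (gamma_quot a b (a + b - 1) 1 n - 1) \<le> B / real (n + 1)"
    using gamma_quot_rate[OF ni one] by auto
  obtain e where e: "e > 0" "\<And>n. e * real (n + 1) \<le> norm (a + b - 1 + of_nat n)"
    using add_of_nat_lower_bound1[OF ni(3)] by metis
  define C where "C = (B + norm (2 - a - b)) / e"
  have "norm (zb_coeff a b k - 1 / of_nat (k + 1)) \<le> C / real (k + 1) ^ 2" for k
  proof -
    have nz: "a + b - 1 + of_nat k \<noteq> 0" by (rule not_nonpos_Int_add_of_nat[OF ni(3)])
    have k0: "of_nat (k + 1) \<noteq> (0::complex)" unfolding of_nat_eq_0_iff by simp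
    have "Gamma (a + b + of_nat k) = (a + b - 1 + of_nat k) * Gamma (a + b - 1 + of_nat k)"
      using Gamma_plus1[OF not_nonpos_Int_plus_of_nat[OF ni(3), of k]] by (simp add: algebra_simps)
    moreover have "Gamma (1 + of_nat k) = (fact k :: complex)" by (rule Gamma_fact)
    ultimately have "zb_coeff a b k = gamma_quot a b (a + b - 1) 1 k / (a + b - 1 + of_nat k)"
      unfolding zb_coeff_def gamma_quot_def by (simp add: mult_ac)
    moreover have "1 / (a + b - 1 + of_nat k) - 1 / of_nat (k + 1) = (2 - a - b) / ((a + b - 1 + of_nat k) * of_nat (k + 1))"
    proof -
      have "1 / (a + b - 1 + of_nat k) - 1 / of_nat (k + 1) = (of_nat (k + 1) - (a + b - 1 + of_nat k)) / ((a + b - 1 + of_nat k) * of_nat (k + 1))"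
        using diff_frac_eq[OF nz k0, of 1 1] by simp
      thus ?thesis by simp
    qed
    ultimately have "zb_coeff a b k - 1 / of_nat (k + 1) = (gamma_quot a b (a + b - 1) 1 k - 1) / (a + b - 1 + of_nat k)
        + (2 - a - b) / ((a + b - 1 + of_nat k) * of_nat (k + 1))"
    proof -
      assume *: "zb_coeff a b k = gamma_quot a b (a + b - 1) 1 k / (a + b - 1 + of_nat k)"
        "1 / (a + b - 1 + of_nat k) - 1 / of_nat (k + 1) = (2 - a - b) / ((a + b - 1 + of_nat k) * of_nat (k + 1))"
      have split: "q / w - u = (q - 1) / w + (1 / w - u)" for q w u :: complex
        by (simp add: diff_divide_distrib)
      show ?thesis unfolding *(1) *(2)[symmetric] by (rule split)
    qed
    also have "norm \<dots> \<le> norm (gamma_quot a b (a + b - 1) 1 k - 1) / norm (a + b - 1 + of_nat k)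
        + norm (2 - a - b) / (norm (a + b - 1 + of_nat k) * real (k + 1))"
      by (rule order_trans[OF norm_triangle_ineq]) (simp add: norm_divide norm_mult del: of_nat_add of_nat_Suc)
    also have "\<dots> \<le> (B / real (k + 1)) / (e * real (k + 1)) + norm (2 - a - b) / ((e * real (k + 1)) * real (k + 1))"
      using B e by (intro add_mono frac_le mult_mono mult_pos_pos) auto
    also have "\<dots> = C / real (k + 1) ^ 2" by (simp add: C_def power2_eq_square add_divide_distrib mult_ac)
    finally show ?thesis .
  qed
  moreover have "C \<ge> 0" using B e by (simp add: C_def)
  ultimately show ?thesis using that by blast
qed

lemma zb_coeff_summable:
  assumes ni: "a \<notin> \<int>\<^sub>\<le>\<^sub>0" "b \<notin> \<int>\<^sub>\<le>\<^sub>0" "a + b - 1 \<notin> \<int>\<^sub>\<le>\<^sub>0"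
  shows "summable (\<lambda>k. norm (zb_coeff a b k - 1 / of_nat (k + 1)))"
proof -
  obtain C where "C \<ge> 0" "\<And>k. norm (zb_coeff a b k - 1 / of_nat (k + 1)) \<le> C / real (k + 1) ^ 2"
    using zb_coeff_rate[OF ni] by metis
  thus ?thesis by (intro summable_comparison_test[OF _ summable_const_over_squares[of C]]) auto
qed

lemma zb_coeff_times_index_LIMSEQ:
  assumes ni: "a \<notin> \<int>\<^sub>\<le>\<^sub>0" "b \<notin> \<int>\<^sub>\<le>\<^sub>0" "a + b - 1 \<notin> \<int>\<^sub>\<le>\<^sub>0"
  shows "(\<lambda>k. of_nat k * zb_coeff a b k) \<longlonglongrightarrow> 1"
proof -
  obtain C where C: "C \<ge> 0" "\<And>k. norm (zb_coeff a b k - 1 / of_nat (k + 1)) \<le> C / real (k + 1) ^ 2"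
    using zb_coeff_rate[OF ni] by metis
  have "(\<lambda>k. of_nat k * (zb_coeff a b k - 1 / of_nat (k + 1))) \<longlonglongrightarrow> 0"
  proof (rule Lim_null_comparison)
    show "eventually (\<lambda>k. norm (of_nat k * (zb_coeff a b k - 1 / of_nat (k + 1))) \<le> real k * (C / real (k + 1) ^ 2)) sequentially"
      unfolding norm_mult norm_of_nat by (intro always_eventually allI mult_left_mono C) auto
    show "(\<lambda>k. real k * (C / real (k + 1) ^ 2)) \<longlonglongrightarrow> 0" by real_asymp
  qed
  moreover have "(\<lambda>k. of_nat k / of_nat (Suc k) :: complex) \<longlonglongrightarrow> 1" by (rule LIMSEQ_n_over_Suc_n)
  ultimately have "(\<lambda>k. of_nat k * (zb_coeff a b k - 1 / of_nat (k + 1)) + of_nat k / of_nat (Suc k)) \<longlonglongrightarrow> 0 + 1"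
    by (rule tendsto_add)
  thus ?thesis by (simp add: algebra_simps)
qed

text \<open>
  The differences of the coefficients for b and b + 1 telescope: they are the increments of k times
  the k-th coefficient, divided by b, and k times the coefficient tends to 1.
\<close>

lemma zb_const_plus1:
  assumes ni: "a \<notin> \<int>\<^sub>\<le>\<^sub>0" "b \<notin> \<int>\<^sub>\<le>\<^sub>0" "a + b - 1 \<notin> \<int>\<^sub>\<le>\<^sub>0"
  shows "zb_const a (b + 1) = zb_const a b - 1 / b"
proof -
  have b0: "b \<noteq> 0" using ni by auto
  have nisum: "a + b \<notin> \<int>\<^sub>\<le>\<^sub>0" using not_nonpos_Int_plus_of_nat[OF ni(3), of 1] by simp
  have ni': "b + 1 \<notin> \<int>\<^sub>\<le>\<^sub>0" using not_nonpos_Int_plus_of_nat[OF ni(2), of 1] by simp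
  have ni'': "a + (b + 1) - 1 \<notin> \<int>\<^sub>\<le>\<^sub>0" using nisum by (simp add: add.assoc[symmetric])
  define h where "h = (\<lambda>k. of_nat k * zb_coeff a b k)"
  have "(\<lambda>k. h (Suc k) - h k) sums (1 - h 0)"
    unfolding h_def by (rule telescope_sums[OF zb_coeff_times_index_LIMSEQ[OF ni]])
  hence "(\<lambda>k. (h (Suc k) - h k) / b) sums (1 / b)" using sums_divide by (fastforce simp: h_def)
  moreover have "(h (Suc k) - h k) / b = zb_coeff a b k - zb_coeff a (b + 1) k" for k
  proof -
    have GS: "Gamma (z + of_nat (Suc k)) = (z + of_nat k) * Gamma (z + of_nat k)" if "z \<notin> \<int>\<^sub>\<le>\<^sub>0" for z :: complex
      using Gamma_plus1[OF not_nonpos_Int_plus_of_nat[OF that, of k]] by (simp add: add_ac)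
    have nz: "a + b + of_nat k \<noteq> 0" by (rule not_nonpos_Int_add_of_nat[OF nisum])
    have GSb: "Gamma (b + 1 + of_nat k) = (b + of_nat k) * Gamma (b + of_nat k)"
      using GS[OF ni(2)] by (simp add: add_ac)
    have GSab: "Gamma (a + (b + 1) + of_nat k) = (a + b + of_nat k) * Gamma (a + b + of_nat k)"
      using GS[OF nisum] by (simp add: add_ac)
    have 1: "zb_coeff a (b + 1) k = zb_coeff a b k * ((b + of_nat k) / (a + b + of_nat k))"
      unfolding zb_coeff_def GSb GSab by (simp add: mult_ac)
    have S0: "of_nat (Suc k) \<noteq> (0::complex)" unfolding of_nat_eq_0_iff by simp
    have "of_nat (Suc k) * zb_coeff a b (Suc k) = zb_coeff a b k * ((a + of_nat k) * (b + of_nat k) / (a + b + of_nat k))"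
      using S0 unfolding zb_coeff_def GS[OF ni(1)] GS[OF ni(2)] GS[OF nisum] fact_Suc by (simp add: mult_ac del: of_nat_Suc)
    hence "h (Suc k) - h k = zb_coeff a b k * ((a + of_nat k) * (b + of_nat k) / (a + b + of_nat k) - of_nat k)"
      unfolding h_def by (simp only: right_diff_distrib mult.commute)
    also have "(a + of_nat k) * (b + of_nat k) / (a + b + of_nat k) - of_nat k = a * b / (a + b + of_nat k)"
      using nz by (simp add: divide_simps) (simp add: algebra_simps)
    finally have "(h (Suc k) - h k) / b = zb_coeff a b k * (a / (a + b + of_nat k))" using b0 by simp
    also have "a / (a + b + of_nat k) = 1 - (b + of_nat k) / (a + b + of_nat k)"
      using nz by (simp add: divide_simps)
    finally show ?thesis unfolding 1 by (simp add: algebra_simps)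
  qed
  ultimately have s: "(\<lambda>k. zb_coeff a b k - zb_coeff a (b + 1) k) sums (1 / b)" by simp
  have "zb_const a b - zb_const a (b + 1) = (\<Sum>k. (zb_coeff a b k - 1 / of_nat (k + 1)) - (zb_coeff a (b + 1) k - 1 / of_nat (k + 1)))"
    unfolding zb_const_def
    by (intro suminf_diff summable_norm_cancel[OF zb_coeff_summable] ni ni' ni'')
  also have "\<dots> = 1 / b" using s by (simp add: sums_iff)
  finally show ?thesis by (simp add: algebra_simps)
qed

lemma zb_const_plus_of_nat:
  assumes ni: "a \<notin> \<int>\<^sub>\<le>\<^sub>0" "b \<notin> \<int>\<^sub>\<le>\<^sub>0" "a + b - 1 \<notin> \<int>\<^sub>\<le>\<^sub>0"
  shows "zb_const a b = zb_const a (b + of_nat n) + (\<Sum>j<n. 1 / (b + of_nat j))"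
proof (induction n)
  case (Suc n)
  have "zb_const a (b + of_nat n + 1) = zb_const a (b + of_nat n) - 1 / (b + of_nat n)"
    using not_nonpos_Int_plus_of_nat[OF ni(3), of n]
    by (intro zb_const_plus1 ni not_nonpos_Int_plus_of_nat) (simp add: algebra_simps)
  thus ?case using Suc by (simp add: algebra_simps)
qed simp

lemma zb_coeff_1: 
  assumes "a \<notin> \<int>\<^sub>\<le>\<^sub>0"
  shows "zb_coeff a 1 k = 1 / (a + of_nat k)"
proof -
  have "Gamma (a + 1 + of_nat k) = (a + of_nat k) * Gamma (a + of_nat k)"
    using Gamma_plus1[OF not_nonpos_Int_plus_of_nat[OF assms, of k]] by (simp add: add_ac)
  moreover have "Gamma (1 + of_nat k) = (fact k :: complex)" by (rule Gamma_fact)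
  moreover have "Gamma (a + of_nat k) \<noteq> 0" 
    using not_nonpos_Int_plus_of_nat[OF assms, of k] by (simp add: Gamma_eq_zero_iff)
  ultimately show ?thesis by (simp add: zb_coeff_def)
qed

lemma Digamma_sums:
  fixes z :: complex
  assumes "z \<noteq> 0"
  shows "(\<lambda>k. 1 / (z + of_nat k) - 1 / (1 + of_nat k)) sums (Digamma 1 - Digamma z)"
proof -
  have "(\<lambda>k. inverse (of_nat (Suc k)) - inverse (z + of_nat k)) sums (Digamma z + euler_mascheroni)"
    using summable_sums[OF summable_Digamma[OF assms]] by (simp add: Digamma_def)
  from sums_minus[OF this] show ?thesis by (simp add: inverse_eq_divide minus_diff_commute)
qed

lemma zb_const_1:
  assumes "a \<notin> \<int>\<^sub>\<le>\<^sub>0"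
  shows "zb_const a 1 = Digamma 1 - Digamma a"
proof -
  have "a \<noteq> 0" using assms by auto
  from sums_unique[OF Digamma_sums[OF this]] show ?thesis
    unfolding zb_const_def zb_coeff_1[OF assms] by (simp add: add.commute)
qed

text \<open>
  For Re a \<ge> 1 the moduli of \<Gamma>(a+k)/k! do not decrease with k, so the quotient of two of
  them that is left after cancelling is at most 1.
\<close>

lemma zb_coeff_tail_bound:
  assumes "Re a \<ge> 1"
  shows "norm (zb_coeff a (1 + of_nat N) k) \<le> 1 / real (k + N + 1)"
proof -
  have ni: "a \<notin> \<int>\<^sub>\<le>\<^sub>0" using assms by (auto elim!: nonpos_Ints_cases')
  define v where "v = (\<lambda>k. Gamma (a + of_nat k) / fact k)"
  have v0: "v k \<noteq> 0" for k
    using not_nonpos_Int_plus_of_nat[OF ni, of k] by (simp add: v_def Gamma_eq_zero_iff)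
  have "norm (v k) \<le> norm (v (Suc k))" for k
  proof -
    have GS: "Gamma (a + of_nat (Suc k)) = (a + of_nat k) * Gamma (a + of_nat k)"
      using Gamma_plus1[OF not_nonpos_Int_plus_of_nat[OF ni, of k]] by (simp add: add_ac)
    have "v (Suc k) = v k * ((a + of_nat k) / of_nat (Suc k))" unfolding v_def GS fact_Suc by (simp add: mult_ac)
    moreover have "norm ((a + of_nat k) / of_nat (Suc k)) \<ge> 1"
    proof -
      have "real (Suc k) \<le> Re (a + of_nat k)" using assms by simp
      also have "\<dots> \<le> norm (a + of_nat k)" by (rule complex_Re_le_cmod)
      finally show ?thesis by (simp add: norm_divide del: of_nat_Suc)
    qed
    ultimately show ?thesis
      using mult_left_mono[of 1 "norm ((a + of_nat k) / of_nat (Suc k))" "norm (v k)"] by (simp only: norm_mult norm_ge_zero mult_1_right)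
  qed
  hence mono: "norm (v k) \<le> norm (v (k + N))" by (rule lift_Suc_mono_le) simp
  have A: "Gamma (a + (1 + of_nat N) + of_nat k) = (a + of_nat (k + N)) * Gamma (a + of_nat (k + N))"
    using Gamma_plus1[OF not_nonpos_Int_plus_of_nat[OF ni, of "k + N"]] by (simp add: add_ac)
  have B: "Gamma (1 + of_nat N + of_nat k) = (fact (k + N) :: complex)"
    using Gamma_fact[of "k + N", where ?'a = complex] by (simp add: add_ac)
  have "zb_coeff a (1 + of_nat N) k = v k / v (k + N) / (a + of_nat (k + N))"
    unfolding zb_coeff_def A B v_def by (simp add: field_simps)
  hence "norm (zb_coeff a (1 + of_nat N) k) = norm (v k) / norm (v (k + N)) / norm (a + of_nat (k + N))"
    by (simp only: norm_divide)
  also have "\<dots> \<le> 1 / real (k + N + 1)"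
  proof (rule frac_le)
    show "norm (v k) / norm (v (k + N)) \<le> 1" using mono v0 by (simp add: divide_le_eq_1)
    have "real (k + N + 1) \<le> Re (a + of_nat (k + N))" using assms by simp
    also have "\<dots> \<le> norm (a + of_nat (k + N))" by (rule complex_Re_le_cmod)
    finally show "real (k + N + 1) \<le> norm (a + of_nat (k + N))" .
  qed auto
  finally show ?thesis .
qed

text \<open>
  By \<open>zb_const_plus_of_nat\<close> both b and 1 may be shifted by N.  After the shift the two constants differ
  by a series with terms O(1/(k+N)^2), hence by o(1), and what the shifts contribute tends to
  \<psi>(1) - \<psi>(b).  For b = 1 the coefficients are 1/(a+k) and the constant is \<psi>(1) - \<psi>(a).
\<close>

lemma zb_const_Re_ge_1:
  assumes a: "Re a \<ge> 1" and ni: "b \<notin> \<int>\<^sub>\<le>\<^sub>0" "a + b - 1 \<notin> \<int>\<^sub>\<le>\<^sub>0"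
  shows "zb_const a b = 2 * Digamma 1 - Digamma a - Digamma b"
proof -
  have nia: "a \<notin> \<int>\<^sub>\<le>\<^sub>0" using a by (auto elim!: nonpos_Ints_cases')
  have nia1: "a + 1 \<notin> \<int>\<^sub>\<le>\<^sub>0" using not_nonpos_Int_plus_of_nat[OF nia, of 1] by simp
  have niab: "a + b \<notin> \<int>\<^sub>\<le>\<^sub>0" using not_nonpos_Int_plus_of_nat[OF ni(2), of 1] by simp
  have one: "(1::complex) \<notin> \<int>\<^sub>\<le>\<^sub>0" by simp
  have b0: "b \<noteq> 0" using ni by auto
  obtain B where B: "B \<ge> 0" "\<And>n. norm (gamma_quot b (a + 1) (a + b) 1 n - 1) \<le> B / real (n + 1)"
    using gamma_quot_rate[OF ni(1) nia1 niab one] by (auto simp: add_ac)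
  have rel: "zb_coeff a (b + of_nat N) k = zb_coeff a (1 + of_nat N) k * gamma_quot b (a + 1) (a + b) 1 (k + N)" for k N
  proof -
    have [simp]: "Gamma (1 + of_nat (k + N)) \<noteq> (0::complex)" "Gamma (a + 1 + of_nat (k + N)) \<noteq> 0"
      unfolding Gamma_eq_zero_iff by (intro not_nonpos_Int_plus_of_nat one nia1)+
    have e: "b + of_nat N + of_nat k = b + of_nat (k + N)" "a + (b + of_nat N) + of_nat k = a + b + of_nat (k + N)"
       "1 + of_nat N + of_nat k = (1 + of_nat (k + N) :: complex)" "a + (1 + of_nat N) + of_nat k = a + 1 + of_nat (k + N)"
      by simp_all
    show ?thesis unfolding zb_coeff_def gamma_quot_def e by (simp del: of_nat_add)
  qed
  have diff: "zb_const a b - zb_const a 1 = (zb_const a (b + of_nat N) - zb_const a (1 + of_nat N)) + 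
      (\<Sum>j<N. 1 / (b + of_nat j) - 1 / (1 + of_nat j))" for N
    using zb_const_plus_of_nat[OF nia ni, of N] zb_const_plus_of_nat[OF nia one, of N] nia
    by (simp add: sum_subtractf)
  define T where "T = (\<lambda>N. \<Sum>k. B / real (k + N + 1) ^ 2)"
  have T0: "T \<longlonglongrightarrow> 0"
  proof -
    note s = summable_const_over_squares[of B]
    have "T N = suminf (\<lambda>k. B / real (k + 1) ^ 2) - (\<Sum>i<N. B / real (i + 1) ^ 2)" for N
      unfolding T_def by (rule suminf_minus_initial_segment[OF s])
    hence "T = (\<lambda>N. suminf (\<lambda>k. B / real (k + 1) ^ 2) - (\<Sum>i<N. B / real (i + 1) ^ 2))" by auto
    also have "\<dots> \<longlonglongrightarrow> suminf (\<lambda>k. B / real (k + 1) ^ 2) - suminf (\<lambda>k. B / real (k + 1) ^ 2)"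
      by (intro tendsto_intros summable_LIMSEQ s)
    finally show ?thesis by simp
  qed
  have bnd: "norm (zb_const a (b + of_nat N) - zb_const a (1 + of_nat N)) \<le> T N" for N
  proof -
    have n1: "b + of_nat N \<notin> \<int>\<^sub>\<le>\<^sub>0" "1 + of_nat N \<notin> (\<int>\<^sub>\<le>\<^sub>0 :: complex set)"
       "a + (b + of_nat N) - 1 \<notin> \<int>\<^sub>\<le>\<^sub>0" "a + (1 + of_nat N) - 1 \<notin> \<int>\<^sub>\<le>\<^sub>0"
      using not_nonpos_Int_plus_of_nat[OF ni(1), of N] not_nonpos_Int_plus_of_nat[OF one, of N]
         not_nonpos_Int_plus_of_nat[OF ni(2), of N] not_nonpos_Int_plus_of_nat[OF nia, of N]
      by (simp_all add: algebra_simps)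
    have "zb_const a (b + of_nat N) - zb_const a (1 + of_nat N) = 
       (\<Sum>k. (zb_coeff a (b + of_nat N) k - 1 / of_nat (k + 1)) - (zb_coeff a (1 + of_nat N) k - 1 / of_nat (k + 1)))"
      unfolding zb_const_def by (intro suminf_diff summable_norm_cancel[OF zb_coeff_summable] nia n1)
    also have "\<dots> = (\<Sum>k. zb_coeff a (b + of_nat N) k - zb_coeff a (1 + of_nat N) k)" by simp
    also have "norm \<dots> \<le> T N" unfolding T_def
    proof (rule norm_suminf_le)
      show "summable (\<lambda>k. B / real (k + N + 1) ^ 2)"
        using summable_ignore_initial_segment[OF summable_const_over_squares[of B], of N] by simp
      fix k
      have "zb_coeff a (b + of_nat N) k - zb_coeff a (1 + of_nat N) k = 
          zb_coeff a (1 + of_nat N) k * (gamma_quot b (a + 1) (a + b) 1 (k + N) - 1)"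
        unfolding rel by (simp add: right_diff_distrib)
      also have "norm \<dots> \<le> (1 / real (k + N + 1)) * (B / real (k + N + 1))"
        unfolding norm_mult using zb_coeff_tail_bound[OF a] B(2)[of "k + N"] by (intro mult_mono) auto
      finally show "norm (zb_coeff a (b + of_nat N) k - zb_coeff a (1 + of_nat N) k) \<le> B / real (k + N + 1) ^ 2"
        by (simp add: power2_eq_square)
    qed
    finally show ?thesis .
  qed
  have "(\<lambda>N. zb_const a (b + of_nat N) - zb_const a (1 + of_nat N)) \<longlonglongrightarrow> 0"
    by (rule Lim_null_comparison[OF _ T0]) (use bnd in auto)
  moreover have "(\<lambda>N. \<Sum>j<N. 1 / (b + of_nat j) - 1 / (1 + of_nat j)) \<longlonglongrightarrow> Digamma 1 - Digamma b"
    using Digamma_sums[OF b0] by (simp add: sums_def)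
  ultimately have "(\<lambda>N. (zb_const a (b + of_nat N) - zb_const a (1 + of_nat N)) +
      (\<Sum>j<N. 1 / (b + of_nat j) - 1 / (1 + of_nat j))) \<longlonglongrightarrow> 0 + (Digamma 1 - Digamma b)"
    by (rule tendsto_add)
  hence "(\<lambda>N::nat. zb_const a b - zb_const a 1) \<longlonglongrightarrow> 0 + (Digamma 1 - Digamma b)"
    by (simp only: diff[symmetric])
  hence "zb_const a b - zb_const a 1 = 0 + (Digamma 1 - Digamma b)" by (simp add: LIMSEQ_const_iff)
  thus ?thesis unfolding zb_const_1[OF nia] by (simp add: algebra_simps del: Digamma_1)
qed

text \<open>
  Lowering a by 1 changes both sides by 1/a, which removes the restriction on Re a.
\<close>

lemma zb_const_eq:
  assumes ni: "a \<notin> \<int>\<^sub>\<le>\<^sub>0" "b \<notin> \<int>\<^sub>\<le>\<^sub>0" "a + b - 1 \<notin> \<int>\<^sub>\<le>\<^sub>0"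
  shows "zb_const a b = 2 * Digamma 1 - Digamma a - Digamma b"
proof -
  obtain n where n: "real n \<ge> 1 - Re a" using real_arch_simple by blast
  hence "Re a + real n \<ge> 1" by simp
  thus ?thesis using ni
  proof (induction n arbitrary: a)
    case 0 thus ?case by (intro zb_const_Re_ge_1) auto
  next
    case (Suc n)
    have a0: "a \<noteq> 0" using Suc.prems by auto
    have "a + 1 \<notin> \<int>\<^sub>\<le>\<^sub>0" "a + 1 + b - 1 \<notin> \<int>\<^sub>\<le>\<^sub>0" 
      using not_nonpos_Int_plus_of_nat[OF Suc.prems(2), of 1] not_nonpos_Int_plus_of_nat[OF Suc.prems(4), of 1]
      by (simp_all add: algebra_simps)
    hence "zb_const (a + 1) b = 2 * Digamma 1 - Digamma (a + 1) - Digamma b"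
      using Suc.prems by (intro Suc.IH) auto
    moreover have "zb_const b (a + 1) = zb_const b a - 1 / a"
      using Suc.prems by (intro zb_const_plus1) (auto simp: add.commute)
    ultimately show ?case using Digamma_plus1[OF a0] by (simp add: zb_const_commute algebra_simps)
  qed
qed

section \<open>Growth of the coefficients\<close>

lemma continuous_on_abs_summable_powser:
  fixes d :: "nat \<Rightarrow> complex"
  assumes "summable (\<lambda>n. norm (d n))"
  shows "continuous_on (cball 0 1) (\<lambda>z. \<Sum>n. d n * z ^ n)"
proof (rule uniform_limit_theorem[where F = sequentially])
  show "uniform_limit (cball 0 1) (\<lambda>n z. \<Sum>i<n. d i * z ^ i) (\<lambda>z. \<Sum>n. d n * z ^ n) sequentially"
  proof (rule Weierstrass_m_test[OF _ assms])
    fix n and z :: complex assume "z \<in> cball 0 1"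
    hence "norm z ^ n \<le> 1" by (simp add: power_le_one)
    from mult_left_mono[OF this, of "norm (d n)"] show "norm (d n * z ^ n) \<le> norm (d n)"
      by (simp add: norm_mult norm_power)
  qed
qed (auto intro!: always_eventually continuous_intros)

lemma continuous_on_eval_fps_cball:
  fixes F :: "complex fps"
  assumes "summable (\<lambda>n. norm (fps_nth F n))"
  shows "continuous_on (cball 0 1) (eval_fps F)"
  using continuous_on_abs_summable_powser[OF assms] by (simp add: eval_fps_def[abs_def])

lemma fps_conv_radius_ge_1:
  fixes F :: "complex fps"
  assumes "summable (\<lambda>n. norm (fps_nth F n))"
  shows "fps_conv_radius F \<ge> 1"
proof -
  have "summable (\<lambda>n. fps_nth F n * 1 ^ n)" using summable_norm_cancel[OF assms] by simp
  from conv_radius_geI[OF this] show ?thesis by (simp add: fps_conv_radius_def one_ereal_def)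
qed

lemma gauss_fps_1_Suc:
  "fps_nth (gauss_fps a b 1) (Suc n) = (a + of_nat n) * (b + of_nat n) / of_nat (Suc n) ^ 2 * fps_nth (gauss_fps a b 1) n"
proof -
  have S0: "of_nat (Suc n) \<noteq> (0::complex)" unfolding of_nat_eq_0_iff by simp
  have "of_nat (Suc n) * of_nat (Suc n) * fps_nth (gauss_fps a b 1) (Suc n) = (a + of_nat n) * (b + of_nat n) * fps_nth (gauss_fps a b 1) n"
    using gauss_fps_Suc[OF one_not_nonpos_Int, of n a b] by simp
  thus ?thesis using S0 by (simp add: field_simps power2_eq_square del: of_nat_Suc)
qed

text \<open>
  For fixed sum a + b = 2s the factors (a+n)(b+n) and (s+n)^2 differ by the constant ab - s^2, so
  the quotient of the coefficients is a product of factors 1 + O(1/n^2), uniformly for bounded ab.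
  The uniformity is what the limit towards a pole of the digamma function needs.
\<close>

lemma gauss_coeff_comparison:
  assumes s: "s \<notin> \<int>\<^sub>\<le>\<^sub>0"
  obtains M where "M \<ge> 0" "\<And>a b n. a + b = 2 * s \<Longrightarrow> norm (a * b) \<le> R \<Longrightarrow>
     norm (fps_nth (gauss_fps a b 1) n) \<le> M * norm (fps_nth (gauss_fps s s 1) n)"
proof -
  obtain \<epsilon> where \<epsilon>: "\<epsilon> > 0" "\<And>n. \<epsilon> * real (n + 1) \<le> norm (s + of_nat n)"
    using add_of_nat_lower_bound1[OF s] by metis
  define C where "C = \<bar>R\<bar> + norm (s * s)"
  define e where "e = (\<lambda>n. (C / \<epsilon>^2) / real (n + 1) ^ 2)"
  have e0: "e n \<ge> 0" for n using \<epsilon> by (simp add: e_def C_def)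
  have se: "summable e" unfolding e_def by (rule summable_const_over_squares)
  have nz: "s + of_nat n \<noteq> 0" for n by (rule not_nonpos_Int_add_of_nat[OF s])
  have main: "norm (fps_nth (gauss_fps a b 1) n) \<le> exp (\<Sum>j<n. e j) * norm (fps_nth (gauss_fps s s 1) n)"
    if ab: "a + b = 2 * s" "norm (a * b) \<le> R" for a b n
  proof (induction n)
    case 0 show ?case by (simp add: fps_nth_gauss_fps)
  next
    case (Suc n)
    have "(a + of_nat n) * (b + of_nat n) = a * b + of_nat n * (a + b) + of_nat n * of_nat n" by (simp add: algebra_simps)
    also have "\<dots> = (s + of_nat n) * (s + of_nat n) + (a * b - s * s)" unfolding ab(1) by (simp add: algebra_simps)
    also have "norm \<dots> \<le> norm ((s + of_nat n) * (s + of_nat n)) + norm (a * b - s * s)" by (rule norm_triangle_ineq)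
    also have "norm (a * b - s * s) \<le> C"
      using norm_triangle_ineq4[of "a * b" "s * s"] ab(2) by (simp add: C_def)
    also have "C = e n * (\<epsilon> * real (n + 1))\<^sup>2" using \<epsilon> by (simp add: e_def power_mult_distrib)
    also have "\<dots> \<le> e n * (norm (s + of_nat n))\<^sup>2" 
      using \<epsilon> e0 by (intro mult_left_mono power_mono) auto
    also have "norm ((s + of_nat n) * (s + of_nat n)) + e n * (norm (s + of_nat n))\<^sup>2 = (1 + e n) * norm ((s + of_nat n) * (s + of_nat n))"
    proof -
      have "norm (x * x) + r * (norm x)\<^sup>2 = (1 + r) * norm (x * x)" for x :: complex and r
        by (simp add: norm_mult power2_eq_square algebra_simps)
      thus ?thesis .
    qed
    also have "\<dots> \<le> exp (e n) * norm ((s + of_nat n) * (s + of_nat n))"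
      by (intro mult_right_mono exp_ge_add_one_self) auto
    finally have *: "norm ((a + of_nat n) * (b + of_nat n)) \<le> exp (e n) * norm ((s + of_nat n) * (s + of_nat n))" by simp
    have "norm (fps_nth (gauss_fps a b 1) (Suc n)) = 
        norm ((a + of_nat n) * (b + of_nat n)) / real (Suc n) ^ 2 * norm (fps_nth (gauss_fps a b 1) n)"
      unfolding gauss_fps_1_Suc by (simp only: norm_mult norm_divide norm_power norm_of_nat)
    also have "\<dots> \<le> (exp (e n) * norm ((s + of_nat n) * (s + of_nat n))) / real (Suc n) ^ 2 * (exp (\<Sum>j<n. e j) * norm (fps_nth (gauss_fps s s 1) n))"
      by (intro mult_mono divide_right_mono * Suc.IH) auto
    also have "\<dots> = exp (\<Sum>j<Suc n. e j) * norm (fps_nth (gauss_fps s s 1) (Suc n))"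
      unfolding gauss_fps_1_Suc by (simp add: norm_mult norm_divide norm_power exp_add del: of_nat_Suc)
    finally show ?case .
  qed
  show ?thesis
  proof (rule that[of "exp (suminf e)"])
    fix a b n assume ab: "a + b = 2 * s" "norm (a * b) \<le> R"
    have "exp (\<Sum>j<n. e j) \<le> exp (suminf e)" using sum_le_suminf[OF se, of "{..<n}"] e0 by simp
    from mult_right_mono[OF this, of "norm (fps_nth (gauss_fps s s 1) n)"] main[OF ab, of n]
    show "norm (fps_nth (gauss_fps a b 1) n) \<le> exp (suminf e) * norm (fps_nth (gauss_fps s s 1) n)" by simp
  qed simp
qed

text \<open>
  Raabe's test: n (u(n)/u(n+1) - 1) tends to 2 - 2 Re s > 1.
\<close>

lemma gauss_coeff_summable_diag:
  assumes s: "s \<notin> \<int>\<^sub>\<le>\<^sub>0" and Re_s: "Re s < 1 / 2"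
  shows "summable (\<lambda>n. norm (fps_nth (gauss_fps s s 1) n))"
proof (rule raabes_test_convergence)
  let ?f = "\<lambda>n. norm (fps_nth (gauss_fps s s 1) n)"
  have pos: "?f n > 0" for n
    using pochhammer_not_nonpos_Int[OF s, of n] by (simp add: fps_nth_gauss_fps pochhammer_fact[symmetric])
  thus "eventually (\<lambda>n. ?f n > 0) sequentially" by simp
  define \<sigma> \<tau> where "\<sigma> = Re s" and "\<tau> = Im s"
  have ratio: "?f n / ?f (Suc n) = real (Suc n) ^ 2 / ((\<sigma> + real n)^2 + \<tau>^2)" for n
  proof -
    have nz: "s + of_nat n \<noteq> 0" by (rule not_nonpos_Int_add_of_nat[OF s])
    have "norm (s + of_nat n) ^ 2 = (\<sigma> + real n)^2 + \<tau>^2" by (simp add: cmod_power2 \<sigma>_def \<tau>_def)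
    moreover have "?f n / ?f (Suc n) = real (Suc n) ^ 2 / norm (s + of_nat n) ^ 2"
    proof -
      have fS: "?f (Suc n) = norm (s + of_nat n) ^ 2 / real (Suc n) ^ 2 * ?f n"
        unfolding gauss_fps_1_Suc by (simp only: norm_mult norm_divide norm_power norm_of_nat power2_eq_square)
      show ?thesis unfolding fS using pos[of n] nz by (simp del: of_nat_Suc)
    qed
    ultimately show ?thesis by simp
  qed
  have "(\<lambda>n. real n * (real (Suc n) ^ 2 / ((\<sigma> + real n)^2 + \<tau>^2) - 1)) \<longlonglongrightarrow> 2 - 2 * \<sigma>"
    by real_asymp
  hence "(\<lambda>n. ereal (real n * (?f n / ?f (Suc n) - 1))) \<longlonglongrightarrow> ereal (2 - 2 * \<sigma>)"
    unfolding ratio by simp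
  hence "liminf (\<lambda>n. ereal (real n * (?f n / ?f (Suc n) - 1))) = ereal (2 - 2 * \<sigma>)"
    by (intro lim_imp_Liminf) auto
  moreover have "ereal (2 - 2 * \<sigma>) > 1" using Re_s by (simp add: \<sigma>_def one_ereal_def)
  ultimately show "liminf (\<lambda>n. ereal (real n * (?f n / ?f (Suc n) - 1))) > 1" by simp
qed

lemma gauss_coeff_summable:
  assumes s: "s \<notin> \<int>\<^sub>\<le>\<^sub>0" and Re_s: "Re s < 1 / 2" and ab: "a + b = 2 * s"
  shows "summable (\<lambda>n. norm (fps_nth (gauss_fps a b 1) n))"
proof -
  obtain M where "M \<ge> 0" "\<And>n. norm (fps_nth (gauss_fps a b 1) n) \<le> M * norm (fps_nth (gauss_fps s s 1) n)"
    using gauss_coeff_comparison[OF s, of "norm (a * b)"] ab by (metis order_refl)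
  thus ?thesis by (intro summable_comparison_test[OF _ summable_mult[OF gauss_coeff_summable_diag[OF s Re_s], of M]]) auto
qed

lemma Digamma_add_of_nat:
  fixes z :: complex
  assumes "z \<notin> \<int>\<^sub>\<le>\<^sub>0"
  shows "Digamma (z + of_nat n) = Digamma z + (\<Sum>j<n. 1 / (z + of_nat j))"
proof (induction n)
  case (Suc n)
  have "Digamma (z + of_nat n + 1) = Digamma (z + of_nat n) + 1 / (z + of_nat n)"
    by (rule Digamma_plus1[OF not_nonpos_Int_add_of_nat[OF assms]])
  thus ?case using Suc by (simp add: add_ac)
qed simp

text \<open>
  The increments in n of the difference are (z-1)/((1+n)(z+n)) = O(1/n^2), uniformly on K.
\<close>

lemma Digamma_diff_bounded:
  fixes K :: "complex set"
  assumes K: "compact K" "K \<inter> \<int>\<^sub>\<le>\<^sub>0 = {}"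
  obtains B where "B \<ge> 0" "\<And>z n. z \<in> K \<Longrightarrow> norm (Digamma (1 + of_nat n) - Digamma (z + of_nat n)) \<le> B"
proof -
  obtain \<epsilon> where \<epsilon>: "\<epsilon> > 0" "\<And>z n. z \<in> K \<Longrightarrow> \<epsilon> * real (n + 1) \<le> norm (z + of_nat n)"
    using add_of_nat_lower_bound[OF K] by metis
  have "continuous_on K (\<lambda>z. Digamma 1 - Digamma z)"
    by (intro continuous_intros continuous_on_Polygamma K)
  hence "bounded ((\<lambda>z. Digamma 1 - Digamma z) ` K)"
    by (intro compact_imp_bounded compact_continuous_image K(1))
  then obtain B0 where B0: "B0 > 0" "\<And>z. z \<in> K \<Longrightarrow> norm (Digamma 1 - Digamma z) \<le> B0"
    unfolding bounded_pos by (metis image_eqI)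
  obtain M where M: "M > 0" "\<And>z. z \<in> K \<Longrightarrow> norm z \<le> M"
    using compact_imp_bounded[OF K(1)] bounded_pos by blast
  define C where "C = (M + 1) / \<epsilon>"
  define T where "T = (\<Sum>n. C / real (n + 1) ^ 2)"
  have C0: "C \<ge> 0" using M \<epsilon> by (simp add: C_def)
  have T0: "(\<Sum>j<n. C / real (j + 1) ^ 2) \<le> T" for n unfolding T_def
    using C0 by (intro sum_le_suminf summable_const_over_squares) auto
  show ?thesis
  proof (rule that[of "B0 + T"])
    show "B0 + T \<ge> 0" using B0 T0[of 0] by simp
    fix z n assume z: "z \<in> K"
    have zni: "z \<notin> \<int>\<^sub>\<le>\<^sub>0" using z K by blast
    have "Digamma (1 + of_nat n) - Digamma (z + of_nat n) = (Digamma 1 - Digamma z) + (\<Sum>j<n. 1 / (1 + of_nat j) - 1 / (z + of_nat j))"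
      unfolding Digamma_add_of_nat[OF zni] Digamma_add_of_nat[OF one_not_nonpos_Int] by (simp add: sum_subtractf)
    also have "norm \<dots> \<le> norm (Digamma 1 - Digamma z) + norm (\<Sum>j<n. 1 / (1 + of_nat j) - 1 / (z + of_nat j))"
      by (rule norm_triangle_ineq)
    also have "\<dots> \<le> B0 + (\<Sum>j<n. C / real (j + 1) ^ 2)"
    proof (intro add_mono B0 z sum_norm_le)
      fix j
      have nz: "z + of_nat j \<noteq> 0" "1 + of_nat j \<noteq> (0::complex)"
        by (rule not_nonpos_Int_add_of_nat[OF zni], rule not_nonpos_Int_add_of_nat[OF one_not_nonpos_Int])
      have nj: "norm (1 + of_nat j :: complex) = real (j + 1)" by (metis of_nat_Suc norm_of_nat Suc_eq_plus1)
      have "1 / (1 + of_nat j) - 1 / (z + of_nat j) = (z - 1) / ((1 + of_nat j) * (z + of_nat j))"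
        using diff_frac_eq[OF nz(2,1), of 1 1] by simp
      hence "norm (1 / (1 + of_nat j) - 1 / (z + of_nat j)) = norm (z - 1) / (real (j + 1) * norm (z + of_nat j))"
        by (simp only: norm_divide norm_mult nj)
      also have "\<dots> \<le> (M + 1) / (real (j + 1) * (\<epsilon> * real (j + 1)))"
      proof (intro frac_le mult_left_mono \<epsilon> z)
        show "norm (z - 1) \<le> M + 1" using norm_triangle_ineq4[of z 1] M(2)[OF z] by simp
      qed (use M \<epsilon> in auto)
      also have "\<dots> = C / real (j + 1) ^ 2" by (simp add: C_def power2_eq_square mult_ac)
      finally show "norm (1 / (1 + of_nat j) - 1 / (z + of_nat j)) \<le> C / real (j + 1) ^ 2" .
    qed
    also have "\<dots> \<le> B0 + T" using T0 by simp
    finally show "norm (Digamma (1 + of_nat n) - Digamma (z + of_nat n)) \<le> B0 + T" .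
  qed
qed

definition digamma_bracket :: "complex \<Rightarrow> complex \<Rightarrow> nat \<Rightarrow> complex" where
  "digamma_bracket a b n = 2 * Digamma (of_nat n + 1) - Digamma (a + of_nat n) - Digamma (b + of_nat n)"

text \<open>
  The power series part of the logarithmic solution, with the terms of S as coefficients up to sign.
\<close>

definition log_fps :: "complex \<Rightarrow> complex \<Rightarrow> complex fps" where
  "log_fps a b = Abs_fps (\<lambda>n. fps_nth (gauss_fps a b 1) n * digamma_bracket a b n)"

lemma S_term_eq: "S_term \<alpha> s n = fps_nth (log_fps (s - \<alpha> / 2) (s + \<alpha> / 2)) n * (-1) ^ n"
  by (simp add: S_term_def Let_def log_fps_def digamma_bracket_def fps_nth_gauss_fps pochhammer_fact[symmetric] power2_eq_square mult_ac)

lemma S_fun_eq: "S_fun \<alpha> s = eval_fps (log_fps (s - \<alpha> / 2) (s + \<alpha> / 2)) (-1)"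
  by (simp add: S_fun_def eval_fps_def S_term_eq)

lemma digamma_bracket_bounded:
  assumes "a \<notin> \<int>\<^sub>\<le>\<^sub>0" "b \<notin> \<int>\<^sub>\<le>\<^sub>0"
  obtains B where "B \<ge> 0" "\<And>n. norm (digamma_bracket a b n) \<le> B"
proof -
  obtain B where B: "B \<ge> 0" "\<And>z n. z \<in> {a, b} \<Longrightarrow> norm (Digamma (1 + of_nat n) - Digamma (z + of_nat n)) \<le> B"
    by (rule Digamma_diff_bounded[of "{a, b}"]) (use assms in auto)
  show ?thesis
  proof (rule that[of "B + B"])
    fix n
    have eq: "digamma_bracket a b n = (Digamma (1 + of_nat n) - Digamma (a + of_nat n)) + (Digamma (1 + of_nat n) - Digamma (b + of_nat n))"
      by (simp add: digamma_bracket_def add_ac)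
    show "norm (digamma_bracket a b n) \<le> B + B"
      unfolding eq by (intro norm_triangle_mono B(2)) auto
  qed (use B in auto)
qed

lemma log_fps_summable:
  assumes s: "s \<notin> \<int>\<^sub>\<le>\<^sub>0" and Re_s: "Re s < 1 / 2" and ab: "a + b = 2 * s" and ni: "a \<notin> \<int>\<^sub>\<le>\<^sub>0" "b \<notin> \<int>\<^sub>\<le>\<^sub>0"
  shows "summable (\<lambda>n. norm (fps_nth (log_fps a b) n))"
proof -
  obtain B where B: "B \<ge> 0" "\<And>n. norm (digamma_bracket a b n) \<le> B"
    using digamma_bracket_bounded[OF ni] by metis
  have "norm (fps_nth (log_fps a b) n) \<le> norm (fps_nth (gauss_fps a b 1) n) * B" for n
    using B by (auto simp: log_fps_def norm_mult intro!: mult_left_mono)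
  thus ?thesis
    by (intro summable_comparison_test[OF _ summable_mult2[OF gauss_coeff_summable[OF s Re_s ab], of B]]) auto
qed

text \<open>
  The bracket grows from n to n + 1 by 2/(n+1) - 1/(a+n) - 1/(b+n), the negative logarithmic derivative
  with respect to n of the quotient (a+n)(b+n)/(n+1)^2.  The right-hand side is the
  inhomogeneity that applying the hypergeometric operator to U log x leaves behind.
\<close>

lemma log_fps_Suc:
  assumes ni: "a \<notin> \<int>\<^sub>\<le>\<^sub>0" "b \<notin> \<int>\<^sub>\<le>\<^sub>0"
  shows "of_nat (Suc n) * (1 + of_nat n) * fps_nth (log_fps a b) (Suc n) - (a + of_nat n) * (b + of_nat n) * fps_nth (log_fps a b) n
     = 2 * of_nat (Suc n) * fps_nth (gauss_fps a b 1) (Suc n) - (2 * of_nat n + a + b) * fps_nth (gauss_fps a b 1) n"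
proof -
  let ?c = "fps_nth (gauss_fps a b 1)" let ?h = "digamma_bracket a b"
  have S0: "of_nat (Suc n) \<noteq> (0::complex)" unfolding of_nat_eq_0_iff by simp
  have a0: "a + of_nat n \<noteq> 0" and b0: "b + of_nat n \<noteq> 0"
    by (rule not_nonpos_Int_add_of_nat[OF ni(1)], rule not_nonpos_Int_add_of_nat[OF ni(2)])
  have D: "Digamma (z + of_nat (Suc n)) = Digamma (z + of_nat n) + 1 / (z + of_nat n)" if "z + of_nat n \<noteq> 0" for z :: complex
    using Digamma_plus1[OF that] by (simp add: add_ac)
  have D1: "Digamma (of_nat (Suc n) + 1) = Digamma (of_nat n + 1) + 1 / (of_nat (Suc n) :: complex)"
    using Digamma_plus1[OF S0] by (simp add: add_ac)
  have h: "?h (Suc n) = ?h n + 2 / of_nat (Suc n) - 1 / (a + of_nat n) - 1 / (b + of_nat n)"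
    unfolding digamma_bracket_def D[OF a0] D[OF b0] D1 by (simp add: algebra_simps)
  have c: "of_nat (Suc n) * (1 + of_nat n) * ?c (Suc n) = (a + of_nat n) * (b + of_nat n) * ?c n"
    by (rule gauss_fps_Suc[OF one_not_nonpos_Int])
  have "of_nat (Suc n) * (1 + of_nat n) * fps_nth (log_fps a b) (Suc n) - (a + of_nat n) * (b + of_nat n) * fps_nth (log_fps a b) n
     = (of_nat (Suc n) * (1 + of_nat n) * ?c (Suc n)) * ?h (Suc n) - ((a + of_nat n) * (b + of_nat n) * ?c n) * ?h n"
    by (simp add: log_fps_def mult.assoc)
  also have "\<dots> = (of_nat (Suc n) * (1 + of_nat n) * ?c (Suc n)) * (2 / of_nat (Suc n)) - 
     ((a + of_nat n) * (b + of_nat n) * ?c n) * (1 / (a + of_nat n) + 1 / (b + of_nat n))"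
    unfolding h c by (simp add: algebra_simps)
  also have "(of_nat (Suc n) * (1 + of_nat n) * ?c (Suc n)) * (2 / of_nat (Suc n)) = 2 * of_nat (Suc n) * ?c (Suc n)"
    using S0 by (simp add: of_nat_Suc[symmetric] del: of_nat_Suc)
  also have "((a + of_nat n) * (b + of_nat n) * ?c n) * (1 / (a + of_nat n) + 1 / (b + of_nat n)) = (2 * of_nat n + a + b) * ?c n"
  proof -
    have "(x * y * d) * (1 / x + 1 / y) = (x + y) * d" if "x \<noteq> 0" "y \<noteq> 0" for x y d :: complex
      using that by (simp add: field_simps)
    from this[OF a0 b0, of "?c n"] show ?thesis by (simp add: algebra_simps)
  qed
  finally show ?thesis .
qed

section \<open>The logarithmic solution\<close>

text \<open>
  The substitution z \<mapsto> 1 - z exchanges the singular points 0 and 1 and turns c into a + b + 1 - c.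
\<close>

lemma hypergeo_solution_reflect:
  assumes "hypergeo_solution a b c D y y'"
  shows "hypergeo_solution a b (a + b + 1 - c) ((\<lambda>z. 1 - z) -` D) (\<lambda>z. y (1 - z)) (\<lambda>z. - y' (1 - z))"
  unfolding hypergeo_solution_def
proof (intro ballI conjI)
  fix z assume z: "z \<in> (\<lambda>z. 1 - z) -` D"
  obtain d where y: "(y has_field_derivative y' (1 - z)) (at (1 - z))" and
    d: "(y' has_field_derivative d) (at (1 - z))"
       "(1 - z) * (1 - (1 - z)) * d + (c - (a + b + 1) * (1 - z)) * y' (1 - z) - a * b * y (1 - z) = 0"
    using assms z unfolding hypergeo_solution_def by (metis vimage_eq)
  have r: "((\<lambda>z. 1 - z) has_field_derivative -1) (at z)" by (auto intro!: derivative_eq_intros)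
  show "((\<lambda>z. y (1 - z)) has_field_derivative - y' (1 - z)) (at z)" using DERIV_chain2[OF y r] by simp
  have "((\<lambda>z. - y' (1 - z)) has_field_derivative d) (at z)" using DERIV_minus[OF DERIV_chain2[OF d(1) r]] by simp
  moreover have "z * (1 - z) * d + (a + b + 1 - c - (a + b + 1) * z) * - y' (1 - z) - a * b * y (1 - z) = 
    (1 - z) * (1 - (1 - z)) * d + (c - (a + b + 1) * (1 - z)) * y' (1 - z) - a * b * y (1 - z)"
    by (simp add: algebra_simps)
  ultimately show "\<exists>d. ((\<lambda>z. - y' (1 - z)) has_field_derivative d) (at z) \<and>
     z * (1 - z) * d + (a + b + 1 - c - (a + b + 1) * z) * - y' (1 - z) - a * b * y (1 - z) = 0"
    using d(2) by metis
qed

text \<open>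
  Cramer's rule for the initial data at z0.
\<close>

lemma hypergeo_solution_combine:
  assumes f: "hypergeo_solution a b c D f f'" and u: "hypergeo_solution a b c D u u'" and w: "hypergeo_solution a b c D w w'"
    and D: "open D" "connected D" "z0 \<in> D" "z0 \<noteq> 0" "z0 \<noteq> 1"
    and wronskian: "u z0 * w' z0 - u' z0 * w z0 \<noteq> 0"
  obtains A B where "\<And>z. z \<in> D \<Longrightarrow> f z = A * u z + B * w z"
proof -
  define \<delta> where "\<delta> = u z0 * w' z0 - u' z0 * w z0"
  define A where "A = (f z0 * w' z0 - f' z0 * w z0) / \<delta>"
  define B where "B = (u z0 * f' z0 - u' z0 * f z0) / \<delta>"
  have \<delta>: "\<delta> \<noteq> 0" using wronskian by (simp add: \<delta>_def)
  have "\<delta> * (A * u z0 + B * w z0) = (\<delta> * A) * u z0 + (\<delta> * B) * w z0" by (simp add: algebra_simps)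
  also have "\<dots> = \<delta> * f z0" using \<delta> by (simp add: A_def B_def) (simp add: \<delta>_def algebra_simps)
  finally have 1: "f z0 = A * u z0 + B * w z0" using \<delta> by simp
  have "\<delta> * (A * u' z0 + B * w' z0) = (\<delta> * A) * u' z0 + (\<delta> * B) * w' z0" by (simp add: algebra_simps)
  also have "\<dots> = \<delta> * f' z0" using \<delta> by (simp add: A_def B_def) (simp add: \<delta>_def algebra_simps)
  finally have 2: "f' z0 = A * u' z0 + B * w' z0" using \<delta> by simp
  have sol: "hypergeo_solution a b c D (\<lambda>z. A * u z + B * w z) (\<lambda>z. A * u' z + B * w' z)"
    by (intro hypergeo_solution_add hypergeo_solution_cmult u w)
  show ?thesis
    by (rule that, rule hypergeo_solution_unique[OF f sol D 1 2])
qed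

lemma eval_fps_linear_mult:
  fixes G :: "complex fps"
  assumes z: "norm z < fps_conv_radius G"
  shows "eval_fps ((fps_const p - fps_const q * fps_X) * G) z = (p - q * z) * eval_fps G z"
    and "norm z < fps_conv_radius ((fps_const p - fps_const q * fps_X) * G)"
proof -
  have e: "fps_const p - fps_const q * fps_X = fps_of_poly [:p, -q:]"
    by (simp add: fps_of_poly_pCons algebra_simps fps_const_neg[symmetric] del: fps_const_neg)
  have "min (fps_conv_radius (fps_of_poly [:p, -q:])) (fps_conv_radius G) \<le> fps_conv_radius (fps_of_poly [:p, -q:] * G)"
    by (rule fps_conv_radius_mult)
  thus r: "norm z < fps_conv_radius ((fps_const p - fps_const q * fps_X) * G)"
    unfolding e using z by (auto simp: min_def split: if_splits)
  show "eval_fps ((fps_const p - fps_const q * fps_X) * G) z = (p - q * z) * eval_fps G z"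
    unfolding e using z by (simp add: eval_fps_mult algebra_simps)
qed

lemma sums_minus_ln_over:
  fixes z :: complex
  assumes "norm z < 1" "z \<noteq> 0"
  shows "(\<lambda>n. z ^ n / of_nat (n + 1)) sums (- Ln (1 - z) / z)"
proof -
  have A: "(\<lambda>n. (-1)^Suc n / of_nat n * (-z)^n) sums ln (1 + (-z))"
    by (rule Ln_series) (use assms in auto)
  have E: "(-1)^Suc n / of_nat n * (-z)^n = - (z ^ n / of_nat n)" for n
  proof -
    have "(-1)^n * (-z)^n = z ^ n" by (simp flip: power_mult_distrib)
    moreover have "(-1)^Suc n / of_nat n * (-z)^n = - ((-1)^n * (-z)^n / of_nat n)" by simp
    ultimately show ?thesis by (simp only:)
  qed
  have "(\<lambda>n. - (z ^ n / of_nat n)) sums ln (1 - z)" using A unfolding E by simp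
  from sums_minus[OF this] have "(\<lambda>n. z ^ n / of_nat n) sums (- ln (1 - z))" by simp
  hence "(\<lambda>n. z ^ Suc n / of_nat (Suc n)) sums (- ln (1 - z))" by (subst sums_Suc_iff) simp
  from sums_divide[OF this, of z] show ?thesis using assms(2) by (simp add: mult.commute)
qed

text \<open>
  The generic situation: neither a nor b is a pole of the Gamma function, and the condition on Re s
  makes the series U and D below converge absolutely on the closed unit disc.
\<close>

locale zero_balanced =
  fixes a b s :: complex
  assumes a_ni: "a \<notin> \<int>\<^sub>\<le>\<^sub>0" and b_ni: "b \<notin> \<int>\<^sub>\<le>\<^sub>0" and ab: "a + b = 2 * s"
    and two_s: "2 * s \<notin> \<int>" and Re_s: "Re s < 1 / 2"
begin

lemma two_s_ni: "2 * s \<notin> \<int>\<^sub>\<le>\<^sub>0" using two_s nonpos_Ints_Int by blast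

lemma s_ni: "s \<notin> \<int>\<^sub>\<le>\<^sub>0"
proof
  assume "s \<in> \<int>\<^sub>\<le>\<^sub>0"
  hence "s \<in> \<int>" by (rule nonpos_Ints_Int)
  hence "2 * s \<in> \<int>" by simp
  thus False using two_s by simp
qed

lemma ab_ni: "a + b \<notin> \<int>\<^sub>\<le>\<^sub>0" unfolding ab by (rule two_s_ni)

lemma ab1_ni: "a + b - 1 \<notin> \<int>\<^sub>\<le>\<^sub>0"
proof
  assume "a + b - 1 \<in> \<int>\<^sub>\<le>\<^sub>0"
  from Ints_add[OF nonpos_Ints_Int[OF this] Ints_1] have "a + b - 1 + 1 \<in> \<int>" .
  thus False using two_s by (simp add: ab)
qed

definition U where "U = eval_fps (gauss_fps a b 1)"
definition U' where "U' = eval_fps (fps_deriv (gauss_fps a b 1))"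
definition D where "D = eval_fps (log_fps a b)"
definition D' where "D' = eval_fps (fps_deriv (log_fps a b))"
definition W where "W = (\<lambda>x. D x - U x * Ln x)"
definition W' where "W' = (\<lambda>x. D' x - (U' x * Ln x + U x / x))"
definition C where "C = Gamma (a + b) / (Gamma a * Gamma b)"

lemma C_nonzero: "C \<noteq> 0"
  using a_ni b_ni ab_ni by (auto simp: C_def Gamma_eq_zero_iff)

lemma U_summable: "summable (\<lambda>n. norm (fps_nth (gauss_fps a b 1) n))"
  by (rule gauss_coeff_summable[OF s_ni Re_s ab])

lemma D_summable: "summable (\<lambda>n. norm (fps_nth (log_fps a b) n))"
  by (rule log_fps_summable[OF s_ni Re_s ab a_ni b_ni])

lemma U_continuous: "continuous_on (cball 0 1) U"
  unfolding U_def by (rule continuous_on_eval_fps_cball[OF U_summable])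

lemma D_continuous: "continuous_on (cball 0 1) D"
  unfolding D_def by (rule continuous_on_eval_fps_cball[OF D_summable])

lemma radius:
  assumes "norm x < 1"
  shows "norm x < fps_conv_radius (gauss_fps a b 1)" "norm x < fps_conv_radius (fps_deriv (gauss_fps a b 1))"
     "norm x < fps_conv_radius (fps_deriv (fps_deriv (gauss_fps a b 1)))"
     "norm x < fps_conv_radius (log_fps a b)" "norm x < fps_conv_radius (fps_deriv (log_fps a b))"
     "norm x < fps_conv_radius (fps_deriv (fps_deriv (log_fps a b)))"
proof -
  have lt: "ereal (norm x) < 1" using assms by (simp add: one_ereal_def)
  have g: "norm x < fps_conv_radius G \<and> norm x < fps_conv_radius (fps_deriv G) \<and> norm x < fps_conv_radius (fps_deriv (fps_deriv G))"
    if "1 \<le> fps_conv_radius G" for G :: "complex fps"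
    using that lt fps_conv_radius_deriv[of G] fps_conv_radius_deriv[of "fps_deriv G"]
    by (meson dual_order.strict_trans1 less_le_trans)
  show "norm x < fps_conv_radius (gauss_fps a b 1)" "norm x < fps_conv_radius (fps_deriv (gauss_fps a b 1))"
     "norm x < fps_conv_radius (fps_deriv (fps_deriv (gauss_fps a b 1)))"
    using g[OF fps_conv_radius_ge_1[OF U_summable]] by auto
  show "norm x < fps_conv_radius (log_fps a b)" "norm x < fps_conv_radius (fps_deriv (log_fps a b))"
     "norm x < fps_conv_radius (fps_deriv (fps_deriv (log_fps a b)))"
    using g[OF fps_conv_radius_ge_1[OF D_summable]] by auto
qed

lemma U_solution: "hypergeo_solution a b 1 (ball 0 1) U U'"
  unfolding U_def U'_def by (rule gauss_series_solution[OF one_not_nonpos_Int])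

text \<open>
  Both x(1-x)D'' + ... and the terms of U log x in which the logarithm is differentiated are equal to
  2(1-x)U' - (a+b)U; the terms with log x as a factor vanish since U is a solution.
\<close>

lemma W_solution: "hypergeo_solution a b 1 (ball 0 1 - \<real>\<^sub>\<le>\<^sub>0) W W'"
  unfolding hypergeo_solution_def
proof (intro ballI conjI exI)
  fix x :: complex assume x: "x \<in> ball 0 1 - \<real>\<^sub>\<le>\<^sub>0"
  hence nx: "norm x < 1" and xn: "x \<notin> \<real>\<^sub>\<le>\<^sub>0" by auto
  have x0: "x \<noteq> 0" using xn by auto
  note r = radius[OF nx]
  define U'' where "U'' = eval_fps (fps_deriv (fps_deriv (gauss_fps a b 1)))"
  define D'' where "D'' = eval_fps (fps_deriv (fps_deriv (log_fps a b)))"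
  have der[derivative_intros]: "(U has_field_derivative U' x) (at x)" "(U' has_field_derivative U'' x) (at x)"
     "(D has_field_derivative D' x) (at x)" "(D' has_field_derivative D'' x) (at x)"
    unfolding U_def U'_def U''_def D_def D'_def D''_def
    by (rule has_field_derivative_eval_fps r)+
  show "(W has_field_derivative W' x) (at x)"
    unfolding W_def W'_def by (rule derivative_eq_intros der xn refl | simp)+ (simp add: field_simps)
  show "(W' has_field_derivative (D'' x - (U'' x * Ln x + 2 * (U' x / x) - U x / x^2))) (at x)"
    unfolding W'_def
    by (rule derivative_eq_intros der xn x0 refl | simp)+ (use x0 in \<open>simp add: field_simps power2_eq_square\<close>)
  have LU: "x * (1 - x) * U'' x + (1 - (a + b + 1) * x) * U' x - a * b * U x = 0"
  proof -
    have z: "fps_X * (1 - fps_X) * fps_deriv (fps_deriv (gauss_fps a b 1)) +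
      (fps_const 1 - fps_const (a + b + 1) * fps_X) * fps_deriv (gauss_fps a b 1) - fps_const (a * b) * gauss_fps a b 1 = 0"
      unfolding fps_eq_iff gauss_ode_coeff gauss_fps_Suc[OF one_not_nonpos_Int] by simp
    show ?thesis using eval_gauss_operator[OF r(1), of 1 a b] unfolding z U_def U'_def U''_def by simp
  qed
  have LD: "x * (1 - x) * D'' x + (1 - (a + b + 1) * x) * D' x - a * b * D x = 2 * (1 - x) * U' x - (a + b) * U x"
  proof -
    have "fps_nth ((fps_const 2 - fps_const 2 * fps_X) * fps_deriv F - fps_const (a + b) * F) n = 
      2 * of_nat (Suc n) * fps_nth F (Suc n) - (2 * of_nat n + a + b) * fps_nth F n" for n and F :: "complex fps"
    proof -
      have e: "(fps_const 2 - fps_const 2 * fps_X) * fps_deriv F - fps_const (a + b) * F = 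
        fps_const 2 * fps_deriv F - fps_const 2 * (fps_X * fps_deriv F) - fps_const (a + b) * F" 
        by (simp only: left_diff_distrib mult.assoc)
      have 3: "fps_nth (fps_X * fps_deriv F) n = of_nat n * fps_nth F n" by (cases n) simp_all
      have 4: "fps_nth (fps_deriv F) n = of_nat (Suc n) * fps_nth F (Suc n)" by simp
      show ?thesis unfolding e fps_sub_nth fps_mult_left_const_nth 3 4 by (simp add: algebra_simps)
    qed
    hence z: "fps_X * (1 - fps_X) * fps_deriv (fps_deriv (log_fps a b)) +
      (fps_const 1 - fps_const (a + b + 1) * fps_X) * fps_deriv (log_fps a b) - fps_const (a * b) * log_fps a b = 
      (fps_const 2 - fps_const 2 * fps_X) * fps_deriv (gauss_fps a b 1) - fps_const (a + b) * gauss_fps a b 1"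
      unfolding fps_eq_iff gauss_ode_coeff log_fps_Suc[OF a_ni b_ni] by simp
    have r1: "norm x < fps_conv_radius (fps_const (a + b) * gauss_fps a b 1)"
      using fps_conv_radius_mult[of "fps_const (a + b)" "gauss_fps a b 1"] r(1) by (auto simp: min_def split: if_splits)
    note lin = eval_fps_linear_mult[OF r(2), of 2 2]
    have E1: "eval_fps ((fps_const 2 - fps_const 2 * fps_X) * fps_deriv (gauss_fps a b 1) - fps_const (a + b) * gauss_fps a b 1) x
       = (2 - 2 * x) * U' x - (a + b) * U x"
      unfolding U_def U'_def by (subst eval_fps_diff[OF lin(2) r1], subst eval_fps_mult) (use lin r(1) in simp_all)
    have "x * (1 - x) * D'' x + (1 - (a + b + 1) * x) * D' x - a * b * D x = (2 - 2 * x) * U' x - (a + b) * U x"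
      unfolding D_def D'_def D''_def by (rule trans[OF eval_gauss_operator[OF r(4), of 1 a b, symmetric, unfolded z] E1])
    also have "2 - 2 * x = 2 * (1 - x)" by (simp add: algebra_simps)
    finally show ?thesis .
  qed
  have "x * (1 - x) * (D'' x - (U'' x * Ln x + 2 * (U' x / x) - U x / x^2)) + (1 - (a + b + 1) * x) * W' x - a * b * W x =
     (x * (1 - x) * D'' x + (1 - (a + b + 1) * x) * D' x - a * b * D x) 
     - Ln x * (x * (1 - x) * U'' x + (1 - (a + b + 1) * x) * U' x - a * b * U x)
     - (2 * (1 - x) * U' x - (a + b) * U x)"
    using x0 unfolding W_def W'_def by (simp add: field_simps power2_eq_square)
  also have "\<dots> = 0" unfolding LU LD by simp
  finally show "x * (1 - x) * (D'' x - (U'' x * Ln x + 2 * (U' x / x) - U x / x^2)) + (1 - (a + b + 1) * x) * W' x - a * b * W x = 0" .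
qed

text \<open>
  Subtracting C/(k+1) from the coefficients splits off -C log x / (1-x); the remaining
  coefficients are absolutely summable, so Abel's theorem is continuity on the closed disc.
\<close>

lemma gauss_series_asymptotics:
  "((\<lambda>x::real. eval_fps (gauss_fps a b (a + b)) (1 - of_real x) + C * (of_real (ln x) / (1 - of_real x)))
     \<longlongrightarrow> C * (2 * Digamma 1 - Digamma a - Digamma b)) (at_right 0)"
proof -
  define d where "d = (\<lambda>k. zb_coeff a b k - 1 / of_nat (k + 1))"
  have sd: "summable (\<lambda>k. norm (d k))" unfolding d_def by (rule zb_coeff_summable[OF a_ni b_ni ab1_ni])
  define g where "g = (\<lambda>z. \<Sum>k. d k * z ^ k)"
  have gc: "continuous_on (cball 0 1) g" unfolding g_def by (rule continuous_on_abs_summable_powser[OF sd])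
  have g1: "g 1 = 2 * Digamma 1 - Digamma a - Digamma b"
    using zb_const_eq[OF a_ni b_ni ab1_ni] by (simp add: g_def d_def zb_const_def)
  have coeff: "fps_nth (gauss_fps a b (a + b)) k = C * zb_coeff a b k" for k
  proof -
    have "Gamma a \<noteq> 0" "Gamma b \<noteq> 0" "Gamma (a + b) \<noteq> 0" using a_ni b_ni ab_ni by (auto simp: Gamma_eq_zero_iff)
    thus ?thesis unfolding fps_nth_gauss_fps zb_coeff_def C_def pochhammer_Gamma[OF a_ni] pochhammer_Gamma[OF b_ni] pochhammer_Gamma[OF ab_ni]
      by (simp add: field_simps)
  qed
  have eq: "eval_fps (gauss_fps a b (a + b)) (1 - of_real x) + C * (of_real (ln x) / (1 - of_real x)) = C * g (1 - of_real x)"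
    if x: "0 < x" "x < 1" for x :: real
  proof -
    define z where "z = complex_of_real (1 - x)"
    have z: "norm z < 1" "z \<noteq> 0" "z \<in> cball 0 1" using x by (auto simp: z_def simp del: of_real_diff)
    have "summable (\<lambda>k. norm (d k * z ^ k))"
    proof (rule summable_comparison_test[OF _ sd])
      have "norm (d k) * norm z ^ k \<le> norm (d k)" for k
        using mult_left_mono[OF power_le_one[of "norm z" k], of "norm (d k)"] z by simp
      thus "\<exists>N. \<forall>n\<ge>N. norm (norm (d n * z ^ n)) \<le> norm (d n)" by (simp add: norm_mult norm_power)
    qed
    from summable_sums[OF summable_norm_cancel[OF this]] have "(\<lambda>k. d k * z ^ k) sums g z" by (simp add: g_def)
    from sums_add[OF this sums_minus_ln_over[OF z(1,2)]]
    have "(\<lambda>k. d k * z ^ k + z ^ k / of_nat (k + 1)) sums (g z + - Ln (1 - z) / z)" .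
    moreover have "d k * z ^ k + z ^ k / of_nat (k + 1) = zb_coeff a b k * z ^ k" for k
      by (simp add: d_def left_diff_distrib)
    ultimately have "(\<lambda>k. zb_coeff a b k * z ^ k) sums (g z + - Ln (1 - z) / z)" by simp
    from sums_mult[OF this, of C] have "(\<lambda>k. fps_nth (gauss_fps a b (a + b)) k * z ^ k) sums (C * (g z + - Ln (1 - z) / z))"
      by (simp add: coeff mult.assoc)
    hence "eval_fps (gauss_fps a b (a + b)) z = C * (g z + - Ln (1 - z) / z)"
      by (simp add: eval_fps_def sums_iff)
    moreover have "Ln (1 - z) = of_real (ln x)" using x by (simp add: z_def Ln_of_real)
    ultimately show ?thesis by (simp add: z_def algebra_simps)
  qed
  have "((\<lambda>x::real. g (1 - of_real x)) \<longlongrightarrow> g 1) (at_right 0)"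
  proof -
    have "((\<lambda>x::real. 1 - complex_of_real x) \<longlongrightarrow> 1 - of_real 0) (at_right 0)" by (intro tendsto_intros)
    hence "((\<lambda>x::real. 1 - complex_of_real x) \<longlongrightarrow> 1) (at_right 0)" by simp
    moreover have "eventually (\<lambda>x::real. 1 - complex_of_real x \<in> cball 0 1) (at_right 0)"
    proof (rule eventually_mono[OF eventually_at_right_real[of 0 1]])
      fix x :: real assume "x \<in> {0<..<1}"
      moreover have "norm (1 - complex_of_real x) = \<bar>1 - x\<bar>" by (metis norm_of_real of_real_1 of_real_diff)
      ultimately show "1 - complex_of_real x \<in> cball 0 1" by (simp add: dist_norm norm_minus_commute)
    qed auto
    ultimately show ?thesis
      by (intro continuous_on_tendsto_compose[OF gc]) auto
  qed
  from tendsto_mult_left[OF this, of C]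
  have "((\<lambda>x::real. C * g (1 - of_real x)) \<longlongrightarrow> C * (2 * Digamma 1 - Digamma a - Digamma b)) (at_right 0)" by (simp add: g1)
  moreover have "eventually (\<lambda>x::real. C * g (1 - of_real x) = eval_fps (gauss_fps a b (a + b)) (1 - of_real x) + C * (of_real (ln x) / (1 - of_real x))) (at_right 0)"
    by (rule eventually_mono[OF eventually_at_right_real[of 0 1]]) (simp_all only: eq greaterThanLessThan_iff zero_less_one)
  ultimately show ?thesis by (rule Lim_transform_eventually)
qed

end

section \<open>The connection formula\<close>

text \<open>
  Angles whose points on the unit circle approach -1 from below; the points with the opposite
  angles are their inverses and approach -1 from above.
\<close>

definition angle_seq :: "nat \<Rightarrow> real" where
  "angle_seq n = - pi + 1 / real (Suc n)"

lemma angle_seq_bounds: "- pi < angle_seq n" "angle_seq n < 0"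
proof -
  have "1 / real (Suc n) \<le> 1" by simp
  thus "angle_seq n < 0" using pi_gt3 unfolding angle_seq_def by linarith
qed (simp add: angle_seq_def)

lemma angle_seq_limit: "angle_seq \<longlonglongrightarrow> - pi"
proof -
  have "angle_seq \<longlonglongrightarrow> - pi + 0" unfolding angle_seq_def by (intro tendsto_intros LIMSEQ_Suc[OF lim_1_over_n])
  thus ?thesis by simp
qed

lemma exp_angle_seq_limit:
  "(\<lambda>n. exp (\<i> * of_real (angle_seq n))) \<longlonglongrightarrow> -1" "(\<lambda>n. exp (\<i> * of_real (- angle_seq n))) \<longlonglongrightarrow> -1"
proof -
  have "(\<lambda>n. exp (\<i> * of_real (angle_seq n))) \<longlonglongrightarrow> exp (\<i> * of_real (- pi))" by (intro tendsto_intros angle_seq_limit)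
  thus "(\<lambda>n. exp (\<i> * of_real (angle_seq n))) \<longlonglongrightarrow> -1" by (simp add: exp_minus exp_pi_i')
  have "(\<lambda>n. exp (\<i> * of_real (- angle_seq n))) \<longlonglongrightarrow> exp (\<i> * of_real (- (- pi)))" by (intro tendsto_intros angle_seq_limit)
  thus "(\<lambda>n. exp (\<i> * of_real (- angle_seq n))) \<longlonglongrightarrow> -1" by (simp add: exp_pi_i')
qed

lemma Ln_exp_angle_seq:
  "Ln (exp (\<i> * of_real (angle_seq n))) = \<i> * of_real (angle_seq n)" "Ln (exp (\<i> * of_real (- angle_seq n))) = \<i> * of_real (- angle_seq n)"
  using angle_seq_bounds[of n] by (intro Ln_exp; simp)+

lemma Im_exp_angle_seq: "Im (exp (\<i> * of_real (angle_seq n))) < 0" "Im (exp (\<i> * of_real (- angle_seq n))) > 0"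
  using angle_seq_bounds[of n] sin_gt_zero[of "- angle_seq n"] by (simp_all add: Im_exp)

lemma exp_angle_seq_in:
  "exp (\<i> * of_real (angle_seq n)) \<in> cball 0 1 - \<real>\<^sub>\<le>\<^sub>0" "exp (\<i> * of_real (- angle_seq n)) \<in> cball 0 1 - \<real>\<^sub>\<le>\<^sub>0"
proof -
  have "exp (\<i> * of_real (angle_seq n)) \<notin> \<real>\<^sub>\<le>\<^sub>0" "exp (\<i> * of_real (- angle_seq n)) \<notin> \<real>\<^sub>\<le>\<^sub>0"
    using Im_exp_angle_seq[of n] unfolding complex_nonpos_Reals_iff by linarith+
  thus "exp (\<i> * of_real (angle_seq n)) \<in> cball 0 1 - \<real>\<^sub>\<le>\<^sub>0" "exp (\<i> * of_real (- angle_seq n)) \<in> cball 0 1 - \<real>\<^sub>\<le>\<^sub>0"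
    by simp_all
qed

context zero_balanced
begin

lemma lens_facts:
  shows "open (ball 0 1 \<inter> ball 1 1 :: complex set)" "connected (ball 0 1 \<inter> ball 1 1 :: complex set)"
  by (auto intro: convex_connected convex_Int)

lemma lens_reflect:
  assumes "z \<in> ball 0 1 \<inter> ball (1::complex) 1"
  shows "1 - z \<in> ball 0 1 - \<real>\<^sub>\<le>\<^sub>0"
proof -
  have "Re z < 1" using assms complex_Re_le_cmod[of z] by auto
  thus ?thesis using assms by (auto simp: dist_norm norm_minus_commute complex_nonpos_Reals_iff)
qed

text \<open>
  In U W' - U' W the terms with log x cancel, and x times what remains is analytic with value -U(0)^2 = -1 at 0.
\<close>

lemma wronskian_near_0:
  obtains x where "0 < x" "x < 1" "U (of_real x) * W' (of_real x) - U' (of_real x) * W (of_real x) \<noteq> 0"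
proof -
  define \<phi> where "\<phi> = (\<lambda>x. x * (U x * D' x - U' x * D x) - U x ^ 2)"
  have U0: "U 0 = 1" by (simp add: U_def eval_fps_at_0 fps_nth_gauss_fps)
  have "isCont \<phi> 0" unfolding \<phi>_def U_def U'_def D_def D'_def
    using radius[of 0] by (intro continuous_intros) (auto simp: )
  hence "((\<lambda>x::real. \<phi> (of_real x)) \<longlongrightarrow> \<phi> 0) (at_right 0)"
    by (intro isCont_tendsto_compose[of _ \<phi>] tendsto_eq_intros refl) auto
  moreover have "\<phi> 0 \<noteq> 0" by (simp add: \<phi>_def U0)
  ultimately have "eventually (\<lambda>x::real. \<phi> (of_real x) \<noteq> 0) (at_right 0)" by (rule tendsto_imp_eventually_ne)
  hence "eventually (\<lambda>x::real. \<phi> (of_real x) \<noteq> 0 \<and> x \<in> {0<..<1}) (at_right 0)"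
    using eventually_at_right_real[of 0 1] by (intro eventually_conj) auto
  then obtain x :: real where x: "\<phi> (of_real x) \<noteq> 0" "0 < x" "x < 1"
    using eventually_happens[of _ "at_right (0::real)"] by (auto simp: trivial_limit_at_right_real)
  have "of_real x * (U (of_real x) * W' (of_real x) - U' (of_real x) * W (of_real x)) = \<phi> (of_real x)"
    using x(2) unfolding W_def W'_def \<phi>_def by (simp add: field_simps power2_eq_square)
  hence "U (of_real x) * W' (of_real x) - U' (of_real x) * W (of_real x) \<noteq> 0" using x(1) by auto
  thus ?thesis using that x by blast
qed

text \<open>
  Write F = A U + B W.  With g(x) = C/(1-x) - B U(x) the asymptotics of F say that g(x) log x
  converges as x tends to 0.  This forces g(0) = 0, so B = C; then g(x) log x tends to 0 and the constant terms
  give A = 0.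
\<close>

lemma connection_lens:
  assumes z: "z \<in> ball 0 1 \<inter> ball 1 1"
  shows "eval_fps (gauss_fps a b (a + b)) z = C * W (1 - z)"
proof -
  let ?L = "ball 0 1 \<inter> ball (1::complex) 1"
  define F where "F = eval_fps (gauss_fps a b (a + b))"
  define F' where "F' = eval_fps (fps_deriv (gauss_fps a b (a + b)))"
  have par: "a + b + 1 - 1 = a + b" by simp
  have solF: "hypergeo_solution a b (a + b) ?L F F'"
    using hypergeo_solution_subset[OF gauss_series_solution[OF ab_ni, of a b]] by (auto simp: F_def F'_def)
  have solU: "hypergeo_solution a b (a + b) ?L (\<lambda>z. U (1 - z)) (\<lambda>z. - U' (1 - z))"
    by (rule hypergeo_solution_subset[OF hypergeo_solution_reflect[OF U_solution, unfolded par]])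
       (use lens_reflect in auto)
  have solW: "hypergeo_solution a b (a + b) ?L (\<lambda>z. W (1 - z)) (\<lambda>z. - W' (1 - z))"
    by (rule hypergeo_solution_subset[OF hypergeo_solution_reflect[OF W_solution, unfolded par]])
       (use lens_reflect in blast)
  obtain x0 where x0: "0 < x0" "x0 < 1" "U (of_real x0) * W' (of_real x0) - U' (of_real x0) * W (of_real x0) \<noteq> 0"
    by (rule wronskian_near_0)
  have in_lens: "1 - complex_of_real x \<in> ?L" if "0 < x" "x < 1" for x
  proof -
    have "norm (1 - complex_of_real x) = \<bar>1 - x\<bar>" by (metis norm_of_real of_real_1 of_real_diff)
    thus ?thesis using that by (simp add: dist_norm norm_minus_commute)
  qed
  obtain A B where AB: "\<And>z. z \<in> ?L \<Longrightarrow> F z = A * U (1 - z) + B * W (1 - z)"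
  proof (rule hypergeo_solution_combine[OF solF solU solW lens_facts, of "1 - of_real x0"])
    show "1 - complex_of_real x0 \<noteq> 0" using x0 by (metis eq_iff_diff_eq_0 of_real_eq_1_iff less_irrefl)
    show "U (1 - (1 - complex_of_real x0)) * - W' (1 - (1 - complex_of_real x0)) -
    - U' (1 - (1 - complex_of_real x0)) * W (1 - (1 - complex_of_real x0)) \<noteq> 0"
      using x0(3) by (simp add: algebra_simps)
  qed (use x0 in_lens in auto)
  have AB_real: "F (1 - of_real x) = A * U (of_real x) + B * (D (of_real x) - U (of_real x) * of_real (ln x))" if "0 < x" "x < 1" for x
    using AB[OF in_lens[OF that]] that by (simp add: W_def Ln_of_real)
  define \<kappa> where "\<kappa> = 2 * Digamma 1 - Digamma a - Digamma b"
  have U0: "U 0 = 1" by (simp add: U_def eval_fps_at_0 fps_nth_gauss_fps)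
  have D0: "D 0 = \<kappa>" by (simp add: D_def eval_fps_at_0 log_fps_def digamma_bracket_def fps_nth_gauss_fps \<kappa>_def)
  have real0: "((\<lambda>x::real. g (complex_of_real x)) \<longlongrightarrow> g 0) (at_right 0)" if "isCont g 0" for g :: "complex \<Rightarrow> complex"
    by (intro isCont_tendsto_compose[OF that] tendsto_eq_intros refl) auto
  have cU: "isCont U 0" and cD: "isCont D 0"
    unfolding U_def D_def using radius[of 0] by (auto intro!: continuous_intros)
  note limU = real0[OF cU, unfolded U0] and limD = real0[OF cD, unfolded D0]
  have limF: "((\<lambda>x::real. F (1 - of_real x) + C * (of_real (ln x) / (1 - of_real x))) \<longlongrightarrow> C * \<kappa>) (at_right 0)"
    using gauss_series_asymptotics by (simp add: F_def \<kappa>_def)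
  define g where "g = (\<lambda>x. C / (1 - x) - B * U x)"
  define l where "l = C * \<kappa> - A * 1 - B * \<kappa>"
  have ev01: "eventually (\<lambda>x::real. x \<in> {0<..<1}) (at_right 0)" by (rule eventually_at_right_real) auto
  have "((\<lambda>x::real. (F (1 - of_real x) + C * (of_real (ln x) / (1 - of_real x))) - A * U (of_real x) - B * D (of_real x)) \<longlongrightarrow> l) (at_right 0)"
    unfolding l_def by (intro tendsto_intros limF limU limD)
  moreover have "eventually (\<lambda>x::real. (F (1 - of_real x) + C * (of_real (ln x) / (1 - of_real x))) - A * U (of_real x) - B * D (of_real x)
       = of_real (ln x) * g (of_real x)) (at_right 0)"
    using ev01 by eventually_elim (simp add: AB_real g_def algebra_simps)
  ultimately have liml: "((\<lambda>x::real. of_real (ln x) * g (of_real x)) \<longlongrightarrow> l) (at_right 0)"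
    by (rule Lim_transform_eventually)
  have ln0: "((\<lambda>x::real. complex_of_real (1 / ln x)) \<longlongrightarrow> of_real 0) (at_right 0)"
  proof (rule tendsto_of_real)
    show "((\<lambda>x::real. 1 / ln x) \<longlongrightarrow> 0) (at_right 0)" by real_asymp
  qed
  have xln0: "((\<lambda>x::real. complex_of_real (x * ln x)) \<longlongrightarrow> of_real 0) (at_right 0)"
  proof (rule tendsto_of_real)
    show "((\<lambda>x::real. x * ln x) \<longlongrightarrow> 0) (at_right 0)" by real_asymp
  qed
  have cg: "isCont g 0" unfolding g_def using cU by (intro continuous_intros) auto
  have "((\<lambda>x::real. complex_of_real (1 / ln x) * (of_real (ln x) * g (of_real x))) \<longlongrightarrow> of_real 0 * l) (at_right 0)"
    by (intro tendsto_mult ln0 liml)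
  moreover have "eventually (\<lambda>x::real. complex_of_real (1 / ln x) * (of_real (ln x) * g (of_real x)) = g (of_real x)) (at_right 0)"
    using ev01 by eventually_elim auto
  ultimately have "((\<lambda>x::real. g (of_real x)) \<longlongrightarrow> of_real 0 * l) (at_right 0)" by (rule Lim_transform_eventually)
  from tendsto_unique[OF trivial_limit_at_right_real this real0[OF cg]] have g0: "g 0 = 0" by simp
  hence BC: "B = C" by (simp add: g_def U0)
  have derU: "(U has_field_derivative U' 0) (at 0)" unfolding U_def U'_def
    using radius[of 0] by (intro has_field_derivative_eval_fps) auto
  have "(g has_field_derivative (C - B * U' 0)) (at 0)" unfolding g_def
    by (rule derivative_eq_intros derU refl | simp)+
  hence "((\<lambda>x. g x / x) \<longlongrightarrow> C - B * U' 0) (at 0)" by (simp add: has_field_derivative_iff g0)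
  moreover have "filterlim (\<lambda>x::real. complex_of_real x) (at 0) (at_right 0)"
    by (intro filterlim_atI tendsto_eq_intros refl) (auto simp: eventually_at_filter)
  ultimately have "((\<lambda>x::real. g (of_real x) / of_real x) \<longlongrightarrow> C - B * U' 0) (at_right 0)"
    by (rule filterlim_compose)
  hence "((\<lambda>x::real. complex_of_real (x * ln x) * (g (of_real x) / of_real x)) \<longlongrightarrow> of_real 0 * (C - B * U' 0)) (at_right 0)"
    by (intro tendsto_mult xln0)
  moreover have "eventually (\<lambda>x::real. complex_of_real (x * ln x) * (g (of_real x) / of_real x) = of_real (ln x) * g (of_real x)) (at_right 0)"
    using ev01 by eventually_elim auto
  ultimately have "((\<lambda>x::real. of_real (ln x) * g (of_real x)) \<longlongrightarrow> of_real 0 * (C - B * U' 0)) (at_right 0)"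
    by (rule Lim_transform_eventually)
  from tendsto_unique[OF trivial_limit_at_right_real liml this] have "l = 0" by simp
  hence "A = 0" by (simp add: l_def BC)
  thus ?thesis using AB[OF z] by (simp add: BC F_def)
qed

lemma connection_open:
  assumes x: "x \<in> ball 0 1 - \<real>\<^sub>\<le>\<^sub>0"
  shows "gauss_2F1 a b (2 * s) (1 - x) = C * W x"
proof -
  let ?E = "ball 0 1 - \<real>\<^sub>\<le>\<^sub>0 :: complex set"
  have E: "?E = slit_plane {0<..} \<inter> ball 0 1"
    by (auto simp: slit_plane_def complex_nonpos_Reals_iff)
  have cut: "1 - x \<in> cut_plane" if "x \<in> ?E" for x
    using that unfolding cut_plane_eq E by (auto simp: slit_plane_def)
  show ?thesis
  proof (rule analytic_continuation_open[of "?E \<inter> ball 1 1" ?E "\<lambda>x. gauss_2F1 a b (2 * s) (1 - x)" "\<lambda>x. C * W x"])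
    show "open ?E" "open (?E \<inter> ball 1 1)" unfolding E by (intro open_Int open_slit_plane; simp)+
    have "1 / 2 \<in> ?E \<inter> ball 1 1" by (auto simp: dist_norm complex_nonpos_Reals_iff)
    thus "?E \<inter> ball 1 1 \<noteq> {}" by blast
    show "connected ?E" unfolding E by (rule connected_slit_plane_Int_convex[of _ "1/2"]) auto
    show "(\<lambda>x. C * W x) holomorphic_on ?E"
      by (intro holomorphic_intros hypergeo_solution_holomorphic(1)[OF W_solution]) (auto simp: E open_slit_plane)
    show "(\<lambda>x. gauss_2F1 a b (2 * s) (1 - x)) holomorphic_on ?E"
      by (rule holomorphic_on_compose_gen[OF _ gauss_2F1_holomorphic[OF two_s_ni], unfolded o_def])
         (use cut in \<open>auto intro!: holomorphic_intros\<close>)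
    show "gauss_2F1 a b (2 * s) (1 - x) = C * W x" if "x \<in> ?E \<inter> ball 1 1" for x
    proof -
      have "1 - x \<in> ball 0 1 \<inter> ball 1 1" using that by (auto simp: dist_norm norm_minus_commute)
      thus ?thesis using connection_lens[of "1 - x"] gauss_2F1_series[OF two_s_ni, of "1 - x" a b] by (simp add: ab)
    qed
  qed (use x in auto)
qed

text \<open>
  Both sides are continuous up to the unit circle, so it suffices to approach x along the radius.
\<close>

lemma connection:
  assumes x: "x \<in> cball 0 1 - \<real>\<^sub>\<le>\<^sub>0"
  shows "gauss_2F1 a b (2 * s) (1 - x) = C * W x"
proof -
  let ?H = "cball 0 1 - \<real>\<^sub>\<le>\<^sub>0 :: complex set"
  have cut: "1 - x \<in> cut_plane" if "x \<in> ?H" for x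
    using that unfolding cut_plane_eq by (auto simp: slit_plane_def complex_nonpos_Reals_iff)
  define h where "h = (\<lambda>x. gauss_2F1 a b (2 * s) (1 - x) - C * W x)"
  have h: "continuous_on ?H h" unfolding h_def W_def
    by (intro continuous_intros continuous_on_compose2[OF holomorphic_on_imp_continuous_on[OF gauss_2F1_holomorphic[OF two_s_ni]]]
        continuous_on_subset[OF U_continuous] continuous_on_subset[OF D_continuous])
       (use cut in auto)
  define X where "X = (\<lambda>n. complex_of_real (real (Suc n) / real (Suc (Suc n))) * x)"
  have fr: "0 < real (Suc n) / real (Suc (Suc n))" "real (Suc n) / real (Suc (Suc n)) < 1" for n by auto
  have X: "X n \<in> ball 0 1 - \<real>\<^sub>\<le>\<^sub>0" for n
  proof -
    define r where "r = real (Suc n) / real (Suc (Suc n))"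
    have r: "0 < r" "r < 1" using fr[of n] by (simp_all add: r_def)
    have Xr: "X n = of_real r * x" by (simp add: X_def r_def)
    have "norm (X n) = r * norm x" using r by (simp add: Xr norm_mult)
    also have "\<dots> \<le> r * 1" using x r by (intro mult_left_mono) auto
    finally have "norm (X n) < 1" using r by simp
    moreover have "X n \<notin> \<real>\<^sub>\<le>\<^sub>0" using x r by (auto simp: Xr complex_nonpos_Reals_iff zero_less_mult_iff mult_le_0_iff)
    ultimately show ?thesis by simp
  qed
  have "X \<longlonglongrightarrow> of_real 1 * x" unfolding X_def
    by (intro tendsto_mult tendsto_of_real tendsto_const LIMSEQ_Suc[OF LIMSEQ_n_over_Suc_n])
  hence "X \<longlonglongrightarrow> x" by simp
  hence "(\<lambda>n. h (X n)) \<longlonglongrightarrow> h x"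
  proof (rule continuous_on_tendsto_compose[OF h _ x])
    show "eventually (\<lambda>n. X n \<in> ?H) sequentially" using X by (auto intro!: always_eventually simp: less_imp_le)
  qed
  moreover have "h (X n) = 0" for n using connection_open[OF X[of n]] by (simp add: h_def)
  ultimately have "h x = 0" by (simp add: LIMSEQ_const_iff)
  thus ?thesis by (simp add: h_def)
qed

lemma U_D_limits:
  assumes "X \<longlonglongrightarrow> x" "\<And>n. X n \<in> cball 0 1" "x \<in> cball 0 1"
  shows "(\<lambda>n. U (X n)) \<longlonglongrightarrow> U x" "(\<lambda>n. D (X n)) \<longlonglongrightarrow> D x"
  using assms by (auto intro!: continuous_on_tendsto_compose[OF U_continuous] continuous_on_tendsto_compose[OF D_continuous])

text \<open>
  The power series are continuous at -1 and log x tends to -i\<pi> from below and to i\<pi> from above.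
\<close>

lemma W_angle_seq_limit:
  "(\<lambda>n. W (exp (\<i> * of_real (angle_seq n)))) \<longlonglongrightarrow> D (-1) + \<i> * of_real pi * U (-1)"
  "(\<lambda>n. W (exp (\<i> * of_real (- angle_seq n)))) \<longlonglongrightarrow> D (-1) - \<i> * of_real pi * U (-1)"
proof -
  have "(\<lambda>n. W (exp (\<i> * of_real (angle_seq n)))) \<longlonglongrightarrow> D (-1) - U (-1) * (\<i> * of_real (- pi))"
    unfolding W_def Ln_exp_angle_seq using exp_angle_seq_in
    by (intro tendsto_intros U_D_limits exp_angle_seq_limit angle_seq_limit) auto
  thus "(\<lambda>n. W (exp (\<i> * of_real (angle_seq n)))) \<longlonglongrightarrow> D (-1) + \<i> * of_real pi * U (-1)" by (simp add: mult_ac)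
  have "(\<lambda>n. W (exp (\<i> * of_real (- angle_seq n)))) \<longlonglongrightarrow> D (-1) - U (-1) * (\<i> * of_real (- (- pi)))"
    unfolding W_def Ln_exp_angle_seq using exp_angle_seq_in
    by (intro tendsto_intros U_D_limits exp_angle_seq_limit angle_seq_limit) auto
  thus "(\<lambda>n. W (exp (\<i> * of_real (- angle_seq n)))) \<longlonglongrightarrow> D (-1) - \<i> * of_real pi * U (-1)" by (simp add: mult_ac)
qed

text \<open>
  As the limit L over the half plane exists, it may be computed along the points 1 - x with x on
  the lower half of the unit circle.
\<close>

lemma boundary_value:
  assumes L: "(gauss_2F1 a b (2 * s) \<longlongrightarrow> L) (at 2 within {z. Im z > 0})"
  shows "L = C * (D (-1) + \<i> * of_real pi * U (-1))"
proof -
  define X where "X = (\<lambda>n. exp (\<i> * of_real (angle_seq n)))"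
  have "filterlim (\<lambda>n. 1 - X n) (at 2 within {z. Im z > 0}) sequentially"
    unfolding filterlim_at
  proof (intro conjI always_eventually allI)
    show "(\<lambda>n. 1 - X n) \<longlonglongrightarrow> 2" using tendsto_diff[OF tendsto_const exp_angle_seq_limit(1), of 1] by (simp add: X_def)
    show im: "1 - X n \<in> {z. Im z > 0}" for n unfolding X_def using Im_exp_angle_seq(1)[of n] by simp
    show "1 - X n \<noteq> 2" for n
    proof
      assume "1 - X n = 2"
      from arg_cong[OF this, of Im] show False using im[of n] by simp
    qed
  qed
  from filterlim_compose[OF L this]
  have "(\<lambda>n. C * W (X n)) \<longlonglongrightarrow> L" unfolding X_def connection[OF exp_angle_seq_in(1)] .
  moreover have "(\<lambda>n. C * W (X n)) \<longlonglongrightarrow> C * (D (-1) + \<i> * of_real pi * U (-1))"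
    unfolding X_def by (intro tendsto_intros W_angle_seq_limit)
  ultimately show ?thesis by (rule LIMSEQ_unique)
qed

end

section \<open>Terminating series\<close>

lemma gauss_fps_terminating:
  assumes "n > m"
  shows "fps_nth (gauss_fps (- of_nat m) b c) n = 0"
  using assms by (simp add: fps_nth_gauss_fps pochhammer_of_nat_eq_0_iff)

lemma gauss_fps_terminating_radius: "fps_conv_radius (gauss_fps (- of_nat m) b c) = \<infinity>"
proof -
  have "eventually (\<lambda>n. fps_nth (gauss_fps (- of_nat m) b c) n = 0) sequentially"
    using eventually_gt_at_top[of m] by eventually_elim (rule gauss_fps_terminating)
  from conv_radius_cong'[OF this] show ?thesis by (simp add: fps_conv_radius_def)
qed

lemma eval_gauss_fps_terminating:
  "eval_fps (gauss_fps (- of_nat m) b c) z = (\<Sum>n\<le>m. fps_nth (gauss_fps (- of_nat m) b c) n * z ^ n)"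
  unfolding eval_fps_def by (rule suminf_finite) (auto simp: gauss_fps_terminating)

text \<open>
  The polynomial F(-m,b;1;1-z) is a solution holomorphic at z = 0, hence a multiple of the branch;
  its value at z = 0 is Vandermonde's sum.
\<close>

lemma gauss_2F1_terminating:
  assumes c: "- of_nat m + b \<notin> \<int>\<^sub>\<le>\<^sub>0" and b: "b \<notin> \<int>" and z: "z \<in> cut_plane"
  shows "gauss_2F1 (- of_nat m) b (- of_nat m + b) z =
     fact m / pochhammer (1 - b) m * eval_fps (gauss_fps (- of_nat m) b 1) (1 - z)"
proof -
  let ?a = "- of_nat m :: complex"
  define P where "P = eval_fps (gauss_fps ?a b 1)"
  define P' where "P' = eval_fps (fps_deriv (gauss_fps ?a b 1))"
  have "hypergeo_solution ?a b 1 UNIV P P'"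
    using gauss_series_solution_eball[OF one_not_nonpos_Int, of ?a b]
    unfolding gauss_fps_terminating_radius P_def P'_def by simp
  from hypergeo_solution_reflect[OF this]
  have sol: "hypergeo_solution ?a b (?a + b) UNIV (\<lambda>z. P (1 - z)) (\<lambda>z. - P' (1 - z))" by simp
  have P1: "P 1 = pochhammer (1 - b) m / fact m"
  proof -
    have "P 1 = (\<Sum>k\<in>{0..m}. pochhammer b k * pochhammer (- of_nat m) k / (of_nat (fact k) * pochhammer 1 k))"
      unfolding P_def eval_gauss_fps_terminating
      by (rule sum.cong) (auto simp: fps_nth_gauss_fps pochhammer_fact[symmetric] mult_ac)
    also have "\<dots> = pochhammer (1 - b) m / pochhammer 1 m"
    proof (rule Vandermonde_pochhammer, intro ballI notI)
      fix i assume "(1::complex) = - of_nat i"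
      hence "(1::complex) \<in> \<int>\<^sub>\<le>\<^sub>0" by (metis minus_of_nat_in_nonpos_Ints)
      thus False by simp
    qed
    finally show ?thesis by (simp add: pochhammer_fact)
  qed
  have b1: "1 - b \<notin> \<int>\<^sub>\<le>\<^sub>0"
  proof
    assume "1 - b \<in> \<int>\<^sub>\<le>\<^sub>0"
    from Ints_diff[OF Ints_1 nonpos_Ints_Int[OF this]] have "b \<in> \<int>" by simp
    thus False using b by simp
  qed
  have P10: "P 1 \<noteq> 0" unfolding P1 using pochhammer_not_nonpos_Int[OF b1] by simp
  have ball: "P (1 - w) = P 1 * eval_fps (gauss_fps ?a b (?a + b)) w" if "norm w < 1" for w
    using hypergeo_solution_at_0[OF hypergeo_solution_subset[OF sol] zero_less_one c that] by simp
  have "P 1 * gauss_2F1 ?a b (?a + b) z = P (1 - z)"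
  proof (rule analytic_continuation_open[of "ball 0 1" cut_plane "\<lambda>z. P 1 * gauss_2F1 ?a b (?a + b) z" "\<lambda>z. P (1 - z)"])
    show "(\<lambda>z. P 1 * gauss_2F1 ?a b (?a + b) z) holomorphic_on cut_plane"
      by (intro holomorphic_intros gauss_2F1_holomorphic c)
    show "(\<lambda>z. P (1 - z)) holomorphic_on cut_plane"
      using hypergeo_solution_holomorphic(1)[OF sol] by (auto intro: holomorphic_on_subset)
  qed (use z ball gauss_2F1_series[OF c] open_cut_plane connected_cut_plane ball_subset_cut_plane in auto)
  thus ?thesis using P10 unfolding P1 P_def[symmetric] by (simp add: field_simps)
qed

lemma boundary_value_terminating:
  assumes c: "- of_nat m + b \<notin> \<int>\<^sub>\<le>\<^sub>0" and b: "b \<notin> \<int>"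
    and L: "(gauss_2F1 (- of_nat m) b (- of_nat m + b) \<longlongrightarrow> L) (at 2 within {z. Im z > 0})"
  shows "L = fact m / pochhammer (1 - b) m * eval_fps (gauss_fps (- of_nat m) b 1) (-1)"
proof -
  let ?a = "- of_nat m :: complex"
  define P where "P = eval_fps (gauss_fps ?a b 1)"
  have cP: "continuous_on UNIV P"
    unfolding P_def using gauss_fps_terminating_radius[of m b 1] by (intro continuous_intros) auto
  have "((\<lambda>z. fact m / pochhammer (1 - b) m * P (1 - z)) \<longlongrightarrow> fact m / pochhammer (1 - b) m * P (1 - 2)) (at 2 within {z. Im z > 0})"
    by (intro tendsto_intros continuous_on_tendsto_compose[OF cP]) auto
  moreover have "eventually (\<lambda>z. fact m / pochhammer (1 - b) m * P (1 - z) = gauss_2F1 ?a b (?a + b) z) (at 2 within {z. Im z > 0})"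
    unfolding eventually_at_filter P_def
    by (intro always_eventually allI impI gauss_2F1_terminating[OF c b, symmetric])
       (simp add: cut_plane_eq slit_plane_def)
  ultimately have "(gauss_2F1 ?a b (?a + b) \<longlongrightarrow> fact m / pochhammer (1 - b) m * P (1 - 2)) (at 2 within {z. Im z > 0})"
    by (rule Lim_transform_eventually)
  from tendsto_unique[OF two_upper_nontrivial L this] show ?thesis by (simp add: P_def)
qed

lemma eventually_not_nonpos_Int: "eventually (\<lambda>z::complex. z \<notin> \<int>\<^sub>\<le>\<^sub>0) (at z0)"
proof -
  show ?thesis
  proof (cases "z0 \<in> \<int>\<^sub>\<le>\<^sub>0")
    case False
    have "open (- (\<int>\<^sub>\<le>\<^sub>0 :: complex set))" by (simp add: open_Compl)
    thus ?thesis unfolding eventually_at_topological using False by (intro exI[of _ "- \<int>\<^sub>\<le>\<^sub>0"]) auto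
  next
    case True
    then obtain k where k: "z0 = - of_nat k" by (elim nonpos_Ints_cases')
    have "z \<notin> \<int>\<^sub>\<le>\<^sub>0" if "z \<noteq> z0" "dist z z0 < 1" for z
    proof
      assume "z \<in> \<int>\<^sub>\<le>\<^sub>0"
      then obtain j where j: "z = - of_nat j" by (elim nonpos_Ints_cases')
      have "of_int \<bar>int j - int k\<bar> < (1::real)"
        using that(2) unfolding j k dist_minus dist_of_nat .
      hence "j = k" by simp
      thus False using that(1) by (simp add: j k)
    qed
    thus ?thesis unfolding eventually_at using zero_less_one by blast
  qed
qed

text \<open>
  Away from the poles the product is minus the derivative of the entire function 1/\<Gamma>, whose value
  at -m is known.
\<close>

lemma rGamma_times_Digamma_limit:
  "((\<lambda>z::complex. rGamma z * Digamma z) \<longlongrightarrow> - ((-1) ^ m * fact m)) (at (- of_nat m))"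
proof -
  have "deriv rGamma holomorphic_on (UNIV :: complex set)"
    by (intro holomorphic_deriv holomorphic_intros) auto
  hence "isCont (deriv rGamma) (- of_nat m :: complex)"
    by (auto dest!: holomorphic_on_imp_continuous_on simp: continuous_on_eq_continuous_at)
  hence "(deriv rGamma \<longlongrightarrow> deriv rGamma (- of_nat m)) (at (- of_nat m :: complex))" by (simp add: isCont_def)
  moreover have "deriv rGamma (- of_nat m :: complex) = (-1) ^ m * fact m"
    by (intro DERIV_imp_deriv has_field_derivative_rGamma_nonpos_int)
  ultimately have "((\<lambda>z. - deriv rGamma z) \<longlongrightarrow> - ((-1) ^ m * fact m)) (at (- of_nat m :: complex))"
    by (metis tendsto_minus)
  moreover have "eventually (\<lambda>z::complex. - deriv rGamma z = rGamma z * Digamma z) (at (- of_nat m))"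
    using eventually_not_nonpos_Int
  proof eventually_elim
    case (elim z)
    have "deriv rGamma z = - rGamma z * Digamma z"
      by (intro DERIV_imp_deriv has_field_derivative_rGamma_no_nonpos_int elim)
    thus ?case by simp
  qed
  ultimately show ?thesis by (rule Lim_transform_eventually)
qed

lemma H_rhs_minus: "H_rhs (- \<alpha>) s = H_rhs \<alpha> s"
proof -
  have g: "gauss_fps x y 1 = gauss_fps y x 1" for x y
    by (simp add: fps_eq_iff fps_nth_gauss_fps mult.commute)
  have "S_term (- \<alpha>) s = S_term \<alpha> s" unfolding S_term_def Let_def fun_eq_iff by (simp add: algebra_simps)
  moreover have "K_fun (- \<alpha>) s = K_fun \<alpha> s" unfolding K_fun_def using g[of "s + \<alpha> / 2" "s - \<alpha> / 2"] by simp
  ultimately show ?thesis by (simp add: H_rhs_def S_fun_def mult.commute)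
qed

lemma calH_minus: "calH (- \<alpha>) Z = calH \<alpha> Z"
proof -
  have g: "gauss_fps x y c = gauss_fps y x c" for x y c
    by (simp add: fps_eq_iff fps_nth_gauss_fps mult.commute)
  have "gauss_2F1 x y c = gauss_2F1 y x c" for x y c unfolding gauss_2F1_def g[of x y] ..
  thus ?thesis unfolding calH_def Let_def gauss_2F1_upper_def by simp
qed

text \<open>
  Let a tend to -m with a + b fixed.  For n \<le> m the bracket equals -\<psi>(a) up to bounded terms, so its product with
  1/\<Gamma>(a) has the limit (-1)^m m!; the rest of S and all of K stay bounded, uniformly in a
  neighbourhood, and are annihilated by the zero of 1/\<Gamma>(a).
\<close>

lemma H_rhs_limit:
  assumes two_s: "2 * s \<notin> \<int>" and Re_s: "Re s < 1 / 2" and a0: "s - \<alpha>0 / 2 = - of_nat m"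
  shows "((\<lambda>\<alpha>. H_rhs \<alpha> s) \<longlongrightarrow>
     fact m / pochhammer (1 - (s + \<alpha>0 / 2)) m * eval_fps (gauss_fps (- of_nat m) (s + \<alpha>0 / 2) 1) (-1)) (at \<alpha>0)"
proof -
  define b0 where "b0 = s + \<alpha>0 / 2"
  define A where "A = (\<lambda>\<alpha>. s - \<alpha> / 2)"
  define B where "B = (\<lambda>\<alpha>. s + \<alpha> / 2)"
  have b0: "b0 = 2 * s + of_nat m" using a0 by (simp add: b0_def field_simps)
  have b0Z: "b0 \<notin> \<int>"
  proof
    assume "b0 \<in> \<int>"
    from Ints_diff[OF this Ints_of_nat[of m]] show False using two_s by (simp add: b0)
  qed
  have s_ni: "s \<notin> \<int>\<^sub>\<le>\<^sub>0"
  proof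
    assume "s \<in> \<int>\<^sub>\<le>\<^sub>0"
    hence "2 * s \<in> \<int>" using nonpos_Ints_Int by (intro Ints_mult) auto
    thus False using two_s by simp
  qed
  have AB: "A \<alpha> + B \<alpha> = 2 * s" for \<alpha> by (simp add: A_def B_def)
  have Alim: "(A \<longlongrightarrow> - of_nat m) (at \<alpha>0)" unfolding A_def a0[symmetric] by (intro tendsto_intros) auto
  have Blim: "(B \<longlongrightarrow> b0) (at \<alpha>0)" unfolding B_def b0_def by (intro tendsto_intros) auto
  have Afl: "filterlim A (at (- of_nat m)) (at \<alpha>0)"
  proof (rule filterlim_atI[OF Alim])
    show "eventually (\<lambda>\<alpha>. A \<alpha> \<noteq> - of_nat m) (at \<alpha>0)"
      unfolding eventually_at_filter by (intro always_eventually) (auto simp: A_def a0[symmetric])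
  qed
  have evA: "eventually (\<lambda>\<alpha>. A \<alpha> \<notin> \<int>\<^sub>\<le>\<^sub>0) (at \<alpha>0)"
    using eventually_not_nonpos_Int Afl by (rule eventually_compose_filterlim)
  define c where "c = (\<lambda>\<alpha> n. fps_nth (gauss_fps (A \<alpha>) (B \<alpha>) 1) n)"
  define h where "h = (\<lambda>\<alpha> n. digamma_bracket (A \<alpha>) (B \<alpha>) n)"
  define c0 where "c0 = (\<lambda>n. fps_nth (gauss_fps (- of_nat m) b0 1) n)"
  have rA: "((\<lambda>\<alpha>. rGamma (A \<alpha>)) \<longlongrightarrow> 0) (at \<alpha>0)"
  proof -
    have "((\<lambda>\<alpha>. rGamma (A \<alpha>)) \<longlongrightarrow> rGamma (- of_nat m)) (at \<alpha>0)"
      by (rule isCont_tendsto_compose[OF _ Alim]) (rule holomorphic_on_imp_continuous_on[of rGamma UNIV, THEN continuous_on_interior], auto intro!: holomorphic_intros)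
    thus ?thesis by (simp add: rGamma_eq_zero_iff)
  qed
  have rB: "((\<lambda>\<alpha>. rGamma (B \<alpha>)) \<longlongrightarrow> rGamma b0) (at \<alpha>0)"
    by (rule isCont_tendsto_compose[OF _ Blim]) (rule holomorphic_on_imp_continuous_on[of rGamma UNIV, THEN continuous_on_interior], auto intro!: holomorphic_intros)
  have poch: "((\<lambda>\<alpha>. pochhammer (g \<alpha>) n) \<longlongrightarrow> pochhammer l n) (at \<alpha>0)" if "(g \<longlongrightarrow> l) (at \<alpha>0)" for g :: "complex \<Rightarrow> complex" and l n
    using that by (induction n) (auto simp: pochhammer_Suc intro!: tendsto_intros)
  have climit: "((\<lambda>\<alpha>. c \<alpha> n) \<longlongrightarrow> c0 n) (at \<alpha>0)" for n
    unfolding c_def c0_def fps_nth_gauss_fps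
    by (intro tendsto_intros poch Alim Blim) (auto simp: pochhammer_fact[symmetric])
  \<comment> \<open>For n \<le> m the sum of the 1/(a+j) with j < n has no pole at -m, so only \<psi>(a) contributes to the limit.\<close>
  have head: "((\<lambda>\<alpha>. rGamma (A \<alpha>) * h \<alpha> n) \<longlongrightarrow> (-1) ^ m * fact m) (at \<alpha>0)" if n: "n \<le> m" for n
  proof -
    have b0n: "b0 + of_nat n \<notin> \<int>\<^sub>\<le>\<^sub>0"
    proof
      assume "b0 + of_nat n \<in> \<int>\<^sub>\<le>\<^sub>0"
      from Ints_diff[OF nonpos_Ints_Int[OF this] Ints_of_nat[of n]] show False using b0Z by simp
    qed
    have nz: "- of_nat m + of_nat j \<noteq> (0::complex)" if "j < n" for j
    proof -
      have "of_nat j \<noteq> (of_nat m :: complex)" using that n by simp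
      thus ?thesis by (simp add: add_eq_0_iff2)
    qed
    have "((\<lambda>\<alpha>. rGamma (A \<alpha>) * (2 * Digamma (of_nat n + 1) - Digamma (B \<alpha> + of_nat n) - (\<Sum>j<n. 1 / (A \<alpha> + of_nat j))) - rGamma (A \<alpha>) * Digamma (A \<alpha>))
      \<longlongrightarrow> 0 * (2 * Digamma (of_nat n + 1) - Digamma (b0 + of_nat n) - (\<Sum>j<n. 1 / (- of_nat m + of_nat j))) - (- ((-1) ^ m * fact m))) (at \<alpha>0)"
      by (intro tendsto_intros rA Blim Alim b0n nz filterlim_compose[OF rGamma_times_Digamma_limit Afl]) auto
    moreover have "eventually (\<lambda>\<alpha>. rGamma (A \<alpha>) * (2 * Digamma (of_nat n + 1) - Digamma (B \<alpha> + of_nat n) - (\<Sum>j<n. 1 / (A \<alpha> + of_nat j))) - rGamma (A \<alpha>) * Digamma (A \<alpha>)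
       = rGamma (A \<alpha>) * h \<alpha> n) (at \<alpha>0)"
      using evA
    proof eventually_elim
      case (elim \<alpha>)
      show ?case unfolding h_def digamma_bracket_def Digamma_add_of_nat[OF elim] by (simp add: algebra_simps)
    qed
    ultimately have "((\<lambda>\<alpha>. rGamma (A \<alpha>) * h \<alpha> n) \<longlongrightarrow>
       0 * (2 * Digamma (of_nat n + 1) - Digamma (b0 + of_nat n) - (\<Sum>j<n. 1 / (- of_nat m + of_nat j))) - (- ((-1) ^ m * fact m))) (at \<alpha>0)"
      by (rule Lim_transform_eventually)
    thus ?thesis by simp
  qed
  define headsum where "headsum = (\<lambda>\<alpha>. \<Sum>n\<le>m. c \<alpha> n * h \<alpha> n * (-1) ^ n)"
  have headlim: "((\<lambda>\<alpha>. rGamma (A \<alpha>) * headsum \<alpha>) \<longlongrightarrow> (-1) ^ m * fact m * eval_fps (gauss_fps (- of_nat m) b0 1) (-1)) (at \<alpha>0)"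
  proof -
    have "((\<lambda>\<alpha>. \<Sum>n\<le>m. c \<alpha> n * (rGamma (A \<alpha>) * h \<alpha> n) * (-1) ^ n) \<longlongrightarrow> (\<Sum>n\<le>m. c0 n * ((-1) ^ m * fact m) * (-1) ^ n)) (at \<alpha>0)"
      by (intro tendsto_intros climit head) auto
    moreover have "(\<Sum>n\<le>m. c \<alpha> n * (rGamma (A \<alpha>) * h \<alpha> n) * (-1) ^ n) = rGamma (A \<alpha>) * headsum \<alpha>" for \<alpha>
      by (simp add: headsum_def sum_distrib_left mult_ac)
    moreover have "(\<Sum>n\<le>m. c0 n * ((-1) ^ m * fact m) * (-1) ^ n) = (-1) ^ m * fact m * eval_fps (gauss_fps (- of_nat m) b0 1) (-1)"
      unfolding eval_gauss_fps_terminating c0_def by (simp add: sum_distrib_left mult_ac)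
    ultimately show ?thesis by simp
  qed
  have b0m: "b0 + of_nat m + 1 \<notin> \<int>\<^sub>\<le>\<^sub>0"
  proof
    assume "b0 + of_nat m + 1 \<in> \<int>\<^sub>\<le>\<^sub>0"
    from Ints_diff[OF nonpos_Ints_Int[OF this] Ints_of_nat[of "Suc m"]] show False using b0Z by simp
  qed
  have op: "open (- (\<int>\<^sub>\<le>\<^sub>0 :: complex set))" by (simp add: open_Compl)
  obtain r1 where r1: "r1 > 0" "cball (b0 + of_nat m + 1) r1 \<subseteq> - \<int>\<^sub>\<le>\<^sub>0"
    using op b0m open_contains_cball[of "- \<int>\<^sub>\<le>\<^sub>0"] by (meson ComplI)
  obtain r2 where r2: "r2 > 0" "cball (1::complex) r2 \<subseteq> - \<int>\<^sub>\<le>\<^sub>0"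
    using op one_not_nonpos_Int open_contains_cball[of "- \<int>\<^sub>\<le>\<^sub>0"] by (meson ComplI)
  \<comment> \<open>The arguments of the digamma functions in the terms n > m, shifted down by n - m - 1.\<close>
  define Q where "Q = cball (b0 + of_nat m + 1) r1 \<union> cball 1 r2 \<union> {of_nat m + 2}"
  have m2: "of_nat m + 2 \<notin> (\<int>\<^sub>\<le>\<^sub>0 :: complex set)"
    using not_nonpos_Int_plus_of_nat[OF one_not_nonpos_Int, of "Suc m"] by (simp add: add_ac)
  have Q: "compact Q" "Q \<inter> \<int>\<^sub>\<le>\<^sub>0 = {}"
    unfolding Q_def by (intro compact_Un compact_cball, simp) (use r1 r2 m2 in auto)
  obtain E where E: "E \<ge> 0" "\<And>z n. z \<in> Q \<Longrightarrow> norm (Digamma (1 + of_nat n) - Digamma (z + of_nat n)) \<le> E"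
    using Digamma_diff_bounded[OF Q] by metis
  define R where "R = norm ((- of_nat m) * b0) + 1"
  obtain M where M: "M \<ge> 0" "\<And>a b n. a + b = 2 * s \<Longrightarrow> norm (a * b) \<le> R \<Longrightarrow>
     norm (fps_nth (gauss_fps a b 1) n) \<le> M * norm (fps_nth (gauss_fps s s 1) n)"
    using gauss_coeff_comparison[OF s_ni, of R] by metis
  define w where "w = (\<lambda>n. M * norm (fps_nth (gauss_fps s s 1) n))"
  have w: "summable w" unfolding w_def by (intro summable_mult gauss_coeff_summable_diag s_ni Re_s)
  have w0: "w n \<ge> 0" for n using M by (simp add: w_def)
  have "((\<lambda>\<alpha>. norm (A \<alpha> * B \<alpha>)) \<longlongrightarrow> norm (- of_nat m * b0)) (at \<alpha>0)" by (intro tendsto_intros Alim Blim)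
  hence ev1: "eventually (\<lambda>\<alpha>. norm (A \<alpha> * B \<alpha>) < R) (at \<alpha>0)"
    by (rule order_tendstoD) (simp add: R_def)
  have "((\<lambda>\<alpha>. A \<alpha> + of_nat m + 1) \<longlongrightarrow> - of_nat m + of_nat m + 1) (at \<alpha>0)" by (intro tendsto_intros Alim)
  hence ev2: "eventually (\<lambda>\<alpha>. dist (A \<alpha> + of_nat m + 1) 1 < r2) (at \<alpha>0)" using r2 by (auto dest: tendstoD)
  have "((\<lambda>\<alpha>. B \<alpha> + of_nat m + 1) \<longlongrightarrow> b0 + of_nat m + 1) (at \<alpha>0)" by (intro tendsto_intros Blim)
  hence ev3: "eventually (\<lambda>\<alpha>. dist (B \<alpha> + of_nat m + 1) (b0 + of_nat m + 1) < r1) (at \<alpha>0)" using r1 by (auto dest: tendstoD)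
  define tail where "tail = (\<lambda>\<alpha>. \<Sum>k. c \<alpha> (k + Suc m) * h \<alpha> (k + Suc m) * (-1) ^ (k + Suc m))"
  define T where "T = suminf w"
  have evB: "eventually (\<lambda>\<alpha>. B \<alpha> \<notin> \<int>\<^sub>\<le>\<^sub>0) (at \<alpha>0)"
  proof -
    have "b0 \<in> - \<int>\<^sub>\<le>\<^sub>0" using b0Z nonpos_Ints_Int by blast
    from topological_tendstoD[OF Blim op this] show ?thesis by simp
  qed
  have bounds: "eventually (\<lambda>\<alpha>. norm (tail \<alpha>) \<le> 4 * E * T \<and> norm (K_fun \<alpha> s) \<le> T \<and> S_fun \<alpha> s = headsum \<alpha> + tail \<alpha>) (at \<alpha>0)"
    using ev1 ev2 ev3 evA evB
  proof eventually_elim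
    case (elim \<alpha>)
    have cb: "norm (c \<alpha> n) \<le> w n" for n
      unfolding c_def w_def using elim(1) by (intro M AB) auto
    have hb: "norm (h \<alpha> (k + Suc m)) \<le> 4 * E" for k
    proof -
      have q: "A \<alpha> + of_nat m + 1 \<in> Q" "B \<alpha> + of_nat m + 1 \<in> Q" "of_nat m + 2 \<in> Q"
        using elim by (auto simp: Q_def dist_commute)
      have "h \<alpha> (k + Suc m) = (Digamma (1 + of_nat k) - Digamma (A \<alpha> + of_nat m + 1 + of_nat k))
          + (Digamma (1 + of_nat k) - Digamma (B \<alpha> + of_nat m + 1 + of_nat k))
          - ((Digamma (1 + of_nat k) - Digamma (of_nat m + 2 + of_nat k)) + (Digamma (1 + of_nat k) - Digamma (of_nat m + 2 + of_nat k)))"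
        by (simp add: h_def digamma_bracket_def algebra_simps)
      also have "norm \<dots> \<le> (E + E) + (E + E)"
        by (intro order_trans[OF norm_triangle_ineq4] add_mono norm_triangle_mono E q)
      finally show ?thesis by simp
    qed
    have tb: "norm (c \<alpha> (k + Suc m) * h \<alpha> (k + Suc m) * (-1) ^ (k + Suc m)) \<le> w (k + Suc m) * (4 * E)" for k
      using mult_mono[OF cb[of "k + Suc m"] hb[of k]] w0 E by (simp add: norm_mult norm_power)
    have ws: "summable (\<lambda>k. w (k + Suc m))" by (rule summable_ignore_initial_segment[OF w])
    have "norm (tail \<alpha>) \<le> (\<Sum>k. w (k + Suc m) * (4 * E))"
      unfolding tail_def by (intro norm_suminf_le tb summable_mult2 ws)
    also have "\<dots> = (\<Sum>k. w (k + Suc m)) * (4 * E)" by (intro suminf_mult2[symmetric] ws)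
    also have "(\<Sum>k. w (k + Suc m)) \<le> T"
      unfolding T_def suminf_minus_initial_segment[OF w] using sum_nonneg[of "{..<Suc m}" w] w0
      by (simp del: sum.lessThan_Suc)
    finally have 1: "norm (tail \<alpha>) \<le> 4 * E * T" using E by (simp add: mult_ac mult_left_mono mult_right_mono)
    have 2: "norm (K_fun \<alpha> s) \<le> T"
      unfolding K_fun_def eval_fps_def T_def
      by (rule norm_suminf_le[OF _ w]) (use cb in \<open>simp add: c_def A_def B_def norm_mult norm_power\<close>)
    have sm: "summable (\<lambda>n. c \<alpha> n * h \<alpha> n * (-1) ^ n)"
    proof (rule summable_norm_cancel)
      show "summable (\<lambda>n. norm (c \<alpha> n * h \<alpha> n * (-1) ^ n))"
        using log_fps_summable[OF s_ni Re_s AB elim(4,5)]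
        by (simp add: log_fps_def c_def h_def norm_mult norm_power)
    qed
    have "S_fun \<alpha> s = (\<Sum>n. c \<alpha> n * h \<alpha> n * (-1) ^ n)"
      unfolding S_fun_eq eval_fps_def log_fps_def c_def h_def A_def B_def by simp
    also have "\<dots> = tail \<alpha> + (\<Sum>n<Suc m. c \<alpha> n * h \<alpha> n * (-1) ^ n)"
      unfolding tail_def by (rule suminf_split_initial_segment[OF sm])
    finally have 3: "S_fun \<alpha> s = headsum \<alpha> + tail \<alpha>" by (simp add: headsum_def lessThan_Suc_atMost)
    show ?case using 1 2 3 by blast
  qed
  have small: "((\<lambda>\<alpha>. rGamma (A \<alpha>) * g \<alpha>) \<longlongrightarrow> 0) (at \<alpha>0)" if "eventually (\<lambda>\<alpha>. norm (g \<alpha>) \<le> G) (at \<alpha>0)" for g :: "complex \<Rightarrow> complex" and G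
  proof (rule Lim_null_comparison)
    show "eventually (\<lambda>\<alpha>. norm (rGamma (A \<alpha>) * g \<alpha>) \<le> norm (rGamma (A \<alpha>)) * G) (at \<alpha>0)"
      using that by eventually_elim (auto simp: norm_mult intro: mult_left_mono)
    show "((\<lambda>\<alpha>. norm (rGamma (A \<alpha>)) * G) \<longlongrightarrow> 0) (at \<alpha>0)"
      using tendsto_mult_right[OF tendsto_norm[OF rA], of G] by simp
  qed
  define V where "V = Gamma (2 * s) * rGamma b0 * ((-1) ^ m * fact m * eval_fps (gauss_fps (- of_nat m) b0 1) (-1) + 0 + \<i> * of_real pi * 0)"
  have "((\<lambda>\<alpha>. Gamma (2 * s) * rGamma (B \<alpha>) * (rGamma (A \<alpha>) * headsum \<alpha> + rGamma (A \<alpha>) * tail \<alpha> + \<i> * of_real pi * (rGamma (A \<alpha>) * K_fun \<alpha> s))) \<longlongrightarrow> V) (at \<alpha>0)"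
    unfolding V_def
    by (intro tendsto_intros rB headlim small) (use bounds in \<open>auto elim: eventually_mono\<close>)
  moreover have "eventually (\<lambda>\<alpha>. Gamma (2 * s) * rGamma (B \<alpha>) * (rGamma (A \<alpha>) * headsum \<alpha> + rGamma (A \<alpha>) * tail \<alpha> + \<i> * of_real pi * (rGamma (A \<alpha>) * K_fun \<alpha> s))
     = H_rhs \<alpha> s) (at \<alpha>0)"
    using bounds
  proof eventually_elim
    case (elim \<alpha>)
    have "G * inverse y * (inverse x * h + inverse x * t + k * (inverse x * l)) = G / (x * y) * (h + t + k * l)"
      for G x y h t k l :: complex by (simp add: divide_inverse algebra_simps)
    thus ?case unfolding H_rhs_def rGamma_inverse_Gamma A_def B_def using elim by simp
  qed
  ultimately have lim: "((\<lambda>\<alpha>. H_rhs \<alpha> s) \<longlongrightarrow> V) (at \<alpha>0)" by (rule Lim_transform_eventually)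
  have ts: "2 * s \<notin> \<int>\<^sub>\<le>\<^sub>0" using two_s nonpos_Ints_Int by blast
  have "Gamma (2 * s) * rGamma b0 = 1 / pochhammer (2 * s) m"
    unfolding pochhammer_Gamma[OF ts] b0 by (simp add: rGamma_inverse_Gamma field_simps)
  moreover have "pochhammer (1 - b0) m = (-1) ^ m * pochhammer (2 * s) m"
    using pochhammer_minus[of "b0 - 1" m] by (simp add: b0)
  moreover have "(-1) ^ m / x = 1 / ((-1) ^ m * x)" for x :: complex
    by (cases "even m") auto
  ultimately have "V = fact m / pochhammer (1 - b0) m * eval_fps (gauss_fps (- of_nat m) b0 1) (-1)"
    unfolding V_def by (cases "even m") (simp_all add: mult_ac)
  thus ?thesis using lim unfolding b0_def by simp
qed

section \<open>Pfaff's transformation and the series at -1\<close>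

text \<open>
  Pfaff's transformation at the level of the equation: it applies to any solution, not only to the
  Gauss series, and so both to the branch on the cut plane and to the series inside the disc.
\<close>

lemma pfaff_solution:
  assumes h: "hypergeo_solution a (c - b) c D h h'"
    and E: "\<And>z. z \<in> E \<Longrightarrow> z / (z - 1) \<in> D" "\<And>z. z \<in> E \<Longrightarrow> 1 - z \<notin> \<real>\<^sub>\<le>\<^sub>0"
  shows "hypergeo_solution a b c E (\<lambda>z. (1 - z) powr (- a) * h (z / (z - 1)))
     (\<lambda>z. (1 - z) powr (- a) * (a * h (z / (z - 1)) / (1 - z) - h' (z / (z - 1)) / (1 - z)^2))"
  unfolding hypergeo_solution_def
proof (intro ballI conjI)
  fix z assume z: "z \<in> E"
  define t where "t = z / (z - 1)"
  define u where "u = 1 - z"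
  define p where "p = (1 - z) powr (- a)"
  have u: "u \<noteq> 0" "z - 1 \<noteq> 0" using E(2)[OF z] by (auto simp: u_def)
  obtain d where hd: "(h has_field_derivative h' t) (at t)" and
    d: "(h' has_field_derivative d) (at t)" "t * (1 - t) * d + (c - (a + (c - b) + 1) * t) * h' t - a * (c - b) * h t = 0"
    using h E(1)[OF z] unfolding hypergeo_solution_def t_def by blast
  have dt: "((\<lambda>z. z / (z - 1)) has_field_derivative - 1 / u^2) (at z)"
    using u by (auto intro!: derivative_eq_intros simp: u_def divide_simps power2_eq_square) (auto simp: algebra_simps)
  have dh: "((\<lambda>z. h (z / (z - 1))) has_field_derivative h' t * (- 1 / u^2)) (at z)"
    using DERIV_chain2[OF hd[unfolded t_def] dt] by (simp add: t_def)
  have dh': "((\<lambda>z. h' (z / (z - 1))) has_field_derivative d * (- 1 / u^2)) (at z)"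
    using DERIV_chain2[OF d(1)[unfolded t_def] dt] by (simp add: t_def)
  have dp: "((\<lambda>z. (1 - z) powr (- a)) has_field_derivative a * p / u) (at z)"
    using E(2)[OF z] u by (auto intro!: derivative_eq_intros simp: p_def u_def powr_diff field_simps)
  have "((\<lambda>z. (1 - z) powr (- a) * h (z / (z - 1))) has_field_derivative
      (a * p / u) * h t + (h' t * (- 1 / u^2)) * p) (at z)"
    using DERIV_mult[OF dp dh] by (simp add: t_def p_def)
  moreover have "(a * p / u) * h t + (h' t * (- 1 / u^2)) * p = p * (a * h t / u - h' t / u^2)"
    by (simp add: algebra_simps)
  ultimately show "((\<lambda>z. (1 - z) powr (- a) * h (z / (z - 1))) has_field_derivative
      (1 - z) powr (- a) * (a * h (z / (z - 1)) / (1 - z) - h' (z / (z - 1)) / (1 - z)^2)) (at z)"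
    by (simp add: t_def p_def u_def)
  define d2 where "d2 = p * (a * (a + 1) * h t / u^2 - (2 * a + 2) * h' t / u^3 + d / u^4)"
  have du: "((\<lambda>z. 1 - z) has_field_derivative -1) (at z)" by (auto intro!: derivative_eq_intros)
  have "((\<lambda>z. a * h (z / (z - 1)) / (1 - z) - h' (z / (z - 1)) / (1 - z)^2) has_field_derivative
     (a * (h' t * (- 1 / u^2)) * u + a * h t) / u^2 - (d * (- 1 / u^2) * u^2 + h' t * (2 * u)) / (u^2 * u^2)) (at z)"
    using u by (auto intro!: derivative_eq_intros dh dh' du simp: t_def u_def power2_eq_square)
      (simp add: algebra_simps)
  from DERIV_mult[OF dp this]
  have "((\<lambda>z. (1 - z) powr (- a) * (a * h (z / (z - 1)) / (1 - z) - h' (z / (z - 1)) / (1 - z)^2)) has_field_derivative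
     (a * p / u) * (a * h t / u - h' t / u^2) +
     ((a * (h' t * (- 1 / u^2)) * u + a * h t) / u^2 - (d * (- 1 / u^2) * u^2 + h' t * (2 * u)) / (u^2 * u^2)) * p) (at z)"
    by (simp add: t_def p_def u_def)
  moreover have "(a * p / u) * (a * h t / u - h' t / u^2) +
     ((a * (h' t * (- 1 / u^2)) * u + a * h t) / u^2 - (d * (- 1 / u^2) * u^2 + h' t * (2 * u)) / (u^2 * u^2)) * p = d2"
    using u unfolding d2_def by (simp add: divide_simps power2_eq_square eval_nat_numeral) (simp add: algebra_simps)
  ultimately have "((\<lambda>z. (1 - z) powr (- a) * (a * h (z / (z - 1)) / (1 - z) - h' (z / (z - 1)) / (1 - z)^2)) has_field_derivative d2) (at z)"
    by simp
  moreover have "z * (1 - z) * d2 + (c - (a + b + 1) * z) * (p * (a * h t / u - h' t / u^2)) - a * b * (p * h t) = 0"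
  proof -
    have zu: "z = 1 - u" by (simp add: u_def)
    have tu: "t = - (1 - u) / u" unfolding t_def zu using u by (simp add: divide_simps)
    have "z * (1 - z) * d2 + (c - (a + b + 1) * z) * (p * (a * h t / u - h' t / u^2)) - a * b * (p * h t) =
       - (p / u) * ((- (1 - u) / u) * (1 - (- (1 - u) / u)) * d + (c - (a + (c - b) + 1) * (- (1 - u) / u)) * h' t - a * (c - b) * h t)"
      unfolding zu d2_def using u(1) by (simp add: divide_simps power2_eq_square eval_nat_numeral) (simp add: algebra_simps)
    also have "\<dots> = 0" using d(2) unfolding tu[symmetric] by simp
    finally show ?thesis .
  qed
  ultimately show "\<exists>d. ((\<lambda>z. (1 - z) powr (- a) * (a * h (z / (z - 1)) / (1 - z) - h' (z / (z - 1)) / (1 - z)^2)) has_field_derivative d) (at z) \<and>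
       z * (1 - z) * d + (c - (a + b + 1) * z) * ((1 - z) powr (- a) * (a * h (z / (z - 1)) / (1 - z) - h' (z / (z - 1)) / (1 - z)^2))
        - a * b * ((1 - z) powr (- a) * h (z / (z - 1))) = 0"
    unfolding t_def p_def u_def by blast
qed

text \<open>
  Both sides of Pfaff's transformation agree on the part of the unit disc where Re z < 1/2,
  and at -1 the left one is continuous by absolute convergence.
\<close>

lemma gauss_at_minus_one:
  assumes sum: "summable (\<lambda>n. norm (fps_nth (gauss_fps s s 1) n))"
  shows "eval_fps (gauss_fps s s 1) (-1) = 2 powr (- s) * eval_fps (gauss_fps s (1 - s) 1) (1 / 2)"
proof -
  define F where "F = eval_fps (gauss_fps s s 1)"
  define G where "G = eval_fps (gauss_fps s (1 - s) 1)"
  define Y where "Y = (\<lambda>z. (1 - z) powr (- s) * G (z / (z - 1)))"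
  define E where "E = {z::complex. Re z < 1 / 2}"
  have opE: "open E" "convex E" unfolding E_def by (rule open_halfspace_Re_lt, rule convex_halfspace_Re_lt)
  have Et: "norm (z / (z - 1)) < 1" if "z \<in> E" for z
  proof -
    have "(norm z)\<^sup>2 < (norm (z - 1))\<^sup>2" using that by (simp add: E_def cmod_power2) (simp add: power2_eq_square algebra_simps)
    hence "norm z < norm (z - 1)" by (rule power2_less_imp_less) simp
    thus ?thesis by (simp add: norm_divide divide_less_eq)
  qed
  have "hypergeo_solution s (1 - s) 1 (ball 0 1) G (eval_fps (fps_deriv (gauss_fps s (1 - s) 1)))"
    unfolding G_def by (rule gauss_series_solution) simp
  from pfaff_solution[OF this, of E]
  obtain Y' where Y: "hypergeo_solution s s 1 E Y Y'"
    unfolding Y_def using Et by (auto simp: E_def complex_nonpos_Reals_iff)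
  have half: "ball 0 (1/2) \<subseteq> E"
  proof
    fix z :: complex assume "z \<in> ball 0 (1/2)"
    thus "z \<in> E" using complex_Re_le_cmod[of z] by (simp add: E_def)
  qed
  have Y0: "Y 0 = 1" by (simp add: Y_def G_def eval_fps_at_0 fps_nth_gauss_fps)
  have near: "Y z = F z" if "z \<in> ball 0 (1/2)" for z
    using hypergeo_solution_at_0[OF hypergeo_solution_subset[OF Y half], of z] that by (simp add: Y0 F_def)
  have holF: "F holomorphic_on ball 0 1"
    unfolding F_def by (rule hypergeo_solution_holomorphic(1)[OF gauss_series_solution]) auto
  have eq: "Y z = F z" if z: "z \<in> E \<inter> ball 0 1" for z
  proof (rule analytic_continuation_open[of "ball 0 (1/2)" "E \<inter> ball 0 1" Y F])
    show "connected (E \<inter> ball 0 1)" using opE by (intro convex_connected convex_Int) auto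
    show "Y holomorphic_on E \<inter> ball 0 1"
      using hypergeo_solution_holomorphic(1)[OF Y opE(1)] by (rule holomorphic_on_subset) auto
    show "F holomorphic_on E \<inter> ball 0 1" using holF by (rule holomorphic_on_subset) auto
  qed (use z opE half near in auto)
  \<comment> \<open>A sequence in the disc with limit -1, on which both sides agree.\<close>
  define X where "X = (\<lambda>n. - complex_of_real (real (Suc n) / real (Suc (Suc n))))"
  have Xlim: "X \<longlonglongrightarrow> - of_real 1"
    unfolding X_def by (intro tendsto_minus tendsto_of_real LIMSEQ_Suc[OF LIMSEQ_n_over_Suc_n])
  have XE: "X n \<in> E \<inter> ball 0 1" for n
  proof -
    have r: "0 < real (Suc n) / real (Suc (Suc n))" "real (Suc n) / real (Suc (Suc n)) < 1" by auto
    have "norm (X n) < 1" unfolding X_def norm_minus_cancel norm_of_real using r by simp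
    moreover have "Re (X n) \<le> 0" using r unfolding X_def by simp
    ultimately show ?thesis by (simp add: E_def)
  qed
  have "(\<lambda>n. F (X n)) \<longlonglongrightarrow> F (-1)"
    using Xlim XE less_imp_le unfolding F_def
    by (intro continuous_on_tendsto_compose[OF continuous_on_eval_fps_cball[OF sum]]) (auto intro!: always_eventually)
  moreover have "(\<lambda>n. Y (X n)) \<longlonglongrightarrow> Y (-1)"
    using Xlim XE by (intro continuous_on_tendsto_compose[OF holomorphic_on_imp_continuous_on[OF hypergeo_solution_holomorphic(1)[OF Y opE(1)]]])
      (auto intro!: always_eventually simp: E_def)
  ultimately have "F (-1) = Y (-1)" using eq[OF XE] LIMSEQ_unique by fastforce
  thus ?thesis by (simp add: F_def G_def Y_def)
qed

lemma bailey_summable: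
  assumes "c \<notin> \<int>\<^sub>\<le>\<^sub>0"
  shows "summable (\<lambda>n. norm (fps_nth (gauss_fps a b c) n * (1 / 2) ^ n))"
    "(\<lambda>n. fps_nth (gauss_fps a b c) n * (1 / 2) ^ n) sums eval_fps (gauss_fps a b c) (1 / 2)"
proof -
  have "ereal (norm (1 / 2 :: complex)) < 1" by (simp add: norm_divide one_ereal_def)
  also have "1 \<le> fps_conv_radius (gauss_fps a b c)" by (rule gauss_fps_conv_radius[OF assms])
  finally have r: "ereal (norm (1 / 2 :: complex)) < fps_conv_radius (gauss_fps a b c)" .
  show "summable (\<lambda>n. norm (fps_nth (gauss_fps a b c) n * (1 / 2) ^ n))"
    using r unfolding fps_conv_radius_def by (rule abs_summable_in_conv_radius)
  show "(\<lambda>n. fps_nth (gauss_fps a b c) n * (1 / 2) ^ n) sums eval_fps (gauss_fps a b c) (1 / 2)"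
    by (rule sums_eval_fps[OF r])
qed

text \<open>
  A telescoping certificate: with u(n) the terms of the series for c, the terms of the difference of both sides are
  the increments of 2 c (c+1) n u(n) / (c+n).
\<close>

lemma bailey_step:
  fixes a c :: complex
  assumes c: "c \<notin> \<int>\<^sub>\<le>\<^sub>0"
  shows "(c + a) * (c + 1 - a) * eval_fps (gauss_fps a (1 - a) (c + 2)) (1 / 2) = c * (c + 1) * eval_fps (gauss_fps a (1 - a) c) (1 / 2)"
proof -
  define u where "u = (\<lambda>n. fps_nth (gauss_fps a (1 - a) c) n * (1 / 2) ^ n)"
  define v where "v = (\<lambda>n. fps_nth (gauss_fps a (1 - a) (c + 2)) n * (1 / 2) ^ n)"
  have c2: "c + 2 \<notin> \<int>\<^sub>\<le>\<^sub>0" using not_nonpos_Int_plus_of_nat[OF c, of 2] by simp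
  note su = bailey_summable(2)[OF c, of a "1 - a", folded u_def] and sv = bailey_summable(2)[OF c2, of a "1 - a", folded v_def]
  define G where "G = (\<lambda>n. 2 * (c * (c + 1)) * (of_nat n / (c + of_nat n)) * u n)"
  have nz: "c + of_nat n \<noteq> 0" for n by (rule not_nonpos_Int_add_of_nat[OF c])
  have nz1: "c + of_nat n + 1 \<noteq> 0" for n using nz[of "Suc n"] by (simp add: add_ac)
  have c0: "c \<noteq> 0" "c + 1 \<noteq> 0" using nz[of 0] nz[of 1] by auto
  have pz: "pochhammer c n \<noteq> 0" for n by (rule pochhammer_not_nonpos_Int[OF c])
  have vu: "v n = u n * (c * (c + 1) / ((c + of_nat n) * (c + of_nat n + 1)))" for n
  proof -
    have "c * (c + 1) * pochhammer (c + 2) n = pochhammer c (n + 2)"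
      by (simp add: pochhammer_rec numeral_2_eq_2 add_ac mult_ac)
    also have "\<dots> = pochhammer c n * (c + of_nat n) * (c + of_nat n + 1)"
      by (simp add: pochhammer_Suc numeral_2_eq_2 add_ac)
    finally have eq: "c * (c + 1) * pochhammer (c + 2) n = pochhammer c n * (c + of_nat n) * (c + of_nat n + 1)" .
    have cc: "c * (c + 1) \<noteq> 0" using c0 by simp
    have "pochhammer (c + 2) n = pochhammer c n * ((c + of_nat n) * (c + of_nat n + 1)) / (c * (c + 1))"
      by (subst nonzero_eq_divide_eq[OF cc]) (use eq in \<open>simp only: mult_ac\<close>)
    thus ?thesis unfolding u_def v_def fps_nth_gauss_fps using c0 nz[of n] nz1[of n] pz[of n] by (simp add: mult_ac)
  qed
  have uS: "u (Suc n) = u n * ((a + of_nat n) * (1 - a + of_nat n) / (2 * of_nat (Suc n) * (c + of_nat n)))" for n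
  proof -
    have S0: "of_nat (Suc n) \<noteq> (0::complex)" unfolding of_nat_eq_0_iff by simp
    have "fps_nth (gauss_fps a (1 - a) c) (Suc n) = (a + of_nat n) * (1 - a + of_nat n) * fps_nth (gauss_fps a (1 - a) c) n / (of_nat (Suc n) * (c + of_nat n))"
      using gauss_fps_Suc[OF c, of n a "1 - a"] S0 nz[of n] by (simp add: eq_divide_eq mult_ac del: of_nat_Suc)
    thus ?thesis unfolding u_def by (simp add: mult_ac del: of_nat_Suc)
  qed
  have tele: "G (Suc n) - G n = (c + a) * (c + 1 - a) * v n - c * (c + 1) * u n" for n
  proof -
    define N where "N = complex_of_nat n"
    have S0: "N + 1 \<noteq> 0" unfolding N_def using of_nat_neq_0[of n, where ?'a = complex] by (simp add: add_ac)
    have x: "c + N \<noteq> 0" "c + N + 1 \<noteq> 0" using nz[of n] nz1[of n] by (simp_all add: N_def)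
    have e: "of_nat (Suc n) = N + 1" "of_nat n = N" by (simp_all add: N_def)
    have 1: "G (Suc n) = c * (c + 1) * u n * ((a + N) * (1 - a + N)) / ((c + N) * (c + N + 1))"
    proof -
      have "2 + N * 2 = 2 * (N + 1)" by simp
      hence "2 + N * 2 \<noteq> 0" using S0 by (metis mult_eq_0_iff zero_neq_numeral)
      thus ?thesis unfolding G_def uS e using S0 x by (simp add: divide_simps add_ac) (simp add: algebra_simps)
    qed
    have 2: "G n = c * (c + 1) * u n * (2 * N * (c + N + 1)) / ((c + N) * (c + N + 1))"
      unfolding G_def e using x by (simp add: divide_simps)
    have 3: "(c + a) * (c + 1 - a) * v n = c * (c + 1) * u n * ((c + a) * (c + 1 - a)) / ((c + N) * (c + N + 1))"
      unfolding vu e by simp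
    have 4: "c * (c + 1) * u n = c * (c + 1) * u n * ((c + N) * (c + N + 1)) / ((c + N) * (c + N + 1))"
      using x by simp
    have "(a + N) * (1 - a + N) - 2 * N * (c + N + 1) = (c + a) * (c + 1 - a) - (c + N) * (c + N + 1)"
      by (simp add: algebra_simps)
    hence key: "c * (c + 1) * u n * ((a + N) * (1 - a + N)) / ((c + N) * (c + N + 1)) - c * (c + 1) * u n * (2 * N * (c + N + 1)) / ((c + N) * (c + N + 1))
       = c * (c + 1) * u n * ((c + a) * (c + 1 - a)) / ((c + N) * (c + N + 1)) - c * (c + 1) * u n * ((c + N) * (c + N + 1)) / ((c + N) * (c + N + 1))"
      by (simp only: diff_divide_distrib[symmetric] right_diff_distrib[symmetric])
    show ?thesis by (simp only: 1 2 3 key 4[symmetric])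
  qed
  have "(\<lambda>n. of_nat n / (c + of_nat n)) \<longlonglongrightarrow> 1"
  proof -
    have "(\<lambda>n. 1 - c / (c + of_nat n)) \<longlonglongrightarrow> 1 - 0"
      by (intro tendsto_intros tendsto_divide_0[OF tendsto_const] tendsto_add_filterlim_at_infinity[OF tendsto_const] tendsto_of_nat)
    moreover have "1 - c / (c + of_nat n) = of_nat n / (c + of_nat n)" for n using nz[of n] by (simp add: divide_simps)
    ultimately show ?thesis by simp
  qed
  moreover have "u \<longlonglongrightarrow> 0" by (rule summable_LIMSEQ_zero[OF sums_summable[OF su]])
  ultimately have "G \<longlonglongrightarrow> 2 * (c * (c + 1)) * 1 * 0" unfolding G_def by (intro tendsto_intros)
  hence "(\<lambda>n. G (Suc n) - G n) sums (0 - G 0)" by (intro telescope_sums) simp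
  hence "(\<lambda>n. (c + a) * (c + 1 - a) * v n - c * (c + 1) * u n) sums 0" unfolding tele by (simp add: G_def)
  moreover have "(\<lambda>n. (c + a) * (c + 1 - a) * v n - c * (c + 1) * u n) sums
     ((c + a) * (c + 1 - a) * eval_fps (gauss_fps a (1 - a) (c + 2)) (1 / 2) - c * (c + 1) * eval_fps (gauss_fps a (1 - a) c) (1 / 2))"
    by (intro sums_diff sums_mult su sv)
  ultimately show ?thesis using sums_unique2 by fastforce
qed

lemma pochhammer_nat_lower_bound:
  fixes k :: nat
  assumes "k \<ge> 1"
  shows "pochhammer k (Suc n) \<ge> k * fact (Suc n)"
proof (induction n)
  case (Suc n)
  have "k * fact (Suc (Suc n)) = (k * fact (Suc n)) * Suc (Suc n)"
    by (simp only: fact_Suc[of "Suc n"] of_nat_id mult_ac)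
  also have "\<dots> \<le> pochhammer k (Suc n) * (k + Suc n)" using assms by (intro mult_mono Suc.IH) auto
  finally show ?case by (simp add: pochhammer_Suc)
qed simp

text \<open>
  Apart from the first one, the terms for c = 1 + 2m are at most 1/(2m+1) times those for c = 1 in modulus.
\<close>

lemma gauss_half_limit:
  "(\<lambda>m. eval_fps (gauss_fps a (1 - a) (1 + of_nat (2 * m))) (1 / 2)) \<longlonglongrightarrow> 1"
proof -
  define u where "u = (\<lambda>n. norm (fps_nth (gauss_fps a (1 - a) 1) n * (1 / 2) ^ n))"
  have su: "summable u" unfolding u_def by (rule bailey_summable(1)) simp
  define T where "T = (\<Sum>n. u (Suc n))"
  have bnd: "norm (eval_fps (gauss_fps a (1 - a) (1 + of_nat (2 * m))) (1 / 2) - 1) \<le> T / real (Suc (2 * m))" for m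
  proof -
    define v where "v = (\<lambda>n. fps_nth (gauss_fps a (1 - a) (1 + of_nat (2 * m))) n * (1 / 2) ^ n)"
    have ni: "1 + of_nat (2 * m) \<notin> (\<int>\<^sub>\<le>\<^sub>0 :: complex set)" by (rule not_nonpos_Int_plus_of_nat[OF one_not_nonpos_Int])
    have sv: "v sums eval_fps (gauss_fps a (1 - a) (1 + of_nat (2 * m))) (1 / 2)"
      unfolding v_def by (rule bailey_summable(2)[OF ni])
    have "v 0 = 1" by (simp add: v_def fps_nth_gauss_fps)
    hence "(\<lambda>n. v (Suc n)) sums (eval_fps (gauss_fps a (1 - a) (1 + of_nat (2 * m))) (1 / 2) - 1)"
      using sv by (subst sums_Suc_iff) simp
    hence "eval_fps (gauss_fps a (1 - a) (1 + of_nat (2 * m))) (1 / 2) - 1 = (\<Sum>n. v (Suc n))" by (simp add: sums_iff)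
    also have "norm \<dots> \<le> (\<Sum>n. u (Suc n) / real (Suc (2 * m)))"
    proof (rule norm_suminf_le)
      show "summable (\<lambda>n. u (Suc n) / real (Suc (2 * m)))" using su by (intro summable_divide) (simp add: summable_Suc_iff)
      fix n
      have e: "1 + of_nat (2 * m) = (of_nat (Suc (2 * m)) :: complex)" by simp
      have "real (Suc (2 * m)) * fact (Suc n) \<le> real (pochhammer (Suc (2 * m)) (Suc n))"
        using pochhammer_nat_lower_bound[of "Suc (2 * m)" n] by (metis le_numeral_extra(4) of_nat_fact of_nat_le_iff of_nat_mult Suc_le_eq zero_less_Suc One_nat_def)
      hence p: "real (Suc (2 * m)) * fact (Suc n) \<le> norm (pochhammer (1 + of_nat (2 * m) :: complex) (Suc n))"
        unfolding e pochhammer_of_nat norm_of_nat .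
      have "norm (v (Suc n)) = norm (pochhammer a (Suc n) * pochhammer (1 - a) (Suc n) * (1 / 2) ^ Suc n) / (norm (pochhammer (1 + of_nat (2 * m) :: complex) (Suc n)) * fact (Suc n))"
        unfolding v_def fps_nth_gauss_fps by (simp add: norm_mult norm_divide norm_power del: pochhammer_Suc fact_Suc of_nat_mult of_nat_Suc)
      also have "\<dots> \<le> norm (pochhammer a (Suc n) * pochhammer (1 - a) (Suc n) * (1 / 2) ^ Suc n) / ((real (Suc (2 * m)) * fact (Suc n)) * fact (Suc n))"
      proof -
        have pos: "0 < real (Suc (2 * m)) * fact (Suc n)" by (intro mult_pos_pos) auto
        hence "0 < norm (pochhammer (1 + of_nat (2 * m) :: complex) (Suc n))" using p by linarith
        thus ?thesis using p pos by (intro divide_left_mono mult_right_mono mult_pos_pos) (auto simp del: fact_Suc of_nat_Suc pochhammer_Suc)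
      qed
      also have "\<dots> = u (Suc n) / real (Suc (2 * m))"
        unfolding u_def fps_nth_gauss_fps pochhammer_fact[symmetric] by (simp add: norm_mult norm_divide norm_power mult_ac del: fact_Suc of_nat_Suc)
      finally show "norm (v (Suc n)) \<le> u (Suc n) / real (Suc (2 * m))" .
    qed
    also have "\<dots> = T / real (Suc (2 * m))" unfolding T_def using su by (intro suminf_divide) (simp add: summable_Suc_iff)
    finally show ?thesis .
  qed
  have "(\<lambda>m. eval_fps (gauss_fps a (1 - a) (1 + of_nat (2 * m))) (1 / 2) - 1) \<longlonglongrightarrow> 0"
  proof (rule Lim_null_comparison)
    show "eventually (\<lambda>m. norm (eval_fps (gauss_fps a (1 - a) (1 + of_nat (2 * m))) (1 / 2) - 1) \<le> T / real (Suc (2 * m))) sequentially"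
      using bnd by simp
    show "(\<lambda>m. T / real (Suc (2 * m))) \<longlonglongrightarrow> 0" by real_asymp
  qed
  thus ?thesis by (simp add: LIM_zero_iff)
qed

text \<open>
  Iterating \<open>bailey_step\<close> from c = 1 upwards expresses the sum as a quotient of Pochhammer symbols times
  a series that tends to 1.
\<close>

lemma gauss_half:
  assumes p: "(1 + a) / 2 \<notin> \<int>\<^sub>\<le>\<^sub>0" and q: "1 - a / 2 \<notin> \<int>\<^sub>\<le>\<^sub>0"
  shows "eval_fps (gauss_fps a (1 - a) 1) (1 / 2) = of_real (sqrt pi) / (Gamma ((1 + a) / 2) * Gamma (1 - a / 2))"
proof -
  define B where "B = (\<lambda>c. eval_fps (gauss_fps a (1 - a) c) (1 / 2))"
  define Q where "Q = (\<lambda>m. pochhammer ((1 + a) / 2) m * pochhammer (1 - a / 2) m / (pochhammer (1 / 2) m * pochhammer 1 m))"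
  have half: "(1 / 2 :: complex) \<notin> \<int>\<^sub>\<le>\<^sub>0" by (auto elim!: nonpos_Ints_cases' simp: complex_eq_iff)
  have step: "B 1 = Q m * B (1 + of_nat (2 * m))" for m
  proof (induction m)
    case 0 show ?case by (simp add: Q_def)
  next
    case (Suc m)
    define c where "c = (1 + of_nat (2 * m) :: complex)"
    have ni: "c \<notin> \<int>\<^sub>\<le>\<^sub>0" unfolding c_def by (rule not_nonpos_Int_plus_of_nat[OF one_not_nonpos_Int])
    have c0: "c \<noteq> 0" "c + 1 \<noteq> 0" using not_nonpos_Int_add_of_nat[OF ni, of 0] not_nonpos_Int_add_of_nat[OF ni, of 1] by auto
    have cc: "c * (c + 1) \<noteq> 0" using c0 by simp
    have "B c = ((c + a) * (c + 1 - a) * B (c + 2)) / (c * (c + 1))"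
      by (subst nonzero_eq_divide_eq[OF cc]) (use bailey_step[OF ni, of a] in \<open>simp only: B_def mult_ac\<close>)
    hence "B c = (c + a) * (c + 1 - a) / (c * (c + 1)) * B (c + 2)" by simp
    also have "c + a = 2 * ((1 + a) / 2 + of_nat m)" by (simp add: c_def field_simps)
    also have "c + 1 - a = 2 * (1 - a / 2 + of_nat m)" by (simp add: c_def field_simps)
    also have "c * (c + 1) = 4 * ((1 / 2 + of_nat m) * (1 + of_nat m))" by (simp add: c_def field_simps)
    also have "2 * ((1 + a) / 2 + of_nat m) * (2 * (1 - a / 2 + of_nat m)) / (4 * ((1 / 2 + of_nat m) * (1 + of_nat m))) =
       ((1 + a) / 2 + of_nat m) * (1 - a / 2 + of_nat m) / ((1 / 2 + of_nat m) * (1 + of_nat m))"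
    proof -
      have "2 * x * (2 * y) / (4 * w) = x * y / w" for x y w :: complex by simp
      thus ?thesis .
    qed
    finally have "B c = ((1 + a) / 2 + of_nat m) * (1 - a / 2 + of_nat m) / ((1 / 2 + of_nat m) * (1 + of_nat m)) * B (c + 2)" .
    moreover have "Q (Suc m) = Q m * (((1 + a) / 2 + of_nat m) * (1 - a / 2 + of_nat m) / ((1 / 2 + of_nat m) * (1 + of_nat m)))"
      by (simp add: Q_def pochhammer_Suc mult_ac)
    moreover have "c + 2 = 1 + of_nat (2 * Suc m)" by (simp add: c_def)
    ultimately show ?case using Suc.IH unfolding c_def[symmetric] by simp
  qed
  have bal: "(1 + a) / 2 + (1 - a / 2) = 1 / 2 + 1" by (simp add: field_simps)
  have G0: "Gamma (1 / 2 :: complex) \<noteq> 0" using half by (simp add: Gamma_eq_zero_iff)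
  have "Q m = gamma_quot ((1 + a) / 2) (1 - a / 2) (1 / 2) 1 m * (Gamma (1 / 2) / (Gamma ((1 + a) / 2) * Gamma (1 - a / 2)))" for m
    unfolding Q_def gamma_quot_def pochhammer_Gamma[OF p] pochhammer_Gamma[OF q] pochhammer_Gamma[OF half] pochhammer_Gamma[OF one_not_nonpos_Int]
    by (simp add: field_simps)
  hence Qlim: "Q \<longlonglongrightarrow> 1 * (Gamma (1 / 2) / (Gamma ((1 + a) / 2) * Gamma (1 - a / 2)))"
    using tendsto_mult_right[OF gamma_quot_LIMSEQ[OF p q half one_not_nonpos_Int bal]] by presburger
  have "(\<lambda>m. Q m * B (1 + of_nat (2 * m))) \<longlonglongrightarrow> (1 * (Gamma (1 / 2) / (Gamma ((1 + a) / 2) * Gamma (1 - a / 2)))) * 1"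
    unfolding B_def by (intro tendsto_mult Qlim gauss_half_limit)
  hence "B 1 = (1 * (Gamma (1 / 2) / (Gamma ((1 + a) / 2) * Gamma (1 - a / 2)))) * 1"
    unfolding step[symmetric] by (simp add: LIMSEQ_const_iff)
  thus ?thesis by (simp add: B_def Gamma_one_half_complex)
qed

section \<open>The diagonal case and the main theorem\<close>

text \<open>
  For a = b = s and c = 2s the parameters a, c - b, c are again s, s, 2s, so Pfaff's
  transformation maps the branch to itself.
\<close>

lemma gauss_2F1_diag_pfaff:
  assumes c: "2 * s \<notin> \<int>\<^sub>\<le>\<^sub>0" and z: "z \<in> cut_plane"
  shows "gauss_2F1 s s (2 * s) z = (1 - z) powr (- s) * gauss_2F1 s s (2 * s) (z / (z - 1))"
proof -
  define f where "f = gauss_2F1 s s (2 * s)"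
  define g where "g = (\<lambda>z. (1 - z) powr (- s) * f (z / (z - 1)))"
  have inv: "1 / x \<notin> \<real>\<^sub>\<le>\<^sub>0" if "x \<notin> \<real>\<^sub>\<le>\<^sub>0" for x :: complex
  proof
    assume "1 / x \<in> \<real>\<^sub>\<le>\<^sub>0"
    then obtain r where "1 / x = complex_of_real r" "r \<le> 0" by (elim nonpos_Reals_cases)
    hence "x = complex_of_real (1 / r)" "1 / r \<le> 0" by (auto simp: field_simps) (metis divide_divide_eq_right mult_1 div_by_1 divide_self_if)
    thus False using that by (metis nonpos_Reals_of_real_iff)
  qed
  have cut: "z \<in> cut_plane \<longleftrightarrow> 1 - z \<notin> \<real>\<^sub>\<le>\<^sub>0" for z
    by (auto simp: cut_plane_eq slit_plane_def complex_nonpos_Reals_iff)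
  have map: "z / (z - 1) \<in> cut_plane" if "z \<in> cut_plane" for z
  proof -
    have z1: "1 - z \<notin> \<real>\<^sub>\<le>\<^sub>0" using that cut by blast
    hence "z \<noteq> 1" by auto
    hence "1 - z / (z - 1) = 1 / (1 - z)" by (simp add: divide_simps)
    thus ?thesis using inv[OF z1] cut by simp
  qed
  have "hypergeo_solution s (2 * s - s) (2 * s) cut_plane f (deriv f)"
    using gauss_2F1_solution[OF c, of s s] by (simp add: f_def)
  from pfaff_solution[OF this, of cut_plane]
  obtain g' where g: "hypergeo_solution s s (2 * s) cut_plane g g'"
    unfolding g_def using map cut by blast
  have f0: "f 0 = 1" unfolding f_def using gauss_2F1_series[OF c, of 0 s s] by (simp add: eval_fps_at_0 fps_nth_gauss_fps)
  have g0: "g 0 = 1" by (simp add: g_def f0)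
  have "g z = f z"
  proof (rule analytic_continuation_open[of "ball 0 1" cut_plane g f])
    show "g holomorphic_on cut_plane" by (rule hypergeo_solution_holomorphic(1)[OF g open_cut_plane])
    show "f holomorphic_on cut_plane" unfolding f_def by (rule gauss_2F1_holomorphic[OF c])
    show "g w = f w" if "w \<in> ball 0 1" for w
      using hypergeo_solution_at_0[OF hypergeo_solution_subset[OF g ball_subset_cut_plane] zero_less_one c, of w] that
        gauss_2F1_series[OF c that, of s s] by (simp add: g0 f_def)
  qed (use z ball_subset_cut_plane open_cut_plane connected_cut_plane in auto)
  thus ?thesis by (simp add: f_def g_def)
qed

context zero_balanced
begin

text \<open>
  In terms of x = 1 - z the map z \<mapsto> z/(z-1) is x \<mapsto> 1/x, which exchanges the two halves of the unit circle.
\<close>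

lemma diag_relation:
  assumes "a = s" "b = s"
  shows "D (-1) + \<i> * of_real pi * U (-1) = exp (\<i> * of_real pi * s) * (D (-1) - \<i> * of_real pi * U (-1))"
proof -
  define X where "X = (\<lambda>n. exp (\<i> * of_real (angle_seq n)))"
  define X' where "X' = (\<lambda>n. exp (\<i> * of_real (- angle_seq n)))"
  have rel: "W (X n) = exp (- s * (\<i> * of_real (angle_seq n))) * W (X' n)" for n
  proof -
    have X0: "X n \<noteq> 0" by (simp add: X_def)
    have XX': "1 - X' n = (1 - X n) / ((1 - X n) - 1)"
    proof -
      have eq: "X' n = 1 / X n" by (simp add: X_def X'_def exp_minus inverse_eq_divide)
      show ?thesis unfolding eq using X0 by (simp add: field_simps)
    qed
    have "1 - X n \<in> cut_plane" unfolding X_def using Im_exp_angle_seq(1)[of n] by (simp add: cut_plane_eq slit_plane_def)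
    note pfaff = gauss_2F1_diag_pfaff[OF two_s_ni this]
    have c: "gauss_2F1 a b (2 * s) (1 - X n) = C * W (X n)" "gauss_2F1 a b (2 * s) (1 - X' n) = C * W (X' n)"
      unfolding X_def X'_def by (rule connection exp_angle_seq_in)+
    have "C * W (X n) = X n powr (- s) * (C * W (X' n))"
      using pfaff c unfolding assms XX'[symmetric] by simp
    moreover have "X n powr (- s) = exp (- s * (\<i> * of_real (angle_seq n)))"
      unfolding X_def powr_def Ln_exp_angle_seq by simp
    ultimately show ?thesis using C_nonzero by simp
  qed
  have "(\<lambda>n. exp (- s * (\<i> * of_real (angle_seq n))) * W (X' n)) \<longlonglongrightarrow>
     exp (- s * (\<i> * of_real (- pi))) * (D (-1) - \<i> * of_real pi * U (-1))"
    unfolding X'_def by (intro tendsto_intros W_angle_seq_limit angle_seq_limit)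
  moreover have "(\<lambda>n. W (X n)) \<longlonglongrightarrow> D (-1) + \<i> * of_real pi * U (-1)"
    unfolding X_def by (rule W_angle_seq_limit(1))
  ultimately have "D (-1) + \<i> * of_real pi * U (-1) = exp (- s * (\<i> * of_real (- pi))) * (D (-1) - \<i> * of_real pi * U (-1))"
    unfolding rel using LIMSEQ_unique by blast
  thus ?thesis by (simp add: mult_ac)
qed

end


lemma not_nonpos_of_double:
  fixes s :: complex
  assumes "2 * s \<notin> \<int>"
  shows "(s + of_int k) / 2 \<notin> \<int>\<^sub>\<le>\<^sub>0" "s + of_int k \<notin> \<int>\<^sub>\<le>\<^sub>0" "1 - s / 2 \<notin> \<int>\<^sub>\<le>\<^sub>0" "s + 1 / 2 \<notin> \<int>\<^sub>\<le>\<^sub>0"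
proof -
  have *: "2 * s \<in> \<int>" if "2 * s = 4 * x + of_int j" "x \<in> \<int>" for x j
    unfolding that(1) using that(2) by (intro Ints_add Ints_mult) auto
  show "(s + of_int k) / 2 \<notin> \<int>\<^sub>\<le>\<^sub>0"
    using *[of "(s + of_int k) / 2" "- 2 * k"] assms nonpos_Ints_Int by (auto simp: field_simps)
  have **: "2 * s \<in> \<int>" if "2 * s = 2 * x + of_int j" "x \<in> \<int>" for x j
    unfolding that(1) using that(2) by (intro Ints_add Ints_mult) auto
  show "s + of_int k \<notin> \<int>\<^sub>\<le>\<^sub>0"
    using **[of "s + of_int k" "- 2 * k"] assms nonpos_Ints_Int by (auto simp: field_simps)
  show "s + 1 / 2 \<notin> \<int>\<^sub>\<le>\<^sub>0"
    using **[of "s + 1 / 2" "- 1"] assms nonpos_Ints_Int by (auto simp: field_simps)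
  have ***: "2 * s \<in> \<int>" if "2 * s = 4 - 4 * x" "x \<in> \<int>" for x
    unfolding that(1) using that(2) by (intro Ints_diff Ints_mult) auto
  show "1 - s / 2 \<notin> \<int>\<^sub>\<le>\<^sub>0"
    using ***[of "1 - s / 2"] assms nonpos_Ints_Int by (auto simp: field_simps)
qed

lemma K_fun_0:
  assumes two_s: "2 * s \<notin> \<int>" and Re_s: "Re s < 1 / 2"
  shows "K_fun 0 s = Gamma (1 + s / 2) / (Gamma (1 + s) * Gamma (1 - s / 2))"
proof -
  note ni = not_nonpos_of_double[OF two_s]
  have s: "s \<notin> \<int>\<^sub>\<le>\<^sub>0" using ni(2)[of 0] by simp
  have p: "(1 + s) / 2 \<notin> \<int>\<^sub>\<le>\<^sub>0" using ni(1)[of 1] by (simp add: add.commute)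
  have p': "(1 + s) / 2 + 1 / 2 \<notin> \<int>\<^sub>\<le>\<^sub>0" using ni(1)[of 2] by (simp add: field_simps)
  have "K_fun 0 s = eval_fps (gauss_fps s s 1) (-1)" by (simp add: K_fun_def)
  also have "\<dots> = 2 powr (- s) * (of_real (sqrt pi) / (Gamma ((1 + s) / 2) * Gamma (1 - s / 2)))"
    unfolding gauss_at_minus_one[OF gauss_coeff_summable_diag[OF s Re_s]] gauss_half[OF p ni(3)] ..
  finally have K: "K_fun 0 s = 2 powr (- s) * of_real (sqrt pi) / (Gamma ((1 + s) / 2) * Gamma (1 - s / 2))" by simp
  have "Gamma ((1 + s) / 2) * Gamma ((1 + s) / 2 + 1 / 2) =
      exp ((1 - 2 * ((1 + s) / 2)) * of_real (ln 2)) * of_real (sqrt pi) * Gamma (2 * ((1 + s) / 2))"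
    by (rule Gamma_legendre_duplication[OF p p'])
  moreover have "(1 + s) / 2 + 1 / 2 = 1 + s / 2" by (simp add: field_simps)
  moreover have "2 * ((1 + s) / 2) = 1 + s" by simp
  moreover have "exp ((1 - (1 + s)) * of_real (ln 2)) = 2 powr (- s)"
  proof -
    have "Ln 2 = complex_of_real (ln 2)" using Ln_of_real[of 2] by simp
    thus ?thesis by (simp add: powr_def)
  qed
  ultimately have dup: "Gamma ((1 + s) / 2) * Gamma (1 + s / 2) = 2 powr (- s) * of_real (sqrt pi) * Gamma (1 + s)" by (simp only:)
  have "Gamma ((1 + s) / 2) \<noteq> 0" "Gamma (1 + s) \<noteq> 0" using p ni(2)[of 1] by (auto simp: Gamma_eq_zero_iff add.commute)
  hence "2 powr (- s) * of_real (sqrt pi) / Gamma ((1 + s) / 2) = Gamma (1 + s / 2) / Gamma (1 + s)"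
    using dup by (simp add: frac_eq_eq mult_ac)
  thus ?thesis unfolding K by (metis divide_divide_eq_left)
qed

text \<open>
  Multiplying \<open>diag_relation\<close> by exp(-i\<pi>s/2) turns it into S sin(\<pi>s/2) = \<pi> K cos(\<pi>s/2); the rest is
  reflection and duplication of the Gamma function.
\<close>

lemma S_fun_0:
  assumes two_s: "2 * s \<notin> \<int>" and Re_s: "Re s < 1 / 2"
  shows "S_fun 0 s = cos (of_real pi * s / 2) *
      (of_real (sqrt pi) * Gamma (s + 1 / 2) * (Gamma s)\<^sup>2 /
        (Gamma (2 * s) * (Gamma ((s + 1) / 2))\<^sup>2))"
proof -
  note ni = not_nonpos_of_double[OF two_s]
  have s: "s \<notin> \<int>\<^sub>\<le>\<^sub>0" using ni(2)[of 0] by simp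
  have s2: "s / 2 \<notin> \<int>\<^sub>\<le>\<^sub>0" using ni(1)[of 0] by simp
  have s12: "(s + 1) / 2 \<notin> \<int>\<^sub>\<le>\<^sub>0" using ni(1)[of 1] by simp
  have s1: "1 + s \<notin> \<int>\<^sub>\<le>\<^sub>0" using ni(2)[of 1] by (simp add: add.commute)
  have ts: "2 * s \<notin> \<int>\<^sub>\<le>\<^sub>0" using two_s nonpos_Ints_Int by blast
  have G0: "Gamma s \<noteq> 0" "Gamma (s / 2) \<noteq> 0" "Gamma ((s + 1) / 2) \<noteq> 0" "Gamma (2 * s) \<noteq> 0" "Gamma (1 - s / 2) \<noteq> 0"
    "Gamma (1 + s) \<noteq> 0"
    using s s2 s12 ts s1 ni(3) by (auto simp: Gamma_eq_zero_iff)
  have s0: "s \<noteq> 0" using s by auto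
  interpret zero_balanced s s s using s two_s Re_s by unfold_locales auto
  define S K where "S = S_fun 0 s" and "K = K_fun 0 s"
  have SD: "D (-1) = S" by (simp add: S_def D_def S_fun_eq)
  have KU: "U (-1) = K" by (simp add: K_def U_def K_fun_def)
  define t where "t = of_real pi * s / 2"
  have sum: "S + \<i> * of_real pi * K = exp (\<i> * (2 * t)) * (S - \<i> * of_real pi * K)"
    using diag_relation[OF refl refl] unfolding SD KU t_def by (simp add: mult_ac)
  have "exp (- (\<i> * t)) * (S + \<i> * of_real pi * K) = (exp (- (\<i> * t)) * exp (\<i> * (2 * t))) * (S - \<i> * of_real pi * K)"
    unfolding sum by simp
  also have "exp (- (\<i> * t)) * exp (\<i> * (2 * t)) = exp (\<i> * t)" by (simp flip: exp_add)
  finally have e: "exp (- (\<i> * t)) * (S + \<i> * of_real pi * K) = exp (\<i> * t) * (S - \<i> * of_real pi * K)" .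
  have euler: "exp (\<i> * t) = cos t + \<i> * sin t" "exp (- (\<i> * t)) = cos t - \<i> * sin t"
    using exp_Euler[of t] exp_Euler[of "-t"] by simp_all
  have "2 * \<i> * (sin t * S) = 2 * \<i> * (of_real pi * K * cos t)"
    using e unfolding euler by (simp add: algebra_simps)
  hence sc: "sin t * S = of_real pi * K * cos t" by simp
  have refl: "Gamma (s / 2) * Gamma (1 - s / 2) = of_real pi / sin t"
    using Gamma_reflection_complex[of "s / 2"] by (simp add: t_def)
  have sin0: "sin t \<noteq> 0" using refl G0 by auto
  have "S = cos t * (of_real pi / sin t) * K" using sc sin0 by (simp add: field_simps)
  also have "\<dots> = cos t * (Gamma (s / 2) * Gamma (1 - s / 2)) * (Gamma (1 + s / 2) / (Gamma (1 + s) * Gamma (1 - s / 2)))"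
    unfolding refl[symmetric] K_def K_fun_0[OF two_s Re_s] ..
  also have "\<dots> = cos t * (Gamma (s / 2) * Gamma (1 + s / 2) / Gamma (1 + s))" using G0 by simp
  also have "Gamma (1 + s / 2) = s / 2 * Gamma (s / 2)" using Gamma_plus1[OF s2] by (simp add: add.commute)
  also have "Gamma (1 + s) = s * Gamma s" using Gamma_plus1[OF s] by (simp add: add.commute)
  finally have S: "S = cos t * (Gamma (s / 2) ^ 2 / (2 * Gamma s))" using s0 by (simp add: power2_eq_square)
  have d1: "Gamma (s / 2) * Gamma ((s + 1) / 2) = exp ((1 - s) * of_real (ln 2)) * of_real (sqrt pi) * Gamma s"
  proof -
    have e: "s / 2 + 1 / 2 = (s + 1) / 2" by (simp add: add_divide_distrib)
    have "s / 2 + 1 / 2 \<notin> \<int>\<^sub>\<le>\<^sub>0" unfolding e by (rule s12)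
    from Gamma_legendre_duplication[OF s2 this] show ?thesis unfolding e by simp
  qed
  have d2: "Gamma s * Gamma (s + 1 / 2) = exp ((1 - 2 * s) * of_real (ln 2)) * of_real (sqrt pi) * Gamma (2 * s)"
    by (rule Gamma_legendre_duplication[OF s ni(4)])
  define q where "q = of_real (sqrt pi) * (1 :: complex)"
  define E where "E = exp ((1 - 2 * s) * complex_of_real (ln 2))"
  have EE: "exp ((1 - s) * of_real (ln 2)) ^ 2 = 2 * E"
  proof -
    have "exp ((1 - s) * of_real (ln 2)) ^ 2 = exp (of_real (ln 2) + (1 - 2 * s) * complex_of_real (ln 2))"
      by (simp add: power2_eq_square algebra_simps flip: exp_add)
    also have "\<dots> = exp (of_real (ln 2)) * E" unfolding E_def by (rule exp_add)
    also have "exp (complex_of_real (ln 2)) = 2" by (simp add: exp_of_real)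
    finally show ?thesis .
  qed
  have "Gamma (s / 2) ^ 2 * Gamma ((s + 1) / 2) ^ 2 = 2 * E * q ^ 2 * Gamma s ^ 2"
  proof -
    have "Gamma (s / 2) ^ 2 * Gamma ((s + 1) / 2) ^ 2 = (Gamma (s / 2) * Gamma ((s + 1) / 2)) ^ 2" by (simp add: power_mult_distrib)
    also have "\<dots> = exp ((1 - s) * of_real (ln 2)) ^ 2 * q ^ 2 * Gamma s ^ 2" unfolding d1 by (simp add: q_def power_mult_distrib)
    finally show ?thesis unfolding EE .
  qed
  hence g1: "Gamma (s / 2) ^ 2 = 2 * E * q ^ 2 * Gamma s ^ 2 / Gamma ((s + 1) / 2) ^ 2" using G0 by (simp add: eq_divide_eq)
  have "Gamma (s + 1 / 2) = E * q * Gamma (2 * s) / Gamma s" using d2 G0 by (simp add: E_def q_def eq_divide_eq mult_ac)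
  hence "of_real (sqrt pi) * Gamma (s + 1 / 2) * (Gamma s)\<^sup>2 / (Gamma (2 * s) * (Gamma ((s + 1) / 2))\<^sup>2) =
       E * q ^ 2 * Gamma s / (Gamma ((s + 1) / 2))\<^sup>2"
    using G0 by (simp add: q_def power2_eq_square)
  moreover have "Gamma (s / 2) ^ 2 / (2 * Gamma s) = E * q ^ 2 * Gamma s / (Gamma ((s + 1) / 2))\<^sup>2"
    unfolding g1 using G0 by (simp add: power2_eq_square)
  ultimately show ?thesis using S unfolding S_def t_def by simp
qed

lemma Reals_suminf:
  fixes f :: "nat \<Rightarrow> complex"
  assumes "summable f" "\<And>n. f n \<in> \<real>"
  shows "suminf f \<in> \<real>"
  using closed_sequentially[OF closed_complex_Reals _ summable_LIMSEQ[OF assms(1)]] assms(2) by (auto intro: sum_in_Reals)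

lemma Reals_eval_fps:
  assumes "summable (\<lambda>n. norm (fps_nth F n))" "\<And>n. fps_nth F n \<in> \<real>"
  shows "eval_fps F (-1) \<in> (\<real> :: complex set)"
  unfolding eval_fps_def
proof (rule Reals_suminf)
  have "summable (\<lambda>n. norm (fps_nth F n * (-1) ^ n))" using assms(1) by (simp add: norm_mult norm_power)
  thus "summable (\<lambda>n. fps_nth F n * (-1) ^ n)" by (rule summable_norm_cancel)
qed (use assms(2) in auto)

lemma Reals_pochhammer: "x \<in> \<real> \<Longrightarrow> pochhammer x n \<in> (\<real> :: complex set)"
  by (induction n) (auto simp: pochhammer_Suc)

lemma Reals_fact: "(fact n :: complex) \<in> \<real>"
  by (metis Reals_of_nat of_nat_fact)

lemma Reals_gauss_fps:
  assumes "a \<in> \<real>" "b \<in> \<real>"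
  shows "fps_nth (gauss_fps a b 1) n \<in> \<real>"
  using assms unfolding fps_nth_gauss_fps by (intro Reals_divide Reals_mult Reals_pochhammer Reals_fact) auto

lemma Reals_Gamma: "x \<in> \<real> \<Longrightarrow> Gamma x \<in> (\<real> :: complex set)"
  by (elim Reals_cases) (simp add: Gamma_complex_of_real)

theorem proposition7p7:
  fixes \<alpha> Z s a b :: complex
  assumes s_def: "s = (1 - Z) / 2"
    and a_def: "a = s - \<alpha> / 2"
    and b_def: "b = s + \<alpha> / 2"
    and Re_s: "Re s < 1 / 2"
    and two_s: "2 * s \<notin> \<int>"
  shows "(gauss_2F1 a b (2 * s) \<longlongrightarrow> calH \<alpha> Z) (at 2 within {z. Im z > 0}) \<and>
    summable (\<lambda>n. norm (fps_nth (gauss_fps a b 1) n * (-1) ^ n)) \<and>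
    (a \<notin> \<int>\<^sub>\<le>\<^sub>0 \<and> b \<notin> \<int>\<^sub>\<le>\<^sub>0 \<longrightarrow>
       summable (\<lambda>n. norm (S_term \<alpha> s n)) \<and> calH \<alpha> Z = H_rhs \<alpha> s) \<and>
    (a \<in> \<int>\<^sub>\<le>\<^sub>0 \<or> b \<in> \<int>\<^sub>\<le>\<^sub>0 \<longrightarrow>
       ((\<lambda>\<alpha>'. H_rhs \<alpha>' s) \<longlongrightarrow> calH \<alpha> Z) (at \<alpha>)) \<and>
    (\<alpha> \<in> \<real> \<and> Z \<in> \<real> \<and> Re Z > 1 \<longrightarrow>
       of_real (Im (calH \<alpha> Z)) =
         of_real pi * Gamma (2 * s) * K_fun \<alpha> s / (Gamma a * Gamma b)) \<and>
    K_fun 0 s = Gamma (1 + s / 2) / (Gamma (1 + s) * Gamma (1 - s / 2)) \<and>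
    S_fun 0 s = cos (of_real pi * s / 2) *
      (of_real (sqrt pi) * Gamma (s + 1 / 2) * (Gamma s)\<^sup>2 /
        (Gamma (2 * s) * (Gamma ((s + 1) / 2))\<^sup>2))"
proof -
  have ts: "2 * s \<notin> \<int>\<^sub>\<le>\<^sub>0" using two_s nonpos_Ints_Int by blast
  have s_ni: "s \<notin> \<int>\<^sub>\<le>\<^sub>0" using not_nonpos_of_double(2)[OF two_s, of 0] by simp
  have ab: "a + b = 2 * s" by (simp add: a_def b_def)
  have limit: "(gauss_2F1 (s - \<alpha> / 2) (s + \<alpha> / 2) (2 * s) \<longlongrightarrow> calH \<alpha> Z) (at 2 within {z. Im z > 0})" for \<alpha>
    using calH_limit[of Z \<alpha>] ts unfolding s_def by blast
  have sumU: "summable (\<lambda>n. norm (fps_nth (gauss_fps a b 1) n))"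
    by (rule gauss_coeff_summable[OF s_ni Re_s ab])
  have generic: "summable (\<lambda>n. norm (fps_nth (log_fps a b) n)) \<and> calH \<alpha> Z = H_rhs \<alpha> s" if ni: "a \<notin> \<int>\<^sub>\<le>\<^sub>0" "b \<notin> \<int>\<^sub>\<le>\<^sub>0"
  proof -
    interpret zero_balanced a b s using ni ab two_s Re_s by unfold_locales
    have "calH \<alpha> Z = C * (D (-1) + \<i> * of_real pi * U (-1))"
      by (rule boundary_value) (use limit[of \<alpha>] in \<open>simp add: a_def b_def\<close>)
    also have "\<dots> = H_rhs \<alpha> s"
      unfolding C_def D_def U_def H_rhs_def S_fun_eq K_fun_def ab by (simp add: a_def b_def)
    finally show ?thesis using D_summable by simp
  qed
  have pole: "((\<lambda>\<alpha>'. H_rhs \<alpha>' s) \<longlongrightarrow> calH \<beta> Z) (at \<beta>) \<and>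
      (s + \<beta> / 2 \<in> \<real> \<longrightarrow> calH \<beta> Z \<in> \<real>)" if pl: "s - \<beta> / 2 \<in> \<int>\<^sub>\<le>\<^sub>0" for \<beta>
  proof -
    obtain m where m: "s - \<beta> / 2 = - of_nat m" using pl by (elim nonpos_Ints_cases')
    have bm: "- of_nat m + (s + \<beta> / 2) = 2 * s" unfolding m[symmetric] by simp
    have bZ: "s + \<beta> / 2 \<notin> \<int>"
    proof
      assume "s + \<beta> / 2 \<in> \<int>"
      from Ints_diff[OF this Ints_of_nat[of m]] have "2 * s \<in> \<int>" using bm by (metis uminus_add_conv_diff)
      thus False using two_s by blast
    qed
    have val: "calH \<beta> Z = fact m / pochhammer (1 - (s + \<beta> / 2)) m * eval_fps (gauss_fps (- of_nat m) (s + \<beta> / 2) 1) (-1)"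
    proof (rule boundary_value_terminating)
      show "- of_nat m + (s + \<beta> / 2) \<notin> \<int>\<^sub>\<le>\<^sub>0" unfolding bm by (rule ts)
      show "(gauss_2F1 (- of_nat m) (s + \<beta> / 2) (- of_nat m + (s + \<beta> / 2)) \<longlongrightarrow> calH \<beta> Z) (at 2 within {z. Im z > 0})"
        unfolding bm using limit[of \<beta>] unfolding m .
    qed (rule bZ)
    have "calH \<beta> Z \<in> \<real>" if "s + \<beta> / 2 \<in> \<real>"
      unfolding val eval_gauss_fps_terminating using that
      by (intro Reals_mult Reals_divide sum_in_Reals Reals_power Reals_pochhammer Reals_gauss_fps Reals_fact) auto
    thus ?thesis using H_rhs_limit[OF two_s Re_s m] unfolding val by blast
  qed
  \<comment> \<open>If b is the nonpositive integer, the sign of \<alpha> is changed, which exchanges a and b.\<close>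
  have pole': "((\<lambda>\<alpha>'. H_rhs \<alpha>' s) \<longlongrightarrow> calH \<alpha> Z) (at \<alpha>) \<and> (a \<in> \<real> \<longrightarrow> b \<in> \<real> \<longrightarrow> calH \<alpha> Z \<in> \<real>)"
    if pl: "a \<in> \<int>\<^sub>\<le>\<^sub>0 \<or> b \<in> \<int>\<^sub>\<le>\<^sub>0"
  proof (cases "a \<in> \<int>\<^sub>\<le>\<^sub>0")
    case True
    thus ?thesis using pole[of \<alpha>] by (simp add: a_def b_def)
  next
    case False
    hence "s - (- \<alpha>) / 2 \<in> \<int>\<^sub>\<le>\<^sub>0" using pl by (simp add: b_def)
    from pole[OF this] have 1: "((\<lambda>\<alpha>'. H_rhs \<alpha>' s) \<longlongrightarrow> calH \<alpha> Z) (at (- \<alpha>))" and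
      2: "s - \<alpha> / 2 \<in> \<real> \<longrightarrow> calH \<alpha> Z \<in> \<real>" by (simp_all add: calH_minus)
    have "filterlim uminus (at (- \<alpha>)) (at \<alpha>)"
      by (intro filterlim_atI tendsto_intros) (auto simp: eventually_at_filter)
    from filterlim_compose[OF 1 this] have "((\<lambda>\<alpha>'. H_rhs \<alpha>' s) \<longlongrightarrow> calH \<alpha> Z) (at \<alpha>)" by (simp add: H_rhs_minus)
    thus ?thesis using 2 by (simp add: a_def)
  qed
  have imag: "of_real (Im (calH \<alpha> Z)) = of_real pi * Gamma (2 * s) * K_fun \<alpha> s / (Gamma a * Gamma b)"
    if real: "\<alpha> \<in> \<real>" "Z \<in> \<real>"
  proof -
    have sR: "s \<in> \<real>" unfolding s_def using real by auto
    have aR: "a \<in> \<real>" and bR: "b \<in> \<real>" using sR real by (auto simp: a_def b_def)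
    show ?thesis
    proof (cases "a \<in> \<int>\<^sub>\<le>\<^sub>0 \<or> b \<in> \<int>\<^sub>\<le>\<^sub>0")
      case True
      hence "Im (calH \<alpha> Z) = 0" using pole' aR bR by (auto simp: complex_is_Real_iff)
      moreover have "Gamma a * Gamma b = 0" using True by (auto simp: Gamma_eq_zero_iff)
      ultimately show ?thesis by simp
    next
      case False
      hence g: "summable (\<lambda>n. norm (fps_nth (log_fps a b) n))" "calH \<alpha> Z = H_rhs \<alpha> s" using generic by blast+
      have KR: "K_fun \<alpha> s \<in> \<real>" unfolding K_fun_def a_def[symmetric] b_def[symmetric]
        by (intro Reals_eval_fps sumU Reals_gauss_fps aR bR)
      have "fps_nth (log_fps a b) n \<in> \<real>" for n
      proof -
        have nz: "a + of_nat n \<noteq> 0" "b + of_nat n \<noteq> 0" "of_nat n + 1 \<noteq> (0::complex)"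
          using False not_nonpos_Int_add_of_nat not_nonpos_Int_add_of_nat[OF one_not_nonpos_Int, of n] by (auto simp: add.commute)
        have "digamma_bracket a b n \<in> \<real>" unfolding digamma_bracket_def
          by (intro Reals_diff Reals_mult Polygamma_Real nz Reals_add aR bR) auto
        thus ?thesis unfolding log_fps_def using Reals_gauss_fps[OF aR bR] by auto
      qed
      hence SR: "S_fun \<alpha> s \<in> \<real>" unfolding S_fun_eq a_def[symmetric] b_def[symmetric] by (intro Reals_eval_fps g)
      have XR: "Gamma (2 * s) / (Gamma a * Gamma b) \<in> \<real>" using sR aR bR by (intro Reals_divide Reals_mult Reals_Gamma) auto
      obtain k where k: "K_fun \<alpha> s = of_real k" using KR by (elim Reals_cases)
      obtain \<sigma> where \<sigma>: "S_fun \<alpha> s = of_real \<sigma>" using SR by (elim Reals_cases)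
      obtain x where x: "Gamma (2 * s) / (Gamma a * Gamma b) = of_real x" using XR by (elim Reals_cases)
      have "calH \<alpha> Z = of_real x * (of_real \<sigma> + \<i> * of_real pi * of_real k)"
        unfolding g(2) H_rhs_def a_def[symmetric] b_def[symmetric] x k \<sigma> ..
      hence "Im (calH \<alpha> Z) = pi * x * k" by simp
      hence "of_real (Im (calH \<alpha> Z)) = of_real pi * (Gamma (2 * s) / (Gamma a * Gamma b)) * K_fun \<alpha> s" by (simp add: x k)
      thus ?thesis by simp
    qed
  qed
  have Ssum: "summable (\<lambda>n. norm (S_term \<alpha> s n))" if "summable (\<lambda>n. norm (fps_nth (log_fps a b) n))"
    using that unfolding S_term_eq a_def[symmetric] b_def[symmetric] by (simp add: norm_mult norm_power)
  show ?thesis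
    using limit[of \<alpha>] sumU generic Ssum pole' imag K_fun_0[OF two_s Re_s] S_fun_0[OF two_s Re_s]
    by (simp add: a_def[symmetric] b_def[symmetric] norm_mult norm_power)
qed

end
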